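(* Let $Z$ be a centered Pearson random variable with support $(a,+\infty)$, density $\rho_*$, and parameters $\alpha,\beta,\gamma$, i.e. $g_*(z)=\alpha z^2+\beta z+\gamma$ for $z\in(a,\infty)$. Assume $\mathbf{E}[Z^2]<\infty$ and $z^3\rho_*(z)\to0$ as $z\to a$ and as $z\to+\infty$. Let $\Phi_*(z)=\mathbf{P}[Z>z]$ and $Q(z)=(1-\alpha)z^2+\gamma$ for $z\in(a,\infty)$. Let $X\in\mathbf{D}^{1,2}$ be a centered random variable with a density $\rho$ and support $(a,+\infty)$, let $G=\langle DX;-DL^{-1}X\rangle_H$, and assume $G\ge\alpha X^2+\beta X+\gamma$ almost surely. (i) Assume in addition that there exists a constant $c>2$ such that $\mathbf{P}[X>z]\le z\rho(z)/c$ holds for all large $z$. Then for all large $z$, $$\mathbf{P}[X>z]\ \ge\ \frac{(c-2)Q(z)}{(c-2)Q(z)+2z^2}\,\Phi_*(z),$$ where the coefficient $\frac{(c-2)Q(z)}{(c-2)Q(z)+2z^2}$ converges to $\frac{(c-2)-\alpha(c-2)}{c-\alpha(c-2)}$ as $z\to\infty$. (ii) The existence of such a constant $c>2$ is guaranteed if, for some $c>2$, $g(z)\le z^2/c$ for all large $z$, where $g(x)=\mathbf{E}[G\mid X=x]$. (iii) Moreover, such a constant $c>2$ exists automatically if $G\le\bar g_*(X)$ almost surely for some quadratic function $\bar g_*(x)=\bar\alpha x^2+\bar\beta x+\bar\gamma$ with $\bar\alpha<1/2$.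
   Context: For a centered (integrable, mean zero) random variable $Z$ with density $\rho_*$, continuous on $\mathbf{R}$, positive and differentiable on the support $(a,b)$ and zero outside it, set $g_*(z)=\frac{\int_z^\infty y\rho_*(y)\,dy}{\rho_*(z)}\mathbf{1}_{(a,b)}(z)$. $Z$ is called a centered Pearson random variable with parameters $\alpha,\beta,\gamma\in\mathbf{R}$ if $g_*(z)=\alpha z^2+\beta z+\gamma$ for all $z\in(a,b)$; equivalently $\frac{\rho_*'(z)}{\rho_*(z)}=-\frac{(2\alpha+1)z+\beta}{\alpha z^2+\beta z+\gamma}$ on $(a,b)$. In general $Q(z)=z^2-zg_*'(z)+g_*(z)$, which here equals $(1-\alpha)z^2+\gamma$ on the support. The function $g(x)=\mathbf{E}[G\mid X=x]$ is defined up to null sets of the law of $X$, and equals $g(z)=\rho(z)^{-1}\int_z^\infty y\rho(y)\,dy$ almost everywhere on the support of $X$. Malliavin calculus: let $W$ be an isonormal Gaussian process over a real separable Hilbert space $H$, on a probability space $(\Omega,\mathcal{F},\mathbf{P})$ with $\mathcal{F}$ generated by $W$ (one may take $H=L^2([0,1])$ and $W$ the white noise of a standard Brownian motion). Every $X\in L^2(\Omega,\mathcal{F},\mathbf{P})$ has a unique Wiener chaos decomposition $X=\sum_{n\ge0}I_n(f_n)$, with $f_n$ symmetric in $H^{\otimes n}$, $I_n$ the $n$-th multiple Wiener integral, $I_0(f_0)=f_0=\mathbf{E}[X]$. $\mathbf{D}^{1,2}$ is the set of such $X$ with $\sum_{n\ge1}n\,n!\|f_n\|^2_{H^{\otimes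 n}}<\infty$. The Malliavin derivative of $X\in\mathbf{D}^{1,2}$ is the $H$-valued random variable $DX=\sum_{n\ge1}nI_{n-1}(f_n(r,\cdot))$ (as a function of $r$). The pseudo-inverse of the Ornstein–Uhlenbeck generator is $-L^{-1}X=\sum_{n\ge1}\frac1nI_n(f_n)$. *)

theory Defs
  imports "HOL-Probability.Probability"
begin

definition sq_integrable :: "'w measure \<Rightarrow> ('w \<Rightarrow> 'e::{real_normed_vector, second_countable_topology}) \<Rightarrow> bool"
  where "sq_integrable M X \<longleftrightarrow>
    X \<in> borel_measurable M \<and> integrable M (\<lambda>\<omega>. (norm (X \<omega>))\<^sup>2)"

definition L2_tendsto ::
  "'w measure \<Rightarrow> (nat \<Rightarrow> 'w \<Rightarrow> 'e::{real_normed_vector, second_countable_topology}) \<Rightarrow> ('w \<Rightarrow> 'e) \<Rightarrow> bool"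
  where "L2_tendsto M Y X \<longleftrightarrow>
    (\<lambda>k. \<integral>\<^sup>+\<omega>. ennreal ((norm (Y k \<omega> - X \<omega>))\<^sup>2) \<partial>M) \<longlonglongrightarrow> 0"

definition centered_gaussian :: "'w measure \<Rightarrow> ('w \<Rightarrow> real) \<Rightarrow> bool"
  where "centered_gaussian M Y \<longleftrightarrow> Y \<in> borel_measurable M \<and>
    ((AE \<omega> in M. Y \<omega> = 0) \<or> (\<exists>\<sigma>>0. distributed M lborel Y (normal_density 0 \<sigma>)))"

text \<open>
  The index space is a real separable Hilbert space of finite or infinite dimension.  The last
  conjunct says that the \<sigma>-algebra of \<open>M\<close> is generated by \<open>W\<close> up to null sets; it
  holds both for the raw generated \<sigma>-algebra and for its completion.
\<close>

definition isonormal_gaussian ::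
  "'w measure \<Rightarrow> ('h::{real_inner, complete_space, second_countable_topology} \<Rightarrow> 'w \<Rightarrow> real) \<Rightarrow> bool"
  where "isonormal_gaussian M W \<longleftrightarrow> prob_space M \<and>
    (\<forall>S c. finite S \<longrightarrow> centered_gaussian M (\<lambda>\<omega>. \<Sum>h\<in>S. c h * W h \<omega>)) \<and>
    (\<forall>h k. (\<integral>\<omega>. W h \<omega> * W k \<omega> \<partial>M) = h \<bullet> k) \<and>
    (\<forall>A\<in>sets M. \<exists>B\<in>sigma_sets (space M) {W h -` S \<inter> space M | h S. S \<in> sets borel}.
       AE \<omega> in M. \<omega> \<in> A \<longleftrightarrow> \<omega> \<in> B)"

text \<open>
  The Hilbert tensor power \<open>H\<^sup>\<otimes>\<^sup>n\<close> is realized as the space of Hilbert--Schmidt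
  \<open>n\<close>-linear forms on \<open>H\<close>: a form \<open>f\<close> is evaluated on lists of length \<open>n\<close>
  (its values on other lists are irrelevant), and the elementary tensor \<open>h\<^sub>1 \<otimes> \<dots> \<otimes> h\<^sub>n\<close> is
  the form \<open>[x\<^sub>1, \<dots>, x\<^sub>n] \<mapsto> \<langle>h\<^sub>1, x\<^sub>1\<rangle> \<dots> \<langle>h\<^sub>n, x\<^sub>n\<rangle>\<close>.  The supremum over all finite orthonormal
  sets below is the sum of the \<open>f(e\<^bsub>i1\<^esub>, \<dots>, e\<^bsub>in\<^esub>)\<^sup>2\<close> over any orthonormal basis \<open>(e\<^sub>i)\<close>, that is,
  the squared norm of \<open>f\<close> in \<open>H\<^sup>\<otimes>\<^sup>n\<close>.
\<close>

definition tensor_norm_sq :: "nat \<Rightarrow> ('h::real_inner list \<Rightarrow> real) \<Rightarrow> ennreal"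
  where "tensor_norm_sq n f =
    (SUP B\<in>{B. finite B \<and> pairwise orthogonal B \<and> (\<forall>b\<in>B. norm b = 1)}.
       \<Sum>xs\<in>{xs. set xs \<subseteq> B \<and> length xs = n}. ennreal ((f xs)\<^sup>2))"

definition symmetric_tensors :: "nat \<Rightarrow> ('h::real_inner list \<Rightarrow> real) set"
  where "symmetric_tensors n = {f.
    (\<forall>xs ys. length xs + length ys + 1 = n \<longrightarrow> linear (\<lambda>x. f (xs @ x # ys))) \<and>
    (\<forall>xs ys. length xs = n \<longrightarrow> mset xs = mset ys \<longrightarrow> f xs = f ys) \<and>
    tensor_norm_sq n f < \<top>}"

definition tensor_power :: "'h::real_inner \<Rightarrow> 'h list \<Rightarrow> real"
  where "tensor_power h xs = (\<Prod>x\<leftarrow>xs. h \<bullet> x)"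

fun hermite :: "nat \<Rightarrow> real \<Rightarrow> real" where
  "hermite 0 x = 1"
| "hermite (Suc 0) x = x"
| "hermite (Suc (Suc n)) x = x * hermite (Suc n) x - real (Suc n) * hermite n x"

text \<open>
  \<open>multiple_integral M W n f Y\<close>: the random variable \<open>Y\<close> is a version of \<open>I\<^sub>n(f)\<close>.  The map
  \<open>I\<^sub>n\<close> is the continuous linear extension of
  \<open>I\<^sub>n(h\<^sup>\<otimes>\<^sup>n) = \<parallel>h\<parallel>\<^sup>n He\<^sub>n(W(h) / \<parallel>h\<parallel>)\<close> from the span of the powers \<open>h\<^sup>\<otimes>\<^sup>n\<close> to all symmetric
  tensors.  The case \<open>h = 0\<close> is correct because of \<open>0 ^ 0 = 1\<close>.
\<close>

definition multiple_integral ::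
  "'w measure \<Rightarrow> ('h::real_inner \<Rightarrow> 'w \<Rightarrow> real) \<Rightarrow> nat \<Rightarrow> ('h list \<Rightarrow> real) \<Rightarrow> ('w \<Rightarrow> real) \<Rightarrow> bool"
  where "multiple_integral M W n f Y \<longleftrightarrow>
    f \<in> symmetric_tensors n \<and> sq_integrable M Y \<and>
    (\<exists>S :: nat \<Rightarrow> (real \<times> 'h) list.
       (\<lambda>k. tensor_norm_sq n (\<lambda>xs. (\<Sum>(c, h)\<leftarrow>S k. c * tensor_power h xs) - f xs)) \<longlonglongrightarrow> 0 \<and>
       L2_tendsto M
         (\<lambda>k \<omega>. \<Sum>(c, h)\<leftarrow>S k. c * (norm h ^ n * hermite n (W h \<omega> / norm h))) Y)"

text \<open>\<open>X = \<Sum>\<^sub>n I\<^sub>n(f\<^sub>n)\<close> in \<open>L\<^sup>2\<close>, where \<open>J n\<close> is a version of \<open>I\<^sub>n(f\<^sub>n)\<close>.\<close>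

definition chaos_expansion ::
  "'w measure \<Rightarrow> ('h::real_inner \<Rightarrow> 'w \<Rightarrow> real) \<Rightarrow> (nat \<Rightarrow> 'h list \<Rightarrow> real) \<Rightarrow> (nat \<Rightarrow> 'w \<Rightarrow> real)
    \<Rightarrow> ('w \<Rightarrow> real) \<Rightarrow> bool"
  where "chaos_expansion M W f J X \<longleftrightarrow>
    sq_integrable M X \<and> (\<forall>n. multiple_integral M W n (f n) (J n)) \<and>
    L2_tendsto M (\<lambda>N \<omega>. \<Sum>n<N. J n \<omega>) X"

definition D12_kernels :: "(nat \<Rightarrow> 'h::real_inner list \<Rightarrow> real) \<Rightarrow> bool"
  where "D12_kernels f \<longleftrightarrow> (\<Sum>n. ennreal (real n * fact n) * tensor_norm_sq n (f n)) < \<top>"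

definition D12 :: "'w measure \<Rightarrow> ('h::real_inner \<Rightarrow> 'w \<Rightarrow> real) \<Rightarrow> ('w \<Rightarrow> real) set"
  where "D12 M W = {X. \<exists>f J. chaos_expansion M W f J X \<and> D12_kernels f}"

text \<open>
  The kernel \<open>f\<^sub>n(r, \<cdot>)\<close>, as an \<open>H\<close>-valued object in \<open>r\<close>, pairs with \<open>h\<close> to the
  \<open>(n-1)\<close>-linear form \<open>xs \<mapsto> f\<^sub>n(h # xs)\<close>.  So \<open>V\<close> is a version of the \<open>H\<close>-valued random
  variable \<open>I\<^bsub>n-1\<^esub>(f\<^sub>n(r, \<cdot>))\<close> iff \<open>\<langle>V, h\<rangle>\<close> is a version of the integral of that form for all
  \<open>h\<close>.  Here \<open>m\<close> stands for \<open>n - 1\<close>.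
\<close>

definition kernel_integral ::
  "'w measure \<Rightarrow> ('h::{real_inner, second_countable_topology} \<Rightarrow> 'w \<Rightarrow> real) \<Rightarrow> nat
    \<Rightarrow> ('h list \<Rightarrow> real) \<Rightarrow> ('w \<Rightarrow> 'h) \<Rightarrow> bool"
  where "kernel_integral M W m f V \<longleftrightarrow> sq_integrable M V \<and>
    (\<forall>h. multiple_integral M W m (\<lambda>xs. f (h # xs)) (\<lambda>\<omega>. V \<omega> \<bullet> h))"

text \<open>\<open>U\<close> is a version of \<open>DX = \<Sum>\<^bsub>n\<ge>1\<^esub> n I\<^bsub>n-1\<^esub>(f\<^sub>n(r, \<cdot>))\<close>, the series converging in \<open>L\<^sup>2(\<Omega>; H)\<close>.\<close>

definition malliavin_derivative ::
  "'w measure \<Rightarrow> ('h::{real_inner, second_countable_topology} \<Rightarrow> 'w \<Rightarrow> real) \<Rightarrow> ('w \<Rightarrow> real)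
    \<Rightarrow> ('w \<Rightarrow> 'h) \<Rightarrow> bool"
  where "malliavin_derivative M W X U \<longleftrightarrow>
    (\<exists>f J V. chaos_expansion M W f J X \<and> D12_kernels f \<and>
       (\<forall>m. kernel_integral M W m (f (Suc m)) (V m)) \<and> sq_integrable M U \<and>
       L2_tendsto M (\<lambda>N \<omega>. \<Sum>m<N. real (Suc m) *\<^sub>R V m \<omega>) U)"

text \<open>\<open>Y\<close> is a version of \<open>-L\<^sup>-\<^sup>1X = \<Sum>\<^bsub>n\<ge>1\<^esub> (1/n) I\<^sub>n(f\<^sub>n)\<close>.\<close>

definition neg_OU_inverse ::
  "'w measure \<Rightarrow> ('h::real_inner \<Rightarrow> 'w \<Rightarrow> real) \<Rightarrow> ('w \<Rightarrow> real) \<Rightarrow> ('w \<Rightarrow> real) \<Rightarrow> bool"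
  where "neg_OU_inverse M W X Y \<longleftrightarrow>
    (\<exists>f J. chaos_expansion M W f J X \<and> sq_integrable M Y \<and>
       L2_tendsto M (\<lambda>N \<omega>. \<Sum>n=1..N. (1 / real n) * J n \<omega>) Y)"

definition law_support :: "'w measure \<Rightarrow> ('w \<Rightarrow> real) \<Rightarrow> real set"
  where "law_support M X = {x. \<forall>e>0. 0 < \<P>(\<omega> in M. dist (X \<omega>) x < e)}"

definition g_star :: "(real \<Rightarrow> real) \<Rightarrow> ereal \<Rightarrow> ereal \<Rightarrow> real \<Rightarrow> real"
  where "g_star \<rho> a b z = (LBINT y:{z..}. y * \<rho> y) / \<rho> z * indicator (einterval a b) z"

definition centered_pearson ::
  "'v measure \<Rightarrow> ('v \<Rightarrow> real) \<Rightarrow> (real \<Rightarrow> real) \<Rightarrow> ereal \<Rightarrow> ereal \<Rightarrow> real \<Rightarrow> real \<Rightarrow> real \<Rightarrow> bool"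
  where "centered_pearson N Z \<rho> a b \<alpha> \<beta> \<gamma> \<longleftrightarrow>
    prob_space N \<and> integrable N Z \<and> (\<integral>\<omega>. Z \<omega> \<partial>N) = 0 \<and>
    distributed N lborel Z (\<lambda>z. ennreal (\<rho> z)) \<and>
    a < b \<and> continuous_on UNIV \<rho> \<and>
    (\<forall>z\<in>einterval a b. 0 < \<rho> z \<and> \<rho> differentiable (at z)) \<and>
    (\<forall>z. z \<notin> einterval a b \<longrightarrow> \<rho> z = 0) \<and>
    (\<forall>z\<in>einterval a b. g_star \<rho> a b z = \<alpha> * z\<^sup>2 + \<beta> * z + \<gamma>)"

definition pearson_Q :: "real \<Rightarrow> real \<Rightarrow> real \<Rightarrow> real"
  where "pearson_Q \<alpha> \<gamma> z = (1 - \<alpha>) * z\<^sup>2 + \<gamma>"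

text \<open>\<open>g(x) = E[G | X = x]\<close>; this determines \<open>g\<close> up to null sets of the law of \<open>X\<close>.\<close>

definition cond_exp_given ::
  "'w measure \<Rightarrow> ('w \<Rightarrow> real) \<Rightarrow> ('w \<Rightarrow> real) \<Rightarrow> (real \<Rightarrow> real) \<Rightarrow> bool"
  where "cond_exp_given M G X g \<longleftrightarrow> g \<in> borel_measurable borel \<and>
    (AE \<omega> in M. real_cond_exp M (vimage_algebra (space M) X borel) G \<omega> = g (X \<omega>))"

text \<open>
  \<open>P[X > z] \<le> z \<rho>(z) / c\<close> for all large \<open>z\<close>.  As \<open>\<rho>\<close> is an arbitrary version of the density,
  the inequality is required for almost every large \<open>z\<close> only.
\<close>

definition tail_density_bound ::
  "'w measure \<Rightarrow> ('w \<Rightarrow> real) \<Rightarrow> (real \<Rightarrow> real) \<Rightarrow> real \<Rightarrow> bool"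
  where "tail_density_bound M X \<rho> c \<longleftrightarrow>
    (\<exists>z0. AE z in lborel. z0 \<le> z \<longrightarrow> \<P>(\<omega> in M. z < X \<omega>) \<le> z * \<rho> z / c)"

end

theory Submission
  imports Defs "HOL-Real_Asymp.Real_Asymp"
begin

text \<open>
  The Malliavin hypotheses enter only through the identity \<open>E[X f(X)] = E[f'(X) G]\<close>.  For finite sums of
  \<open>\<parallel>h\<parallel>\<^sup>n He\<^sub>n(W(h) / \<parallel>h\<parallel>)\<close> it is one-dimensional Gaussian integration by parts in the direction \<open>h\<close>, after
  that coordinate of \<open>W\<close> is resampled independently of the rest; it passes to chaos expansions by
  \<open>L\<^sup>2\<close> limits that are only weak in the \<open>H\<close>-valued derivatives.

  With \<open>\<phi>(z) = E[X; X > z]\<close> the identity becomes \<open>E[G; X \<in> B] = \<integral>\<^sub>B \<phi>\<close>, so \<open>\<phi> = g \<rho>\<close> and \<open>\<phi> \<ge> g\<^sub>* \<rho>\<close> almost everywhere,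
  and (ii), (iii) follow from \<open>\<phi>(z) \<ge> z P[X > z]\<close>.  For (i) let \<open>p = \<Phi>\<^sub>* / \<phi>\<^sub>*\<close> and \<open>s = (1 - \<Phi>\<^sub>*) / \<phi>\<^sub>*\<close>.  Then
  \<open>g\<^sub>* p' = x p - 1 \<in> [-g\<^sub>* / Q, 0]\<close> and \<open>g\<^sub>* s' = 1 + x s \<ge> 0\<close>, and integrating \<open>p' \<phi>\<close> over \<open>(z, \<infinity>)\<close> and
  \<open>s' \<phi>\<close> over \<open>(a, z]\<close> gives \<open>P[X > z] \<ge> \<Phi>\<^sub>*(z) - Q(z)\<^bsup>-1\<^esup> \<integral>\<^sub>z\<^sup>\<infinity> \<phi>\<close>.  The tail hypothesis bounds the last integral
  by \<open>2 z\<^sup>2 P[X > z] / (c - 2)\<close>.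
\<close>

subsection \<open>Finite-dimensional laws are determined by characteristic functions\<close>

text \<open>Part (i) is Stein's method. Write \<open>q\<close> for the Pearson quadratic. The
  function that is \<open>- P.tail z * s\<close> left of \<open>z\<close> and
  \<open>- (1 - P.tail z) * p\<close> right of it solves
  \<open>q x * f' x - x * f x = indicator {z<..} x - P.tail z\<close> off \<open>z\<close>. Its
  branches agree at \<open>z\<close> but its derivative jumps there, so they are estimated
  separately, on compact intervals where no growth condition arises, and recombined with these
  weights. On the Malliavin side the obstacle is that a kernel integral is known only through its
  pairings \<open>V \<bullet> h\<close> with fixed vectors, so norm convergence of the approximating
  derivatives is not at hand. Pairings plus a norm bound suffice, since each derivative is tested
  against one fixed square integrable variable. \<open>G\<close> is merely integrable, which
  confines the test functions to bounded derivatives. The same cosine criterion gives joint laws of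
  \<open>W\<close>, of which only linear combinations are prescribed.\<close>

lemma finite_measure_eqI_cos:
  fixes \<mu> \<nu> :: "real measure"
  assumes "finite_measure \<mu>" "finite_measure \<nu>" and sets: "sets \<mu> = sets borel" "sets \<nu> = sets borel"
    and cos: "\<And>t \<theta>. (\<integral>x. cos (t * x + \<theta>) \<partial>\<mu>) = (\<integral>x. cos (t * x + \<theta>) \<partial>\<nu>)"
  shows "\<mu> = \<nu>"
proof -
  interpret m: finite_measure \<mu> by fact
  interpret n: finite_measure \<nu> by fact
  have sp: "space \<mu> = UNIV" "space \<nu> = UNIV"
    using sets_eq_imp_space_eq[OF sets(1)] sets_eq_imp_space_eq[OF sets(2)] by auto
  define r where "r = measure \<mu> UNIV"
  have r': "measure \<nu> UNIV = r" using cos[of 0 0] by (simp add: r_def sp)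
  show ?thesis
  proof (cases "r = 0")
    case True
    show ?thesis
    proof (rule measure_eqI)
      show "sets \<mu> = sets \<nu>" using sets by simp
      fix A assume "A \<in> sets \<mu>"
      have "measure \<mu> A \<le> measure \<mu> UNIV" "measure \<nu> A \<le> measure \<nu> UNIV"
        using m.bounded_measure[of A] n.bounded_measure[of A] sp by auto
      with True r' have "measure \<mu> A = 0" "measure \<nu> A = 0"
        by (auto simp: r_def intro!: antisym)
      then show "emeasure \<mu> A = emeasure \<nu> A"
        by (simp add: m.emeasure_eq_measure n.emeasure_eq_measure)
    qed
  next
    case False
    then have r: "r > 0" using measure_nonneg[of \<mu> UNIV] unfolding r_def by linarith
    \<comment> \<open>The uniqueness theorem concerns probability laws, so both measures are divided
      by their common total mass.\<close>
    define sc where "sc K = scale_measure (ennreal (1 / r)) (K :: real measure)" for K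
    have rd: "real_distribution (sc K)" if "sets K = sets borel" "finite_measure K" "measure K UNIV = r" for K
    proof (rule real_distribution.intro)
      interpret finite_measure K by fact
      have "space K = UNIV" using sets_eq_imp_space_eq[OF that(1)] by simp
      then show "prob_space (sc K)"
        using r that(3) by (intro prob_spaceI)
          (simp add: sc_def emeasure_eq_measure space_scale_measure ennreal_mult[symmetric])
      show "real_distribution_axioms (sc K)"
        by unfold_locales (simp add: sc_def that)
    qed
    \<comment> \<open>The phase \<open>- pi / 2\<close> turns the cosine into a sine, so real
      cosines with a free phase carry the whole characteristic function.\<close>
    have ch: "char (sc K) t = (1 / r) *\<^sub>R Complex (\<integral>x. cos (t * x) \<partial>K) (\<integral>x. cos (t * x - pi / 2) \<partial>K)"
      if "sets K = sets borel" "finite_measure K" for K t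
    proof -
      interpret finite_measure K by fact
      note [measurable_cong] = that(1)
      have i: "integrable K (\<lambda>x. iexp (t * x))"
        by (rule integrable_const_bound[where B=1]) auto
      have "char (sc K) t = (1 / r) *\<^sub>R (\<integral>x. iexp (t * x) \<partial>K)"
      proof -
        have "sc K = density K (\<lambda>_. ennreal (1 / r))"
          by (rule measure_eqI) (auto simp: sc_def emeasure_density nn_integral_cmult)
        then show ?thesis unfolding char_def
          using r by (simp add: integral_density)
      qed
      moreover have "(\<integral>x. iexp (t * x) \<partial>K) = Complex (\<integral>x. cos (t * x) \<partial>K) (\<integral>x. cos (t * x - pi / 2) \<partial>K)"
      proof (rule complex_eqI)
        show "Re (\<integral>x. iexp (t * x) \<partial>K) = Re (Complex (\<integral>x. cos (t * x) \<partial>K) (\<integral>x. cos (t * x - pi / 2) \<partial>K))"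
          using i by (subst integral_Re[symmetric]) (simp_all add: Re_exp)
        show "Im (\<integral>x. iexp (t * x) \<partial>K) = Im (Complex (\<integral>x. cos (t * x) \<partial>K) (\<integral>x. cos (t * x - pi / 2) \<partial>K))"
          using i by (subst integral_Im[symmetric]) (simp_all add: Im_exp cos_diff)
      qed
      ultimately show ?thesis by simp
    qed
    have "sc \<mu> = sc \<nu>"
    proof (rule Levy_uniqueness[OF rd rd])
      show "char (sc \<mu>) = char (sc \<nu>)"
        using ch[OF sets(1) assms(1)] ch[OF sets(2) assms(2)] cos[of _ 0] cos[of _ "- (pi / 2)"]
        by (intro ext) simp
    qed (use sets assms r' in \<open>auto simp: r_def\<close>)
    show ?thesis
    proof (rule measure_eqI)
      show "sets \<mu> = sets \<nu>" using sets by simp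
      fix A assume "A \<in> sets \<mu>"
      have "emeasure (sc \<mu>) A = emeasure (sc \<nu>) A" using \<open>sc \<mu> = sc \<nu>\<close> by simp
      then have "ennreal r * (ennreal (1 / r) * emeasure \<mu> A) = ennreal r * (ennreal (1 / r) * emeasure \<nu> A)"
        by (simp add: sc_def)
      then show "emeasure \<mu> A = emeasure \<nu> A"
        using r by (simp add: mult.assoc[symmetric] ennreal_mult[symmetric])
    qed
  qed
qed

lemma cos_times_cos_shift:
  "cos (u + \<theta>) * cos (v + \<phi>) = (cos (\<theta> + \<phi> + (u + v)) + cos (\<theta> - \<phi> + (u - v))) / 2" for u v :: real
proof -
  have *: "u + \<theta> - (v + \<phi>) = \<theta> - \<phi> + (u - v)" "u + \<theta> + (v + \<phi>) = \<theta> + \<phi> + (u + v)" by auto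
  show ?thesis unfolding cos_times_cos * by (simp add: add.commute)
qed

lemma two_plus_cos_nonneg: "0 \<le> 2 + cos x" for x :: real
  using cos_ge_minus_one[of x] by linarith

lemma finite_measure_density_le:
  assumes "finite_measure K" and [measurable]: "w \<in> borel_measurable K" and "\<And>x. w x \<le> b"
  shows "finite_measure (density K (\<lambda>x. ennreal (w x)))"
proof -
  interpret finite_measure K by fact
  have "(\<integral>\<^sup>+x. ennreal (w x) \<partial>K) \<le> (\<integral>\<^sup>+x. ennreal b \<partial>K)"
    by (intro nn_integral_mono ennreal_leI assms)
  also have "\<dots> < \<infinity>" by (simp add: emeasure_eq_measure ennreal_mult_less_top)
  finally show "finite_measure (density K (\<lambda>x. ennreal (w x)))"
    by (intro finite_measureI) (simp add: emeasure_density cong: nn_integral_cong)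
qed

text \<open>By the product formula, the weight times a cosine is a combination of cosines of the sum
  and the difference of the two arguments. Cosine integrals of linear forms therefore determine the
  weighted law of a single coordinate.\<close>

lemma integral_cos_distr_density:
  fixes w c :: "'a \<Rightarrow> real"
  assumes "finite_measure K" and [measurable]: "w \<in> borel_measurable K" "c \<in> borel_measurable K"
  shows "(\<integral>x. cos (t * x + \<phi>) \<partial>distr (density K (\<lambda>x. ennreal (2 + cos (\<theta> + w x)))) borel c) =
    2 * (\<integral>x. cos (\<phi> + t * c x) \<partial>K) +
      ((\<integral>x. cos (\<phi> + \<theta> + (t * c x + w x)) \<partial>K) + (\<integral>x. cos (\<phi> - \<theta> + (t * c x - w x)) \<partial>K)) / 2"
proof -
  interpret finite_measure K by fact
  have i: "integrable K (\<lambda>x. cos (u x))" if "u \<in> borel_measurable K" for u :: "_ \<Rightarrow> real"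
    using that by (intro integrable_const_bound[where B=1]) auto
  have "(\<integral>x. cos (t * x + \<phi>) \<partial>distr (density K (\<lambda>x. ennreal (2 + cos (\<theta> + w x)))) borel c) =
     (\<integral>x. (2 + cos (\<theta> + w x)) * cos (t * c x + \<phi>) \<partial>K)"
    by (simp add: integral_distr integral_density two_plus_cos_nonneg)
  also have "\<dots> = (\<integral>x. 2 * cos (\<phi> + t * c x) + (cos (\<phi> + \<theta> + (t * c x + w x)) + cos (\<phi> - \<theta> + (t * c x - w x))) / 2 \<partial>K)"
  proof (intro Bochner_Integration.integral_cong refl)
    fix x
    show "(2 + cos (\<theta> + w x)) * cos (t * c x + \<phi>) =
      2 * cos (\<phi> + t * c x) + (cos (\<phi> + \<theta> + (t * c x + w x)) + cos (\<phi> - \<theta> + (t * c x - w x))) / 2"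
      using cos_times_cos_shift[of "t * c x" \<phi> "w x" \<theta>] by (simp add: algebra_simps)
  qed
  also have "\<dots> = 2 * (\<integral>x. cos (\<phi> + t * c x) \<partial>K) + ((\<integral>x. cos (\<phi> + \<theta> + (t * c x + w x)) \<partial>K) + (\<integral>x. cos (\<phi> - \<theta> + (t * c x - w x)) \<partial>K)) / 2"
    by (simp add: i)
  finally show ?thesis .
qed

text \<open>The constant \<open>2\<close>, added to make the cosine a density, is subtracted again,
  so that restricting one coordinate to \<open>S\<close> leaves a plain cosine integral in the
  others.\<close>

lemma integral_cos_density_indicator:
  fixes w c :: "'a \<Rightarrow> real"
  assumes "finite_measure K" and [measurable]: "w \<in> borel_measurable K" "c \<in> borel_measurable K" "S \<in> sets borel"
  shows "(\<integral>x. cos (\<theta> + w x) \<partial>density K (\<lambda>x. ennreal (indicator S (c x)))) =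
    (\<integral>x. indicator S (c x) * (2 + cos (\<theta> + w x)) \<partial>K) - 2 * (\<integral>x. indicator S (c x) \<partial>K)"
proof -
  interpret finite_measure K by fact
  have i: "integrable K (\<lambda>x. indicator S (c x) :: real)"
    by (intro integrable_const_bound[where B=1]) auto
  have i2: "integrable K (\<lambda>x. indicator S (c x) * cos (\<theta> + w x))"
    by (intro integrable_const_bound[where B=1]) (auto split: split_indicator)
  have "(\<integral>x. cos (\<theta> + w x) \<partial>density K (\<lambda>x. ennreal (indicator S (c x)))) =
     (\<integral>x. indicator S (c x) * cos (\<theta> + w x) \<partial>K)"
    by (subst integral_density) auto
  then show ?thesis using i i2 by (simp add: distrib_left)
qed

lemma measure_density_indicator_boxes:
  fixes D :: "'i \<Rightarrow> 'a \<Rightarrow> real"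
  assumes I: "finite I" and D: "\<And>i. i \<in> insert j I \<Longrightarrow> D i \<in> borel_measurable K"
    and S: "\<And>i. i \<in> insert j I \<Longrightarrow> S i \<in> sets borel"
  shows "measure (density K (\<lambda>x. ennreal (indicator (S j) (D j x)))) {x\<in>space K. \<forall>i\<in>I. D i x \<in> S i} =
     measure K {x\<in>space K. \<forall>i\<in>insert j I. D i x \<in> S i}"
proof -
  have [measurable]: "D i \<in> borel_measurable K" if "i \<in> I" for i using D that by auto
  have [measurable]: "S i \<in> sets borel" if "i \<in> I" for i using S that by auto
  have [measurable]: "D j \<in> borel_measurable K" "S j \<in> sets borel" using D S by auto
  have m: "{x\<in>space K. \<forall>i\<in>I. D i x \<in> S i} \<in> sets K" using I by measurable
  have "emeasure (density K (\<lambda>x. ennreal (indicator (S j) (D j x)))) {x\<in>space K. \<forall>i\<in>I. D i x \<in> S i} =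
     (\<integral>\<^sup>+x. ennreal (indicator (S j) (D j x)) * indicator {x\<in>space K. \<forall>i\<in>I. D i x \<in> S i} x \<partial>K)"
    using m by (intro emeasure_density) auto
  also have "\<dots> = (\<integral>\<^sup>+x. indicator {x\<in>space K. \<forall>i\<in>insert j I. D i x \<in> S i} x \<partial>K)"
    by (intro nn_integral_cong) (auto split: split_indicator)
  also have "\<dots> = emeasure K {x\<in>space K. \<forall>i\<in>insert j I. D i x \<in> S i}"
  proof (rule nn_integral_indicator)
    have "{x\<in>space K. \<forall>i\<in>insert j I. D i x \<in> S i} = {x\<in>space K. \<forall>i\<in>I. D i x \<in> S i} \<inter> {x\<in>space K. D j x \<in> S j}" by auto
    also have "\<dots> \<in> sets K" using m by measurable
    finally show "{x\<in>space K. \<forall>i\<in>insert j I. D i x \<in> S i} \<in> sets K" .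
  qed
  finally show ?thesis by (simp add: measure_def)
qed

lemma sum_upd_notin:
  "j \<notin> I \<Longrightarrow> (\<Sum>i\<in>I. (if i = j then u else v i) * d i) = (\<Sum>i\<in>I. v i * d i)" for u :: real
  by (intro sum.cong) auto

text \<open>Induction on the coordinates, with the measures generalized. Restricting both measures
  to the event that the new coordinate lies in \<open>S j\<close> preserves the cosine hypothesis
  for the remaining ones, so the induction hypothesis applies to the restricted measures.\<close>

lemma measure_boxes_eq_cos:
  fixes C :: "'i \<Rightarrow> 'a \<Rightarrow> real" and C' :: "'i \<Rightarrow> 'b \<Rightarrow> real"
  assumes "finite I" "finite_measure \<mu>" "finite_measure \<nu>"
    and "\<And>i. i \<in> I \<Longrightarrow> C i \<in> borel_measurable \<mu>"
    and "\<And>i. i \<in> I \<Longrightarrow> C' i \<in> borel_measurable \<nu>"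
    and "\<And>s \<theta>. (\<integral>x. cos (\<theta> + (\<Sum>i\<in>I. s i * C i x)) \<partial>\<mu>) = (\<integral>x. cos (\<theta> + (\<Sum>i\<in>I. s i * C' i x)) \<partial>\<nu>)"
    and "\<And>i. i \<in> I \<Longrightarrow> S i \<in> sets borel"
  shows "measure \<mu> {x\<in>space \<mu>. \<forall>i\<in>I. C i x \<in> S i} = measure \<nu> {x\<in>space \<nu>. \<forall>i\<in>I. C' i x \<in> S i}"
  using assms
proof (induction I arbitrary: \<mu> \<nu> rule: finite_induct)
  case empty
  from empty.prems(5)[of 0] show ?case by simp
next
  case (insert j I)
  interpret m: finite_measure \<mu> by fact
  interpret n: finite_measure \<nu> by fact
  have [measurable]: "\<And>i. i \<in> I \<Longrightarrow> C i \<in> borel_measurable \<mu>" "C j \<in> borel_measurable \<mu>"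
    "\<And>i. i \<in> I \<Longrightarrow> C' i \<in> borel_measurable \<nu>" "C' j \<in> borel_measurable \<nu>" "S j \<in> sets borel"
    using insert.prems by auto
  note upd = sum_upd_notin[OF insert.hyps(2)]
  have fin3: "finite_measure (density K (\<lambda>x. ennreal (2 + cos (w x))))"
    if "finite_measure K" "w \<in> borel_measurable K" for K :: "'a measure" and w
    using that cos_le_one by (intro finite_measure_density_le[where b=3]) auto
  have fin3': "finite_measure (density K (\<lambda>x. ennreal (2 + cos (w x))))"
    if "finite_measure K" "w \<in> borel_measurable K" for K :: "'b measure" and w
    using that cos_le_one by (intro finite_measure_density_le[where b=3]) auto
  \<comment> \<open>The weight \<open>2 + cos(\<dots>)\<close> is positive, so one-dimensional uniqueness applies to the law of the
     \<open>j\<close>-th coordinate under it.\<close>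
  have eq: "distr (density \<mu> (\<lambda>x. ennreal (2 + cos (\<theta> + (\<Sum>i\<in>I. s i * C i x))))) borel (C j) =
        distr (density \<nu> (\<lambda>x. ennreal (2 + cos (\<theta> + (\<Sum>i\<in>I. s i * C' i x))))) borel (C' j)" for s \<theta>
  proof (rule finite_measure_eqI_cos)
    show "finite_measure (distr (density \<mu> (\<lambda>x. ennreal (2 + cos (\<theta> + (\<Sum>i\<in>I. s i * C i x))))) borel (C j))"
      by (intro finite_measure.finite_measure_distr fin3 insert.prems) auto
    show "finite_measure (distr (density \<nu> (\<lambda>x. ennreal (2 + cos (\<theta> + (\<Sum>i\<in>I. s i * C' i x))))) borel (C' j))"
      by (intro finite_measure.finite_measure_distr fin3' insert.prems) auto
    fix t \<phi>
    \<comment> \<open>The coefficient at \<open>j\<close> is \<open>t\<close>; the others are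
      \<open>0\<close>, \<open>s\<close> and \<open>- s\<close> in turn, which yields the three
      integrals of the product formula.\<close>
    have e1: "(\<integral>x. cos (\<phi> + t * C j x) \<partial>\<mu>) = (\<integral>x. cos (\<phi> + t * C' j x) \<partial>\<nu>)"
      using insert.prems(5)[of \<phi> "\<lambda>i. if i = j then t else 0"] insert.hyps by (simp add: upd)
    have e2: "(\<integral>x. cos (\<phi> + \<theta> + (t * C j x + (\<Sum>i\<in>I. s i * C i x))) \<partial>\<mu>) =
       (\<integral>x. cos (\<phi> + \<theta> + (t * C' j x + (\<Sum>i\<in>I. s i * C' i x))) \<partial>\<nu>)"
      using insert.prems(5)[of "\<phi> + \<theta>" "\<lambda>i. if i = j then t else s i"] insert.hyps by (simp add: upd)
    have e3: "(\<integral>x. cos (\<phi> - \<theta> + (t * C j x - (\<Sum>i\<in>I. s i * C i x))) \<partial>\<mu>) =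
       (\<integral>x. cos (\<phi> - \<theta> + (t * C' j x - (\<Sum>i\<in>I. s i * C' i x))) \<partial>\<nu>)"
      using insert.prems(5)[of "\<phi> - \<theta>" "\<lambda>i. if i = j then t else - s i"] insert.hyps by (simp add: upd sum_negf)
    show "(\<integral>x. cos (t * x + \<phi>) \<partial>distr (density \<mu> (\<lambda>x. ennreal (2 + cos (\<theta> + (\<Sum>i\<in>I. s i * C i x))))) borel (C j)) =
       (\<integral>x. cos (t * x + \<phi>) \<partial>distr (density \<nu> (\<lambda>x. ennreal (2 + cos (\<theta> + (\<Sum>i\<in>I. s i * C' i x))))) borel (C' j))"
      by (subst (1 2) integral_cos_distr_density) (use insert.prems in \<open>auto simp: e1 e2 e3\<close>)
  qed auto
  have weighted: "(\<integral>x. indicator (S j) (C j x) * (2 + cos (\<theta> + (\<Sum>i\<in>I. s i * C i x))) \<partial>\<mu>) =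
     (\<integral>x. indicator (S j) (C' j x) * (2 + cos (\<theta> + (\<Sum>i\<in>I. s i * C' i x))) \<partial>\<nu>)" for s \<theta>
  proof -
    have "(\<integral>x. indicator (S j) (C j x) * (2 + cos (\<theta> + (\<Sum>i\<in>I. s i * C i x))) \<partial>\<mu>) =
        (\<integral>x. indicator (S j) x \<partial>distr (density \<mu> (\<lambda>x. ennreal (2 + cos (\<theta> + (\<Sum>i\<in>I. s i * C i x))))) borel (C j))"
      by (subst integral_distr, simp, simp, subst integral_density) (auto simp: two_plus_cos_nonneg mult.commute)
    also have "\<dots> = (\<integral>x. indicator (S j) (C' j x) * (2 + cos (\<theta> + (\<Sum>i\<in>I. s i * C' i x))) \<partial>\<nu>)"
      unfolding eq
      by (subst integral_distr, simp, simp, subst integral_density) (auto simp: two_plus_cos_nonneg mult.commute)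
    finally show ?thesis .
  qed
  define \<mu>' where "\<mu>' = density \<mu> (\<lambda>x. ennreal (indicator (S j) (C j x)))"
  define \<nu>' where "\<nu>' = density \<nu> (\<lambda>x. ennreal (indicator (S j) (C' j x)))"
  \<comment> \<open>With zero phase and zero coefficients the weight is the constant
    \<open>3\<close>.\<close>
  have ind: "(\<integral>x. indicator (S j) (C j x) \<partial>\<mu>) = (\<integral>x. indicator (S j) (C' j x) \<partial>\<nu> :: real)"
    using weighted[of 0 "\<lambda>_. 0"] by simp
  have "measure \<mu>' {x\<in>space \<mu>'. \<forall>i\<in>I. C i x \<in> S i} = measure \<nu>' {x\<in>space \<nu>'. \<forall>i\<in>I. C' i x \<in> S i}"
  proof (rule insert.IH)
    show "finite_measure \<mu>'" "finite_measure \<nu>'"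
      unfolding \<mu>'_def \<nu>'_def
      by (auto intro!: finite_measure_density_le[where b=1] insert.prems simp: indicator_le_1)
    show "(\<integral>x. cos (\<theta> + (\<Sum>i\<in>I. s i * C i x)) \<partial>\<mu>') = (\<integral>x. cos (\<theta> + (\<Sum>i\<in>I. s i * C' i x)) \<partial>\<nu>')" for s \<theta>
      unfolding \<mu>'_def \<nu>'_def
      by (subst (1 2) integral_cos_density_indicator) (use insert.prems in \<open>auto simp: weighted ind\<close>)
  qed (use insert.prems in \<open>auto simp: \<mu>'_def \<nu>'_def\<close>)
  moreover have "measure \<mu>' {x\<in>space \<mu>'. \<forall>i\<in>I. C i x \<in> S i} = measure \<mu> {x\<in>space \<mu>. \<forall>i\<in>insert j I. C i x \<in> S i}"
    using measure_density_indicator_boxes[of I j C \<mu> S] insert by (simp add: \<mu>'_def)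
  moreover have "measure \<nu>' {x\<in>space \<nu>'. \<forall>i\<in>I. C' i x \<in> S i} = measure \<nu> {x\<in>space \<nu>. \<forall>i\<in>insert j I. C' i x \<in> S i}"
    using measure_density_indicator_boxes[of I j C' \<nu> S] insert by (simp add: \<nu>'_def)
  ultimately show ?case by simp
qed

text \<open>A Cramer-Wold device with phased cosines. Boxes form an intersection-stable generator of
  the product sigma-algebra, so agreement on boxes is enough.\<close>

lemma distr_PiM_eq_cos:
  fixes C :: "'i \<Rightarrow> 'a \<Rightarrow> real" and C' :: "'i \<Rightarrow> 'b \<Rightarrow> real"
  assumes I: "finite I" and fin: "finite_measure \<mu>" "finite_measure \<nu>"
    and C: "\<And>i. i \<in> I \<Longrightarrow> C i \<in> borel_measurable \<mu>"
    and C': "\<And>i. i \<in> I \<Longrightarrow> C' i \<in> borel_measurable \<nu>"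
    and cos: "\<And>s \<theta>. (\<integral>x. cos (\<theta> + (\<Sum>i\<in>I. s i * C i x)) \<partial>\<mu>) = (\<integral>x. cos (\<theta> + (\<Sum>i\<in>I. s i * C' i x)) \<partial>\<nu>)"
  shows "distr \<mu> (PiM I (\<lambda>_. borel)) (\<lambda>x. \<lambda>i\<in>I. C i x) = distr \<nu> (PiM I (\<lambda>_. borel)) (\<lambda>x. \<lambda>i\<in>I. C' i x)"
    (is "?P = ?Q")
proof (rule measure_eqI_PiM_finite[OF I, where A="\<lambda>_::nat. Pi\<^sub>E I (\<lambda>_. UNIV)"])
  interpret m: finite_measure \<mu> by fact
  interpret n: finite_measure \<nu> by fact
  have mC: "(\<lambda>x. \<lambda>i\<in>I. C i x) \<in> measurable \<mu> (PiM I (\<lambda>_. borel))"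
    by (rule measurable_restrict) (use C in auto)
  have mC': "(\<lambda>x. \<lambda>i\<in>I. C' i x) \<in> measurable \<nu> (PiM I (\<lambda>_. borel))"
    by (rule measurable_restrict) (use C' in auto)
  show "range (\<lambda>_::nat. Pi\<^sub>E I (\<lambda>_. UNIV)) \<subseteq> prod_algebra I (\<lambda>_. borel)"
    using I by (auto intro!: prod_algebraI_finite)
  show "(\<Union>i::nat. Pi\<^sub>E I (\<lambda>_. UNIV)) = space (PiM I (\<lambda>_. borel))"
    by (simp add: space_PiM)
  interpret P: finite_measure ?P by (rule m.finite_measure_distr[OF mC])
  show "\<And>i::nat. emeasure ?P (Pi\<^sub>E I (\<lambda>_. UNIV)) \<noteq> \<infinity>"
    using P.emeasure_finite by simp
  fix A :: "'i \<Rightarrow> real set" assume A: "\<And>i. i \<in> I \<Longrightarrow> A i \<in> sets borel"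
  have "(\<lambda>x. \<lambda>i\<in>I. C i x) -` Pi\<^sub>E I A \<inter> space \<mu> = {x\<in>space \<mu>. \<forall>i\<in>I. C i x \<in> A i}"
    "(\<lambda>x. \<lambda>i\<in>I. C' i x) -` Pi\<^sub>E I A \<inter> space \<nu> = {x\<in>space \<nu>. \<forall>i\<in>I. C' i x \<in> A i}"
    by (auto simp: PiE_iff)
  then show "emeasure ?P (Pi\<^sub>E I A) = emeasure ?Q (Pi\<^sub>E I A)"
    using measure_boxes_eq_cos[OF I fin C C' cos A] A I
    by (simp add: emeasure_distr[OF mC] emeasure_distr[OF mC'] sets_PiM_I_finite m.emeasure_eq_measure n.emeasure_eq_measure)
qed auto

subsection \<open>Hermite polynomials and moments\<close>

text \<open>At \<open>n = 0\<close> the truncated index \<open>n - 1\<close> is harmless because its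
  factor vanishes; this gives one recursion without case distinction.\<close>

lemma hermite_rec: "hermite (Suc n) x = x * hermite n x - real n * hermite (n - 1) x"
  by (cases n) auto

lemma hermite_has_derivative: "(hermite n has_real_derivative real n * hermite (n - 1) x) (at x)"
proof (induction n x rule: hermite.induct)
  case (3 n x)
  have "((\<lambda>x. x * hermite (Suc n) x - real (Suc n) * hermite n x) has_real_derivative
     hermite (Suc n) x + x * (real (Suc n) * hermite n x) - real (Suc n) * (real n * hermite (n - 1) x)) (at x)"
    using 3 by (auto intro!: derivative_eq_intros)
  moreover have "hermite (Suc n) x + x * (real (Suc n) * hermite n x) - real (Suc n) * (real n * hermite (n - 1) x) =
     real (Suc (Suc n)) * hermite (Suc n) x"
    unfolding hermite_rec[of n] by (simp add: algebra_simps)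
  ultimately show ?case by (simp add: fun_eq_iff)
qed (auto intro!: derivative_eq_intros)

lemma hermite_DERIV_chain[derivative_intros]:
  "(g has_real_derivative g') (at x within A) \<Longrightarrow>
    ((\<lambda>x. hermite n (g x)) has_real_derivative real n * hermite (n - 1) (g x) * g') (at x within A)"
  using DERIV_chain2[OF hermite_has_derivative] by blast

lemma continuous_on_hermite[continuous_intros]:
  "continuous_on A g \<Longrightarrow> continuous_on A (\<lambda>x. hermite n (g x))"
proof -
  assume g: "continuous_on A g"
  have "continuous_on UNIV (hermite n)"
    by (meson DERIV_isCont continuous_at_imp_continuous_on hermite_has_derivative)
  then show ?thesis using g by (metis continuous_on_compose2 subset_UNIV)
qed

lemma borel_measurable_hermite[measurable]: "hermite n \<in> borel_measurable borel"
  using continuous_on_hermite[of UNIV "\<lambda>x. x"] by (intro borel_measurable_continuous_onI) simp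

section \<open>Functions of polynomial growth\<close>

definition poly_bounded :: "(real \<Rightarrow> real) \<Rightarrow> bool"
  where "poly_bounded u \<longleftrightarrow> (\<exists>C k. \<forall>x. \<bar>u x\<bar> \<le> C * (1 + \<bar>x\<bar>) ^ k)"

lemma poly_boundedE:
  assumes "poly_bounded u"
  obtains C k where "C \<ge> 0" "\<And>x. \<bar>u x\<bar> \<le> C * (1 + \<bar>x\<bar>) ^ k"
proof -
  from assms obtain C k where C: "\<And>x. \<bar>u x\<bar> \<le> C * (1 + \<bar>x\<bar>) ^ k" by (auto simp: poly_bounded_def)
  from C[of 0] have "0 \<le> C" by simp
  with C show ?thesis using that by blast
qed

lemma poly_bounded_mono: "poly_bounded v \<Longrightarrow> (\<And>x. \<bar>u x\<bar> \<le> \<bar>v x\<bar>) \<Longrightarrow> poly_bounded u"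
  unfolding poly_bounded_def by (meson order_trans)

lemma poly_bounded_const: "poly_bounded (\<lambda>x. c)"
  unfolding poly_bounded_def by (rule exI[of _ "\<bar>c\<bar>"], rule exI[of _ 0]) simp

lemma poly_bounded_id: "poly_bounded (\<lambda>x. x)"
  unfolding poly_bounded_def by (rule exI[of _ 1], rule exI[of _ 1]) simp

lemma poly_bounded_mult: assumes "poly_bounded u" "poly_bounded v" shows "poly_bounded (\<lambda>x. u x * v x)"
proof -
  obtain C k where C: "C \<ge> 0" "\<And>x. \<bar>u x\<bar> \<le> C * (1 + \<bar>x\<bar>) ^ k" using poly_boundedE[OF assms(1)] by metis
  obtain D l where D: "D \<ge> 0" "\<And>x. \<bar>v x\<bar> \<le> D * (1 + \<bar>x\<bar>) ^ l" using poly_boundedE[OF assms(2)] by metis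
  have "\<bar>u x * v x\<bar> \<le> (C * D) * (1 + \<bar>x\<bar>) ^ (k + l)" for x
  proof -
    have "\<bar>u x * v x\<bar> \<le> (C * (1 + \<bar>x\<bar>) ^ k) * (D * (1 + \<bar>x\<bar>) ^ l)"
      unfolding abs_mult using C D by (intro mult_mono) auto
    then show ?thesis by (simp add: power_add mult_ac)
  qed
  then show ?thesis unfolding poly_bounded_def by blast
qed

lemma poly_bounded_add: assumes "poly_bounded u" "poly_bounded v" shows "poly_bounded (\<lambda>x. u x + v x)"
proof -
  obtain C k where C: "C \<ge> 0" "\<And>x. \<bar>u x\<bar> \<le> C * (1 + \<bar>x\<bar>) ^ k" using poly_boundedE[OF assms(1)] by metis
  obtain D l where D: "D \<ge> 0" "\<And>x. \<bar>v x\<bar> \<le> D * (1 + \<bar>x\<bar>) ^ l" using poly_boundedE[OF assms(2)] by metis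
  have "\<bar>u x + v x\<bar> \<le> (C + D) * (1 + \<bar>x\<bar>) ^ (k + l)" for x
  proof -
    \<comment> \<open>Since the base \<open>1 + \<bar>x\<bar>\<close> is at least 1, its powers
      increase with the exponent, and both summands fit under \<open>k + l\<close>.\<close>
    have "(1 + \<bar>x\<bar>) ^ k \<le> (1 + \<bar>x\<bar>) ^ (k + l)" "(1 + \<bar>x\<bar>) ^ l \<le> (1 + \<bar>x\<bar>) ^ (k + l)"
      by (auto intro!: power_increasing)
    then have "C * (1 + \<bar>x\<bar>) ^ k \<le> C * (1 + \<bar>x\<bar>) ^ (k + l)" "D * (1 + \<bar>x\<bar>) ^ l \<le> D * (1 + \<bar>x\<bar>) ^ (k + l)"
      using C D by (auto intro!: mult_left_mono)
    then show ?thesis using C(2)[of x] D(2)[of x] abs_triangle_ineq[of "u x" "v x"] unfolding distrib_right by linarith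
  qed
  then show ?thesis unfolding poly_bounded_def by blast
qed

lemma poly_bounded_sum_list: "(\<And>x. x \<in> set xs \<Longrightarrow> poly_bounded (F x)) \<Longrightarrow> poly_bounded (\<lambda>a. \<Sum>x\<leftarrow>xs. F x a)"
  by (induction xs) (auto intro!: poly_bounded_add poly_bounded_const)

lemma poly_bounded_hermite: assumes "poly_bounded g" shows "poly_bounded (\<lambda>a. hermite n (g a))"
proof (induction n rule: induct_nat_012)
  case (ge2 n)
  have "poly_bounded (\<lambda>a. g a * hermite (Suc n) (g a) + (- real (Suc n)) * hermite n (g a))"
    by (intro poly_bounded_add poly_bounded_mult poly_bounded_const assms ge2)
  then show ?case by (simp add: algebra_simps)
qed (auto intro: poly_bounded_const assms)

text \<open>This form leaves a single pure power, as needed for the absolute moments of the normal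
  density; it follows from \<open>1 + \<bar>x\<bar> \<le> 2 * max 1 \<bar>x\<bar>\<close>.\<close>

lemma poly_bounded_le_powers:
  assumes "poly_bounded u"
  obtains C k where "C \<ge> 0" "\<And>x. \<bar>u x\<bar> \<le> C * (1 + \<bar>x\<bar> ^ k)"
proof -
  obtain C k where C: "C \<ge> 0" "\<And>x. \<bar>u x\<bar> \<le> C * (1 + \<bar>x\<bar>) ^ k" using poly_boundedE[OF assms(1)] by metis
  have "\<bar>u x\<bar> \<le> (C * 2 ^ k) * (1 + \<bar>x\<bar> ^ k)" for x
  proof -
    have "(1 + \<bar>x\<bar>) ^ k \<le> (2 * max 1 \<bar>x\<bar>) ^ k" by (intro power_mono) auto
    also have "\<dots> = 2 ^ k * max 1 \<bar>x\<bar> ^ k" by (simp add: power_mult_distrib)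
    also have "max 1 \<bar>x\<bar> ^ k \<le> 1 + \<bar>x\<bar> ^ k" by (auto simp: max_def)
    finally have "(1 + \<bar>x\<bar>) ^ k \<le> 2 ^ k * (1 + \<bar>x\<bar> ^ k)" by simp
    then have "C * (1 + \<bar>x\<bar>) ^ k \<le> C * (2 ^ k * (1 + \<bar>x\<bar> ^ k))" using C by (intro mult_left_mono)
    then show ?thesis using C(2)[of x] by (simp add: mult_ac)
  qed
  then show ?thesis using C that[of "C * 2 ^ k" k] by simp
qed

lemma integrable_std_normal_poly_bounded:
  assumes "poly_bounded u" and [measurable]: "u \<in> borel_measurable borel"
  shows "integrable lborel (\<lambda>x. std_normal_density x * u x)"
proof -
  obtain C k where C: "C \<ge> 0" "\<And>x. \<bar>u x\<bar> \<le> C * (1 + \<bar>x\<bar> ^ k)"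
    using poly_bounded_le_powers[OF assms(1)] by metis
  show ?thesis
  proof (rule Bochner_Integration.integrable_bound)
    show "integrable lborel (\<lambda>x. C * (std_normal_density x + std_normal_density x * \<bar>x\<bar> ^ k))"
      by (intro integrable_mult_right Bochner_Integration.integrable_add integrable_std_normal_moment_abs) auto
    show "AE x in lborel. norm (std_normal_density x * u x) \<le> norm (C * (std_normal_density x + std_normal_density x * \<bar>x\<bar> ^ k))"
    proof (intro AE_I2)
      fix x
      have "std_normal_density x * \<bar>u x\<bar> \<le> std_normal_density x * (C * (1 + \<bar>x\<bar> ^ k))"
        by (intro mult_left_mono C) auto
      then show "norm (std_normal_density x * u x) \<le> norm (C * (std_normal_density x + std_normal_density x * \<bar>x\<bar> ^ k))"
        using C by (simp add: abs_mult algebra_simps)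
    qed
  qed simp
qed

lemma std_normal_poly_bounded_tendsto:
  assumes "poly_bounded u"
  shows "((\<lambda>x. std_normal_density x * u x) \<longlongrightarrow> 0) at_infinity"
proof -
  obtain C k where C: "C \<ge> 0" "\<And>x. \<bar>u x\<bar> \<le> C * (1 + \<bar>x\<bar> ^ k)"
    using poly_bounded_le_powers[OF assms(1)] by metis
  have t: "((\<lambda>x. std_normal_density x * \<bar>x\<bar> ^ m) \<longlongrightarrow> 0) at_infinity" for m
  proof -
    have "((\<lambda>x::real. (1 / sqrt (2 * pi)) * (x ^ m * exp (- x\<^sup>2 / 2))) \<longlongrightarrow> 0) at_top"
      by real_asymp
    then have 1: "((\<lambda>x. std_normal_density x * \<bar>x\<bar> ^ m) \<longlongrightarrow> 0) at_top"
      by (rule filterlim_cong[THEN iffD1, rotated 3])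
        (auto simp: std_normal_density_def eventually_at_top_linorder intro!: exI[of _ 0])
    moreover from 1 have "((\<lambda>x. std_normal_density x * \<bar>x\<bar> ^ m) \<longlongrightarrow> 0) at_bot"
      unfolding filterlim_at_bot_mirror by (simp add: std_normal_density_def)
    ultimately show ?thesis
      by (simp add: at_infinity_eq_at_top_bot filterlim_def filtermap_sup)
  qed
  show ?thesis
  proof (rule Lim_null_comparison)
    show "((\<lambda>x. C * (std_normal_density x * \<bar>x\<bar> ^ 0 + std_normal_density x * \<bar>x\<bar> ^ k)) \<longlongrightarrow> 0) at_infinity"
      using tendsto_mult[OF tendsto_const[of C] tendsto_add[OF t[of 0] t[of k]]] by simp
    show "\<forall>\<^sub>F x in at_infinity. norm (std_normal_density x * u x) \<le> C * (std_normal_density x * \<bar>x\<bar> ^ 0 + std_normal_density x * \<bar>x\<bar> ^ k)"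
    proof (intro always_eventually allI)
      fix x
      have "std_normal_density x * \<bar>u x\<bar> \<le> std_normal_density x * (C * (1 + \<bar>x\<bar> ^ k))"
        by (intro mult_left_mono C) auto
      then show "norm (std_normal_density x * u x) \<le> C * (std_normal_density x * \<bar>x\<bar> ^ 0 + std_normal_density x * \<bar>x\<bar> ^ k)"
        by (simp add: abs_mult algebra_simps)
    qed
  qed
qed

text \<open>The derivative of \<open>std_normal_density x * hermite n x\<close> is
  \<open>- std_normal_density x * hermite (Suc n) x\<close>, so the integrand is minus the
  derivative of \<open>std_normal_density x * (hermite n x * u x)\<close>, which vanishes at both
  infinities.\<close>

lemma hermite_integration_by_parts:
  assumes u: "\<And>x. (u has_real_derivative u' x) (at x)" and cont: "continuous_on UNIV u'"
    and pb: "poly_bounded u" "poly_bounded u'"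
  shows "(\<integral>x. std_normal_density x * (hermite (Suc n) x * u x - hermite n x * u' x) \<partial>lborel) = 0"
proof -
  define f where "f x = std_normal_density x * (hermite n x * u' x - hermite (Suc n) x * u x)" for x
  define F where "F x = std_normal_density x * (hermite n x * u x)" for x
  have cu: "continuous_on UNIV u"
    using u by (meson DERIV_isCont continuous_at_imp_continuous_on)
  have cs: "continuous_on UNIV std_normal_density"
    unfolding std_normal_density_def by (intro continuous_intros) auto
  have pf: "poly_bounded (\<lambda>x. hermite n x * u' x - hermite (Suc n) x * u x)"
  proof -
    have "poly_bounded (\<lambda>x. hermite n x * u' x + (-1) * (hermite (Suc n) x * u x))"
      by (intro poly_bounded_add poly_bounded_mult poly_bounded_hermite poly_bounded_const pb poly_bounded_id)
    then show ?thesis by simp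
  qed
  have pF: "poly_bounded (\<lambda>x. hermite n x * u x)"
    by (intro poly_bounded_mult poly_bounded_hermite pb poly_bounded_id)
  have cf: "continuous_on UNIV f" unfolding f_def
    by (intro continuous_intros cu cont cs)
  have cF: "continuous_on UNIV F" unfolding F_def
    by (intro continuous_intros cu cont cs)
  have dF: "(F has_real_derivative f x) (at x)" for x
  proof -
    have "(std_normal_density has_real_derivative - x * std_normal_density x) (at x)"
      unfolding std_normal_density_def by (auto intro!: derivative_eq_intros simp: field_simps)
    then have "(F has_real_derivative - x * std_normal_density x * (hermite n x * u x) +
        std_normal_density x * (real n * hermite (n - 1) x * u x + hermite n x * u' x)) (at x)"
      unfolding F_def using u hermite_has_derivative by (auto intro!: derivative_eq_intros)
    moreover have "- x * std_normal_density x * (hermite n x * u x) +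
        std_normal_density x * (real n * hermite (n - 1) x * u x + hermite n x * u' x) = f x"
      unfolding f_def hermite_rec[of n] by (simp add: algebra_simps)
    ultimately show ?thesis by simp
  qed
  have int: "integrable lborel f"
    unfolding f_def
    by (rule integrable_std_normal_poly_bounded[OF pf])
      (intro borel_measurable_continuous_onI continuous_intros cu cont)
  have lim: "(F \<longlongrightarrow> 0) at_infinity"
    unfolding F_def by (rule std_normal_poly_bounded_tendsto[OF pF])
  then have lims: "(F \<longlongrightarrow> 0) at_top" "(F \<longlongrightarrow> 0) at_bot"
    by (auto simp: at_infinity_eq_at_top_bot filterlim_def filtermap_sup)
  have "(LBINT x=-\<infinity>..\<infinity>. f x) = 0 - 0"
  proof (rule interval_integral_FTC_integrable)
    show "set_integrable lborel (einterval (-\<infinity>) \<infinity>) f" using int by (simp add: set_integrable_def)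
    show "((F \<circ> real_of_ereal) \<longlongrightarrow> 0) (at_right (- \<infinity>))"
      using lims(2) by (simp add: ereal_tendsto_simps1)
    show "((F \<circ> real_of_ereal) \<longlongrightarrow> 0) (at_left \<infinity>)"
      using lims(1) by (simp add: ereal_tendsto_simps1)
    show "isCont f x" for x using cf by (simp add: continuous_on_eq_continuous_at)
    show "(F has_vector_derivative f x) (at x)" for x
      using dF by (simp add: has_real_derivative_iff_has_vector_derivative)
  qed simp
  then have "(\<integral>x. f x \<partial>lborel) = 0"
    by (simp add: interval_lebesgue_integral_def set_lebesgue_integral_def)
  then have "(\<integral>x. - f x \<partial>lborel) = 0" by simp
  moreover have "- f x = std_normal_density x * (hermite (Suc n) x * u x - hermite n x * u' x)" for x
    by (simp add: f_def algebra_simps)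
  ultimately show ?thesis by simp
qed

section \<open>Random variables with moments of all orders\<close>

definition all_moments :: "'w measure \<Rightarrow> ('w \<Rightarrow> real) \<Rightarrow> bool"
  where "all_moments M X \<longleftrightarrow> X \<in> borel_measurable M \<and> (\<forall>p::nat. integrable M (\<lambda>\<omega>. \<bar>X \<omega>\<bar> ^ p))"

lemma all_moments_measurable: "all_moments M X \<Longrightarrow> X \<in> borel_measurable M"
  by (simp add: all_moments_def)

lemma all_moments_integrable: "all_moments M X \<Longrightarrow> integrable M X"
proof -
  assume a: "all_moments M X"
  then have "integrable M (\<lambda>\<omega>. \<bar>X \<omega>\<bar> ^ 1)" unfolding all_moments_def by blast
  then show ?thesis using a by (simp add: all_moments_def integrable_abs_iff)
qed

lemma all_moments_integrable_sq: "all_moments M X \<Longrightarrow> integrable M (\<lambda>\<omega>. (X \<omega>)\<^sup>2)"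
proof -
  assume a: "all_moments M X"
  then have "integrable M (\<lambda>\<omega>. \<bar>X \<omega>\<bar> ^ 2)" unfolding all_moments_def by blast
  then show ?thesis by simp
qed

lemma (in prob_space) all_moments_const: "all_moments M (\<lambda>_. c)"
  by (simp add: all_moments_def)

lemma all_moments_mono:
  assumes "all_moments M Y" "X \<in> borel_measurable M" "\<And>\<omega>. \<bar>X \<omega>\<bar> \<le> \<bar>Y \<omega>\<bar>"
  shows "all_moments M X"
  unfolding all_moments_def
proof (intro conjI allI assms)
  have [measurable]: "X \<in> borel_measurable M" by fact
  fix p show "integrable M (\<lambda>\<omega>. \<bar>X \<omega>\<bar> ^ p)"
    by (rule Bochner_Integration.integrable_bound[of _ "\<lambda>\<omega>. \<bar>Y \<omega>\<bar> ^ p"])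
      (use assms(1) in \<open>auto simp: all_moments_def intro!: power_mono assms(3)\<close>)
qed

lemma all_moments_add:
  assumes "all_moments M X" "all_moments M Y" shows "all_moments M (\<lambda>\<omega>. X \<omega> + Y \<omega>)"
  unfolding all_moments_def
proof (intro conjI allI)
  have [measurable]: "X \<in> borel_measurable M" "Y \<in> borel_measurable M"
    using assms by (auto simp: all_moments_def)
  show "(\<lambda>\<omega>. X \<omega> + Y \<omega>) \<in> borel_measurable M" by simp
  fix p
  show "integrable M (\<lambda>\<omega>. \<bar>X \<omega> + Y \<omega>\<bar> ^ p)"
  proof (rule Bochner_Integration.integrable_bound)
    show "integrable M (\<lambda>\<omega>. 2 ^ p * (\<bar>X \<omega>\<bar> ^ p + \<bar>Y \<omega>\<bar> ^ p))"
      using assms by (auto simp: all_moments_def)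
    show "AE \<omega> in M. norm (\<bar>X \<omega> + Y \<omega>\<bar> ^ p) \<le> norm (2 ^ p * (\<bar>X \<omega>\<bar> ^ p + \<bar>Y \<omega>\<bar> ^ p))"
    proof (intro AE_I2)
      fix \<omega>
      have "\<bar>X \<omega> + Y \<omega>\<bar> ^ p \<le> (2 * max \<bar>X \<omega>\<bar> \<bar>Y \<omega>\<bar>) ^ p" by (intro power_mono) auto
      also have "\<dots> = 2 ^ p * max \<bar>X \<omega>\<bar> \<bar>Y \<omega>\<bar> ^ p" by (simp add: power_mult_distrib)
      also have "\<dots> \<le> 2 ^ p * (\<bar>X \<omega>\<bar> ^ p + \<bar>Y \<omega>\<bar> ^ p)" by (intro mult_left_mono) (auto simp: max_def)
      finally show "norm (\<bar>X \<omega> + Y \<omega>\<bar> ^ p) \<le> norm (2 ^ p * (\<bar>X \<omega>\<bar> ^ p + \<bar>Y \<omega>\<bar> ^ p))" by simp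
    qed
  qed simp
qed

text \<open>The bound doubles the exponent, which is why the class asks for every moment: it is then
  an algebra, and integrability of products of Gaussian polynomials follows from their
  shape.\<close>

lemma all_moments_mult:
  assumes "all_moments M X" "all_moments M Y" shows "all_moments M (\<lambda>\<omega>. X \<omega> * Y \<omega>)"
  unfolding all_moments_def
proof (intro conjI allI)
  have [measurable]: "X \<in> borel_measurable M" "Y \<in> borel_measurable M"
    using assms by (auto simp: all_moments_def)
  show "(\<lambda>\<omega>. X \<omega> * Y \<omega>) \<in> borel_measurable M" by simp
  fix p
  show "integrable M (\<lambda>\<omega>. \<bar>X \<omega> * Y \<omega>\<bar> ^ p)"
  proof (rule Bochner_Integration.integrable_bound)
    show "integrable M (\<lambda>\<omega>. \<bar>X \<omega>\<bar> ^ (2 * p) + \<bar>Y \<omega>\<bar> ^ (2 * p))"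
      using assms[unfolded all_moments_def, THEN conjunct2, THEN spec[of _ "2 * p"]]
      by (rule Bochner_Integration.integrable_add)
    show "AE \<omega> in M. norm (\<bar>X \<omega> * Y \<omega>\<bar> ^ p) \<le> norm (\<bar>X \<omega>\<bar> ^ (2 * p) + \<bar>Y \<omega>\<bar> ^ (2 * p))"
    proof (intro AE_I2)
      fix \<omega>
      define a b where "a = \<bar>X \<omega>\<bar> ^ p" and "b = \<bar>Y \<omega>\<bar> ^ p"
      have ab: "a \<ge> 0" "b \<ge> 0" by (auto simp: a_def b_def)
      have "2 * (a * b) \<le> a\<^sup>2 + b\<^sup>2" using sum_squares_bound[of a b] by (simp add: mult.assoc)
      then have "a * b \<le> a\<^sup>2 + b\<^sup>2" using mult_nonneg_nonneg[OF ab] by linarith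
      moreover have "\<bar>X \<omega> * Y \<omega>\<bar> ^ p = a * b" by (simp add: a_def b_def abs_mult power_mult_distrib)
      moreover have "\<bar>X \<omega>\<bar> ^ (2 * p) + \<bar>Y \<omega>\<bar> ^ (2 * p) = a\<^sup>2 + b\<^sup>2"
        by (simp add: a_def b_def power_mult[symmetric] mult.commute)
      ultimately show "norm (\<bar>X \<omega> * Y \<omega>\<bar> ^ p) \<le> norm (\<bar>X \<omega>\<bar> ^ (2 * p) + \<bar>Y \<omega>\<bar> ^ (2 * p))" using ab by simp
    qed
  qed simp
qed

lemma (in prob_space) all_moments_sum_list:
  "(\<And>x. x \<in> set xs \<Longrightarrow> all_moments M (F x)) \<Longrightarrow> all_moments M (\<lambda>a. \<Sum>x\<leftarrow>xs. F x a)"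
  by (induction xs) (auto intro!: all_moments_add all_moments_const)

lemma (in prob_space) all_moments_hermite:
  assumes "all_moments M g" shows "all_moments M (\<lambda>a. hermite n (g a))"
proof (induction n rule: induct_nat_012)
  case (ge2 n)
  have "all_moments M (\<lambda>a. g a * hermite (Suc n) (g a) + (- real (Suc n)) * hermite n (g a))"
    by (intro all_moments_add all_moments_mult all_moments_const assms ge2)
  then show ?case by (simp add: algebra_simps)
qed (auto intro: all_moments_const assms)

lemma (in prob_space) all_moments_gaussian:
  assumes "centered_gaussian M Y" shows "all_moments M Y"
  unfolding all_moments_def
proof (intro conjI allI)
  show Y[measurable]: "Y \<in> borel_measurable M" using assms by (simp add: centered_gaussian_def)
  fix p :: nat
  consider "AE \<omega> in M. Y \<omega> = 0" | \<sigma> where "\<sigma> > 0" "distributed M lborel Y (normal_density 0 \<sigma>)"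
    using assms by (auto simp: centered_gaussian_def)
  then show "integrable M (\<lambda>\<omega>. \<bar>Y \<omega>\<bar> ^ p)"
  proof cases
    case 1
    have "integrable M (\<lambda>\<omega>. \<bar>Y \<omega>\<bar> ^ p) \<longleftrightarrow> integrable M (\<lambda>\<omega>. \<bar>0\<bar> ^ p :: real)"
      using 1 by (intro integrable_cong_AE) auto
    then show ?thesis by simp
  next
    case 2
    then show ?thesis
      using distributed_integrable[OF 2(2), of "\<lambda>x. \<bar>x\<bar> ^ p"] integrable_normal_moment_abs[of \<sigma> 0 p] by simp
  qed
qed

subsection \<open>Gaussian integration by parts\<close>

lemma integral_cos_std_normal:
  "(\<integral>x. cos (\<theta> + d * x) \<partial>std_normal_distribution) = exp (- d\<^sup>2 / 2) * cos \<theta>"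
proof -
  interpret real_distribution std_normal_distribution by (rule real_dist_normal_dist)
  have i: "integrable std_normal_distribution (\<lambda>x. iexp (d * x))" by (rule integrable_iexp) auto
  have e: "(\<integral>x. iexp (d * x) \<partial>std_normal_distribution) = complex_of_real (exp (- d\<^sup>2 / 2))"
    using fun_cong[OF char_std_normal_distribution, of d] by (simp add: char_def)
  have re: "(\<integral>x. cos (d * x) \<partial>std_normal_distribution) = exp (- d\<^sup>2 / 2)"
    using arg_cong[OF e, of Re] i by (subst (asm) integral_Re[symmetric]) (simp_all add: Re_exp)
  have im: "(\<integral>x. sin (d * x) \<partial>std_normal_distribution) = 0"
    using arg_cong[OF e, of Im] i by (subst (asm) integral_Im[symmetric]) (simp_all add: Im_exp)
  have ii: "integrable std_normal_distribution (\<lambda>x. cos (d * x))" "integrable std_normal_distribution (\<lambda>x. sin (d * x))"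
    by (intro integrable_const_bound[where B=1]; simp)+
  have "(\<integral>x. cos (\<theta> + d * x) \<partial>std_normal_distribution) =
    (\<integral>x. cos \<theta> * cos (d * x) - sin \<theta> * sin (d * x) \<partial>std_normal_distribution)"
    by (simp add: cos_add)
  also have "\<dots> = exp (- d\<^sup>2 / 2) * cos \<theta>"
    using ii by (simp add: re im)
  finally show ?thesis .
qed

text \<open>Writing the variance as a second moment lets the degenerate Gaussian share the formula
  of the nondegenerate ones.\<close>

lemma (in prob_space) integral_cos_gaussian:
  assumes "centered_gaussian M Y"
  shows "(\<integral>\<omega>. cos (\<theta> + Y \<omega>) \<partial>M) = exp (- (\<integral>\<omega>. (Y \<omega>)\<^sup>2 \<partial>M) / 2) * cos \<theta>"
proof -
  have Y[measurable]: "Y \<in> borel_measurable M" using assms by (simp add: centered_gaussian_def)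
  consider "AE \<omega> in M. Y \<omega> = 0" | \<sigma> where "\<sigma> > 0" "distributed M lborel Y (normal_density 0 \<sigma>)"
    using assms by (auto simp: centered_gaussian_def)
  then show ?thesis
  proof cases
    case 1
    have "(\<integral>\<omega>. cos (\<theta> + Y \<omega>) \<partial>M) = (\<integral>\<omega>. cos \<theta> \<partial>M)"
      using 1 by (intro integral_cong_AE) auto
    moreover have "(\<integral>\<omega>. (Y \<omega>)\<^sup>2 \<partial>M) = (\<integral>\<omega>. 0 \<partial>M)"
      using 1 by (intro integral_cong_AE) auto
    ultimately show ?thesis by (simp add: prob_space)
  next
    case 2
    have var: "(\<integral>\<omega>. (Y \<omega>)\<^sup>2 \<partial>M) = \<sigma>\<^sup>2"
      using normal_distributed_variance[OF 2] normal_distributed_expectation[OF 2] by simp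
    have d: "distributed M lborel (\<lambda>\<omega>. (Y \<omega> - 0) / \<sigma>) std_normal_density"
      using normal_standard_normal_convert[OF 2(1), of Y 0] 2(2) by simp
    have "(\<integral>\<omega>. cos (\<theta> + Y \<omega>) \<partial>M) = (\<integral>\<omega>. cos (\<theta> + \<sigma> * ((Y \<omega> - 0) / \<sigma>)) \<partial>M)"
      using 2(1) by simp
    also have "\<dots> = (\<integral>x. std_normal_density x * cos (\<theta> + \<sigma> * x) \<partial>lborel)"
      by (subst distributed_integral[OF d, symmetric]) auto
    also have "\<dots> = (\<integral>x. cos (\<theta> + \<sigma> * x) \<partial>std_normal_distribution)"
      by (subst integral_density) auto
    also have "\<dots> = exp (- \<sigma>\<^sup>2 / 2) * cos \<theta>" by (rule integral_cos_std_normal)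
    finally show ?thesis by (simp add: var)
  qed
qed

text \<open>
  With \<open>v\<close> the path \<open>h \<mapsto> W h\<close>, an entry \<open>(n, c, h)\<close> of a list stands for \<open>c I\<^sub>n(h\<^sup>\<otimes>\<^sup>n)\<close>; \<open>sval\<close>, \<open>sder\<close> and \<open>slap\<close> are
  the sum of the entries, its Malliavin derivative and its image under \<open>-L\<close>.
\<close>

definition hval :: "nat \<Rightarrow> 'h::real_inner \<Rightarrow> ('h \<Rightarrow> real) \<Rightarrow> real"
  where "hval n h v = norm h ^ n * hermite n (v h / norm h)"

definition sval :: "(nat \<times> real \<times> 'h::real_inner) list \<Rightarrow> ('h \<Rightarrow> real) \<Rightarrow> real"
  where "sval S v = (\<Sum>(n, c, h)\<leftarrow>S. c * hval n h v)"

definition sder :: "(nat \<times> real \<times> 'h::real_inner) list \<Rightarrow> ('h \<Rightarrow> real) \<Rightarrow> 'h"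
  where "sder S v = (\<Sum>(n, c, h)\<leftarrow>S. (c * (real n * hval (n - 1) h v)) *\<^sub>R h)"

definition slap :: "(nat \<times> real \<times> 'h::real_inner) list \<Rightarrow> ('h \<Rightarrow> real) \<Rightarrow> real"
  where "slap S v = (\<Sum>(n, c, h)\<leftarrow>S. c * (real n * hval n h v))"

lemma sval_simps[simp]: "sval [] v = 0" "sval ((n, c, h) # S) v = c * hval n h v + sval S v"
  "sval (S @ T) v = sval S v + sval T v"
  by (auto simp: sval_def)

lemma sder_simps[simp]: "sder [] v = 0"
  "sder ((n, c, h) # S) v = (c * (real n * hval (n - 1) h v)) *\<^sub>R h + sder S v"
  "sder (S @ T) v = sder S v + sder T v"
  by (auto simp: sder_def)

lemma slap_simps[simp]: "slap [] v = 0" "slap ((n, c, h) # S) v = c * (real n * hval n h v) + slap S v"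
  "slap (S @ T) v = slap S v + slap T v"
  by (auto simp: slap_def)

lemma hval_0[simp]: "hval 0 h v = 1" by (simp add: hval_def)

lemma hval_cong: "v h = w h \<Longrightarrow> hval n h v = hval n h w"
  by (simp add: hval_def)

text \<open>Such a functional reads only finitely many values of the path, so it may be evaluated on
  a restriction to a finite index set, where the law of the path is accessible.\<close>

lemma sval_cong: "(\<And>n c h. (n, c, h) \<in> set S \<Longrightarrow> v h = w h) \<Longrightarrow> sval S v = sval S w"
proof (induction S)
  case (Cons p S)
  obtain n c h where p: "p = (n, c, h)" by (cases p)
  have "sval S v = sval S w" "hval n h v = hval n h w" using Cons p by (auto intro!: hval_cong)
  then show ?case by (simp add: p)
qed simp

lemma sder_cong: "(\<And>n c h. (n, c, h) \<in> set S \<Longrightarrow> v h = w h) \<Longrightarrow> sder S v = sder S w"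
proof (induction S)
  case (Cons p S)
  obtain n c h where p: "p = (n, c, h)" by (cases p)
  have "sder S v = sder S w" "hval (n - 1) h v = hval (n - 1) h w" using Cons p by (auto intro!: hval_cong)
  then show ?case by (simp add: p)
qed simp

lemma inner_sder: "sder S v \<bullet> k = (\<Sum>(n, c, h)\<leftarrow>S. c * (real n * hval (n - 1) h v) * (h \<bullet> k))"
  by (induction S) (auto simp: inner_add_left)

text \<open>For \<open>h = 0\<close> the division by the norm makes the left-hand function constant,
  and the hypothesis \<open>v' = 0\<close> makes the claimed derivative vanish as well.\<close>

lemma hval_has_derivative:
  assumes "(v has_real_derivative v') (at a)" "norm h = 0 \<Longrightarrow> v' = 0"
  shows "((\<lambda>a. norm h ^ n * hermite n (v a / norm h)) has_real_derivative
     real n * (norm h ^ (n - 1) * hermite (n - 1) (v a / norm h)) * v') (at a)"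
proof (cases "norm h = 0")
  case True
  then show ?thesis using assms(2) by simp
next
  case False
  have "((\<lambda>a. norm h ^ n * hermite n (v a / norm h)) has_real_derivative
     norm h ^ n * (real n * hermite (n - 1) (v a / norm h) * (v' / norm h))) (at a)"
    using assms(1) False by (auto intro!: derivative_eq_intros)
  moreover have "norm h ^ n * (real n * hermite (n - 1) (v a / norm h) * (v' / norm h)) =
    real n * (norm h ^ (n - 1) * hermite (n - 1) (v a / norm h)) * v'"
    using False by (cases n) auto
  ultimately show ?thesis by simp
qed

lemma measurable_hval_PiM[measurable]: "h \<in> I \<Longrightarrow> hval n h \<in> borel_measurable (PiM I (\<lambda>_. borel))"
  unfolding hval_def by measurable

lemma measurable_sval_PiM: "(\<And>n c h. (n, c, h) \<in> set S \<Longrightarrow> h \<in> I) \<Longrightarrow> sval S \<in> borel_measurable (PiM I (\<lambda>_. borel))"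
proof (induction S)
  case (Cons a S)
  obtain n c h where a: "a = (n, c, h)" by (cases a)
  have [measurable]: "sval S \<in> borel_measurable (PiM I (\<lambda>_. borel))" "h \<in> I"
    using Cons a by auto
  show ?case unfolding a sval_simps by measurable
qed (simp add: sval_def[abs_def])

lemma measurable_inner_sder_PiM:
  "(\<And>n c h. (n, c, h) \<in> set S \<Longrightarrow> h \<in> I) \<Longrightarrow> (\<lambda>v. sder S v \<bullet> k) \<in> borel_measurable (PiM I (\<lambda>_. borel))"
proof (induction S)
  case (Cons a S)
  obtain n c h where a: "a = (n, c, h)" by (cases a)
  have [measurable]: "(\<lambda>v. sder S v \<bullet> k) \<in> borel_measurable (PiM I (\<lambda>_. borel))" "h \<in> I"
    using Cons a by auto
  show ?case unfolding a sder_simps inner_add_left inner_scaleR_left by measurable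
qed (simp add: sder_def[abs_def])

text \<open>The test functions. A bounded derivative keeps
  \<open>f' (X \<omega>) * G \<omega>\<close> integrable for merely integrable \<open>G\<close> and
  makes \<open>f\<close> compatible with L2 limits; continuity of \<open>f'\<close> lets it pass
  through almost sure limits.\<close>

definition lipschitz_C1 :: "(real \<Rightarrow> real) \<Rightarrow> (real \<Rightarrow> real) \<Rightarrow> bool"
  where "lipschitz_C1 f f' \<longleftrightarrow> (\<forall>x. (f has_real_derivative f' x) (at x)) \<and> continuous_on UNIV f' \<and> (\<exists>K. \<forall>x. \<bar>f' x\<bar> \<le> K)"

lemma lipschitz_C1E:
  assumes "lipschitz_C1 f f'"
  obtains K where "K \<ge> 0" "\<And>x. (f has_real_derivative f' x) (at x)" "continuous_on UNIV f'" "\<And>x. \<bar>f' x\<bar> \<le> K"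
    "\<And>x y. \<bar>f x - f y\<bar> \<le> K * \<bar>x - y\<bar>" "\<And>x. \<bar>f x\<bar> \<le> \<bar>f 0\<bar> + K * \<bar>x\<bar>"
    "f \<in> borel_measurable borel" "f' \<in> borel_measurable borel"
proof -
  obtain K where K: "\<And>x. \<bar>f' x\<bar> \<le> K" and d: "\<And>x. (f has_real_derivative f' x) (at x)" and c: "continuous_on UNIV f'"
    using assms by (auto simp: lipschitz_C1_def)
  have K0: "K \<ge> 0" using K[of 0] by linarith
  have lip: "\<bar>f x - f y\<bar> \<le> K * \<bar>x - y\<bar>" for x y
    using field_differentiable_bound[of UNIV f f' K x y] d K by auto
  have gr: "\<bar>f x\<bar> \<le> \<bar>f 0\<bar> + K * \<bar>x\<bar>" for x using lip[of x 0] by simp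
  have "continuous_on UNIV f" using d by (meson DERIV_isCont continuous_at_imp_continuous_on)
  then have "f \<in> borel_measurable borel" "f' \<in> borel_measurable borel"
    using c by (auto intro: borel_measurable_continuous_onI)
  then show ?thesis using that K0 d c K lip gr by metis
qed

section \<open>Isonormal processes and resampling of one direction\<close>

locale isonormal_process = prob_space M for M :: "'w measure" +
  fixes W :: "'h::{real_inner, complete_space, second_countable_topology} \<Rightarrow> 'w \<Rightarrow> real"
  assumes isonormal: "isonormal_gaussian M W"
begin

lemma gaussian_sum: "finite S \<Longrightarrow> centered_gaussian M (\<lambda>\<omega>. \<Sum>h\<in>S. c h * W h \<omega>)"
  using isonormal by (auto simp: isonormal_gaussian_def)

lemma gaussian_W: "centered_gaussian M (W h)"
  using gaussian_sum[of "{h}" "\<lambda>_. 1"] by simp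

lemma W_measurable[measurable]: "W h \<in> borel_measurable M"
  using gaussian_W by (simp add: centered_gaussian_def)

lemma all_moments_W: "all_moments M (W h)"
  by (rule all_moments_gaussian[OF gaussian_W])

lemma covariance_W: "(\<integral>\<omega>. W h \<omega> * W k \<omega> \<partial>M) = h \<bullet> k"
  using isonormal by (auto simp: isonormal_gaussian_def)

lemma variance_sum_W:
  assumes "finite S"
  shows "(\<integral>\<omega>. (\<Sum>h\<in>S. c h * W h \<omega>)\<^sup>2 \<partial>M) = (norm (\<Sum>h\<in>S. c h *\<^sub>R h))\<^sup>2"
proof -
  have i: "integrable M (\<lambda>\<omega>. W h \<omega> * W k \<omega>)" for h k
    by (intro all_moments_integrable all_moments_mult all_moments_W)
  have "(\<integral>\<omega>. (\<Sum>h\<in>S. c h * W h \<omega>)\<^sup>2 \<partial>M) = (\<integral>\<omega>. (\<Sum>h\<in>S. \<Sum>k\<in>S. c h * c k * (W h \<omega> * W k \<omega>)) \<partial>M)"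
    by (intro Bochner_Integration.integral_cong refl) (simp add: power2_eq_square sum_product mult_ac)
  also have "\<dots> = (\<Sum>h\<in>S. \<Sum>k\<in>S. c h * c k * (h \<bullet> k))"
    using i by (simp add: Bochner_Integration.integral_sum covariance_W)
  also have "\<dots> = (norm (\<Sum>h\<in>S. c h *\<^sub>R h))\<^sup>2"
    by (simp add: power2_norm_eq_inner inner_sum_left inner_sum_right sum_distrib_left mult_ac inner_commute[of _ "_ :: 'h"])
  finally show ?thesis .
qed

lemma integral_cos_sum_W:
  assumes "finite S"
  shows "(\<integral>\<omega>. cos (\<theta> + (\<Sum>h\<in>S. c h * W h \<omega>)) \<partial>M) = exp (- (norm (\<Sum>h\<in>S. c h *\<^sub>R h))\<^sup>2 / 2) * cos \<theta>"
  using integral_cos_gaussian[OF gaussian_sum[OF assms]] by (simp add: variance_sum_W assms)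

text \<open>Replaces the component of \<open>W\<close> along \<open>h\<close> by an independent Gaussian.\<close>

definition resample :: "'h \<Rightarrow> 'h \<Rightarrow> real \<times> 'w \<Rightarrow> real"
  where "resample h k p = W k (snd p) + (k \<bullet> h) / (norm h)\<^sup>2 * (fst p * norm h - W h (snd p))"

lemma resample_measurable[measurable]: "resample h k \<in> borel_measurable (std_normal_distribution \<Otimes>\<^sub>M M)"
  unfolding resample_def by measurable

text \<open>Compare cosine integrals. For the vector \<open>K\<close> of a linear combination, the
  fresh Gaussian contributes the component of \<open>K\<close> along \<open>h\<close> and the old
  path contributes the orthogonal component; the two exponential factors multiply to that of
  \<open>K\<close> by Pythagoras.\<close>

lemma distr_resample:
  assumes S: "finite S" "h \<in> S" and h: "h \<noteq> 0"
  shows "distr M (PiM S (\<lambda>_. borel)) (\<lambda>\<omega>. \<lambda>k\<in>S. W k \<omega>) =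
    distr (std_normal_distribution \<Otimes>\<^sub>M M) (PiM S (\<lambda>_. borel)) (\<lambda>p. \<lambda>k\<in>S. resample h k p)"
proof (rule distr_PiM_eq_cos)
  interpret N: real_distribution std_normal_distribution by (rule real_dist_normal_dist)
  interpret P: pair_prob_space std_normal_distribution M ..
  show "finite_measure M" by (rule finite_measure_axioms)
  show "finite_measure (std_normal_distribution \<Otimes>\<^sub>M M)" by (rule P.finite_measure_axioms)
  fix s :: "'h \<Rightarrow> real" and \<theta>
  define K where "K = (\<Sum>k\<in>S. s k *\<^sub>R k)"
  \<comment> \<open>\<open>d *\<^sub>R h\<close> is the projection of \<open>K\<close> onto
    \<open>h\<close>. As \<open>h\<close> itself is in \<open>S\<close>, lowering its coefficient by
    \<open>d\<close> turns the combination into the orthogonal part.\<close>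
  define d where "d = (K \<bullet> h) / (norm h)\<^sup>2"
  define s' where "s' = s(h := s h - d)"
  have sumd: "(\<Sum>k\<in>S. s k * ((k \<bullet> h) / (norm h)\<^sup>2 * e)) = d * e" for e
    by (simp add: d_def K_def inner_sum_left sum_distrib_left sum_distrib_right sum_divide_distrib mult_ac)
  have s'1: "(\<Sum>k\<in>S. s' k * W k \<omega>) = (\<Sum>k\<in>S. s k * W k \<omega>) - d * W h \<omega>" for \<omega>
    using S by (simp add: s'_def sum.remove[of S h] algebra_simps)
  have s'2: "(\<Sum>k\<in>S. s' k *\<^sub>R k) = K - d *\<^sub>R h"
    using S by (simp add: s'_def K_def sum.remove[of S h] algebra_simps)
  have *: "(\<Sum>k\<in>S. s k * resample h k p) = (\<Sum>k\<in>S. s' k * W k (snd p)) + d * norm h * fst p" for p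
  proof -
    have "(\<Sum>k\<in>S. s k * resample h k p) = (\<Sum>k\<in>S. s k * W k (snd p)) + (\<Sum>k\<in>S. s k * ((k \<bullet> h) / (norm h)\<^sup>2 * (fst p * norm h - W h (snd p))))"
      by (simp add: resample_def distrib_left sum.distrib)
    then show ?thesis unfolding sumd s'1 by (simp add: algebra_simps)
  qed
  have nrm: "(norm (K - d *\<^sub>R h))\<^sup>2 = (norm K)\<^sup>2 - (d * norm h)\<^sup>2"
  proof -
    have dh: "d * (norm h)\<^sup>2 = K \<bullet> h" using h by (simp add: d_def)
    have "(norm (K - d *\<^sub>R h))\<^sup>2 = (norm K)\<^sup>2 - 2 * d * (K \<bullet> h) + d\<^sup>2 * (norm h)\<^sup>2"
      unfolding power2_norm_eq_inner
      by (simp add: inner_diff_left inner_diff_right inner_commute power2_eq_square algebra_simps)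
    also have "\<dots> = (norm K)\<^sup>2 - d\<^sup>2 * (norm h)\<^sup>2" unfolding dh[symmetric] by (simp add: power2_eq_square)
    finally show ?thesis by (simp add: power_mult_distrib)
  qed
  have "(\<integral>p. cos (\<theta> + (\<Sum>k\<in>S. s k * resample h k p)) \<partial>(std_normal_distribution \<Otimes>\<^sub>M M)) =
     (\<integral>\<omega>. \<integral>a. cos (\<theta> + (\<Sum>k\<in>S. s k * resample h k (a, \<omega>))) \<partial>std_normal_distribution \<partial>M)"
    by (subst P.integral_snd) (auto intro!: P.integrable_const_bound[where B=1] simp: case_prod_beta')
  also have "\<dots> = (\<integral>\<omega>. exp (- (d * norm h)\<^sup>2 / 2) * cos (\<theta> + (\<Sum>k\<in>S. s' k * W k \<omega>)) \<partial>M)"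
    unfolding * using integral_cos_std_normal[of "\<theta> + (\<Sum>k\<in>S. s' k * W k _)" "d * norm h"]
    by (intro Bochner_Integration.integral_cong) (auto simp: add.assoc)
  also have "\<dots> = exp (- (d * norm h)\<^sup>2 / 2) * (exp (- (norm (K - d *\<^sub>R h))\<^sup>2 / 2) * cos \<theta>)"
    by (simp add: integral_cos_sum_W[OF S(1)] s'2)
  also have "\<dots> = exp (- (norm K)\<^sup>2 / 2) * cos \<theta>"
    unfolding nrm by (simp add: exp_add[symmetric] mult.assoc[symmetric] diff_divide_distrib)
  finally show "(\<integral>\<omega>. cos (\<theta> + (\<Sum>k\<in>S. s k * W k \<omega>)) \<partial>M) =
     (\<integral>p. cos (\<theta> + (\<Sum>k\<in>S. s k * resample h k p)) \<partial>(std_normal_distribution \<Otimes>\<^sub>M M))"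
    by (simp add: integral_cos_sum_W[OF S(1)] K_def)
qed (use S in auto)

text \<open>The new coordinate is integrated first, with the old path frozen, which reduces
  expectations over paths to one-dimensional Gaussian integrals.\<close>

lemma integral_resample:
  fixes \<Psi> :: "('h \<Rightarrow> real) \<Rightarrow> real"
  assumes S: "finite S" "h \<in> S" and h: "h \<noteq> 0" and [measurable]: "\<Psi> \<in> borel_measurable (PiM S (\<lambda>_. borel))"
    and int: "integrable M (\<lambda>\<omega>. \<Psi> (\<lambda>k\<in>S. W k \<omega>))"
  shows "(\<integral>\<omega>. \<Psi> (\<lambda>k\<in>S. W k \<omega>) \<partial>M) =
    (\<integral>\<omega>. (\<integral>a. std_normal_density a * \<Psi> (\<lambda>k\<in>S. resample h k (a, \<omega>)) \<partial>lborel) \<partial>M)"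
proof -
  interpret N: real_distribution std_normal_distribution by (rule real_dist_normal_dist)
  interpret P: pair_prob_space std_normal_distribution M ..
  have m1[measurable]: "(\<lambda>\<omega>. \<lambda>k\<in>S. W k \<omega>) \<in> measurable M (PiM S (\<lambda>_. borel))"
    by (rule measurable_restrict) simp
  have m2[measurable]: "(\<lambda>p. \<lambda>k\<in>S. resample h k p) \<in> measurable (std_normal_distribution \<Otimes>\<^sub>M M) (PiM S (\<lambda>_. borel))"
    by (rule measurable_restrict) simp
  have int2: "integrable (std_normal_distribution \<Otimes>\<^sub>M M) (\<lambda>p. \<Psi> (\<lambda>k\<in>S. resample h k p))"
    using int integrable_distr_eq[OF m1 assms(4)] integrable_distr_eq[OF m2 assms(4)] distr_resample[OF S h] by simp
  have "(\<integral>\<omega>. \<Psi> (\<lambda>k\<in>S. W k \<omega>) \<partial>M) = (\<integral>p. \<Psi> (\<lambda>k\<in>S. resample h k p) \<partial>(std_normal_distribution \<Otimes>\<^sub>M M))"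
    using integral_distr[OF m1 assms(4)] integral_distr[OF m2 assms(4)] distr_resample[OF S h] by simp
  also have "\<dots> = (\<integral>\<omega>. (\<integral>a. \<Psi> (\<lambda>k\<in>S. resample h k (a, \<omega>)) \<partial>std_normal_distribution) \<partial>M)"
    using P.integral_snd[of "\<lambda>a \<omega>. \<Psi> (\<lambda>k\<in>S. resample h k (a, \<omega>))"] int2 by (simp add: case_prod_beta' del: restrict_apply)
  also have "\<dots> = (\<integral>\<omega>. (\<integral>a. std_normal_density a * \<Psi> (\<lambda>k\<in>S. resample h k (a, \<omega>)) \<partial>lborel) \<partial>M)"
  proof (rule Bochner_Integration.integral_cong[OF refl])
    fix \<omega> assume [simp]: "\<omega> \<in> space M"
    have "(\<lambda>a. \<Psi> (\<lambda>k\<in>S. resample h k (a, \<omega>))) \<in> borel_measurable std_normal_distribution"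
      by (rule measurable_compose[OF _ measurable_compose[OF m2 assms(4)]]) simp
    then show "(\<integral>a. \<Psi> (\<lambda>k\<in>S. resample h k (a, \<omega>)) \<partial>std_normal_distribution) =
       (\<integral>a. std_normal_density a * \<Psi> (\<lambda>k\<in>S. resample h k (a, \<omega>)) \<partial>lborel)"
      by (subst integral_density) auto
  qed
  finally show ?thesis .
qed

abbreviation Wv :: "'w \<Rightarrow> 'h \<Rightarrow> real"
  where "Wv \<omega> \<equiv> (\<lambda>k. W k \<omega>)"

lemma all_moments_hval: "all_moments M (\<lambda>\<omega>. hval n h (Wv \<omega>))"
proof -
  have "all_moments M (\<lambda>\<omega>. inverse (norm h) * W h \<omega>)"
    by (intro all_moments_mult all_moments_const all_moments_W)
  then have "all_moments M (\<lambda>\<omega>. W h \<omega> / norm h)"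
    by (simp add: divide_inverse mult.commute)
  then show ?thesis unfolding hval_def
    by (intro all_moments_mult all_moments_const all_moments_hermite)
qed

lemma all_moments_sval: "all_moments M (\<lambda>\<omega>. sval S (Wv \<omega>))"
  unfolding sval_def
  by (intro all_moments_sum_list) (auto intro!: all_moments_mult all_moments_const all_moments_hval)

lemma all_moments_slap: "all_moments M (\<lambda>\<omega>. slap S (Wv \<omega>))"
  unfolding slap_def
  by (intro all_moments_sum_list) (auto intro!: all_moments_mult all_moments_const all_moments_hval)

lemma all_moments_sder: "all_moments M (\<lambda>\<omega>. sder S (Wv \<omega>) \<bullet> k)"
  unfolding inner_sder
  by (intro all_moments_sum_list) (auto intro!: all_moments_mult all_moments_const all_moments_hval)

lemmas sval_measurable[measurable] = all_moments_measurable[OF all_moments_sval]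
lemmas hval_measurable[measurable] = all_moments_measurable[OF all_moments_hval]

lemma sder_measurable[measurable]: "(\<lambda>\<omega>. sder S (Wv \<omega>)) \<in> borel_measurable M"
  by (induction S) auto

lemma all_moments_lipschitz:
  assumes "lipschitz_C1 f f'" "all_moments M X"
  shows "all_moments M (\<lambda>\<omega>. f (X \<omega>))" "all_moments M (\<lambda>\<omega>. f' (X \<omega>))"
proof -
  obtain K where K: "K \<ge> 0" "\<And>x. \<bar>f' x\<bar> \<le> K" "\<And>x. \<bar>f x\<bar> \<le> \<bar>f 0\<bar> + K * \<bar>x\<bar>"
    and [measurable]: "f \<in> borel_measurable borel" "f' \<in> borel_measurable borel"
    by (rule lipschitz_C1E[OF assms(1)]) blast
  have [measurable]: "X \<in> borel_measurable M" by (rule all_moments_measurable[OF assms(2)])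
  have "all_moments M (\<lambda>\<omega>. \<bar>X \<omega>\<bar>)"
    by (rule all_moments_mono[OF assms(2)]) auto
  then have "all_moments M (\<lambda>\<omega>. \<bar>f 0\<bar> + K * \<bar>X \<omega>\<bar>)"
    by (intro all_moments_add all_moments_const all_moments_mult)
  then show "all_moments M (\<lambda>\<omega>. f (X \<omega>))"
    by (rule all_moments_mono) (use K in \<open>auto intro: order_trans[OF K(3)]\<close>)
  show "all_moments M (\<lambda>\<omega>. f' (X \<omega>))"
    by (rule all_moments_mono[OF all_moments_const[of K]]) (use K in \<open>auto intro: order_trans[OF K(2)]\<close>)
qed

text \<open>Resample along \<open>h\<close>. For a frozen path the functional is a smooth function
  of the new coordinate \<open>a\<close> of polynomial growth, and \<open>hval n h\<close> is a
  multiple of \<open>hermite n a\<close>; the one-dimensional formula then makes the inner integral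
  zero for every path.\<close>

lemma hval_integration_by_parts:
  assumes f: "lipschitz_C1 f f'"
  shows "(\<integral>\<omega>. hval (Suc n) h (Wv \<omega>) * f (sval S (Wv \<omega>)) \<partial>M) =
    (\<integral>\<omega>. hval n h (Wv \<omega>) * (f' (sval S (Wv \<omega>)) * (sder S (Wv \<omega>) \<bullet> h)) \<partial>M)"
proof (cases "h = 0")
  case True
  then show ?thesis by (simp add: hval_def)
next
  case False
  define I where "I = insert h ((\<lambda>(n, c, h). h) ` set S)"
  have I: "finite I" "h \<in> I" "\<And>n c k. (n, c, k) \<in> set S \<Longrightarrow> k \<in> I" by (force simp: I_def)+
  obtain K where K: "K \<ge> 0" "\<And>x. (f has_real_derivative f' x) (at x)" "continuous_on UNIV f'" "\<And>x. \<bar>f' x\<bar> \<le> K" "\<And>x. \<bar>f x\<bar> \<le> \<bar>f 0\<bar> + K * \<bar>x\<bar>"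
    and [measurable]: "f \<in> borel_measurable borel" "f' \<in> borel_measurable borel"
    by (rule lipschitz_C1E[OF f]) blast
  define \<Psi> where "\<Psi> v = hval (Suc n) h v * f (sval S v) - hval n h v * (f' (sval S v) * (sder S v \<bullet> h))" for v
  have [measurable]: "sval S \<in> borel_measurable (PiM I (\<lambda>_. borel))" "(\<lambda>v. sder S v \<bullet> h) \<in> borel_measurable (PiM I (\<lambda>_. borel))"
    using I by (auto intro: measurable_sval_PiM measurable_inner_sder_PiM)
  have [measurable]: "\<Psi> \<in> borel_measurable (PiM I (\<lambda>_. borel))"
    unfolding \<Psi>_def using I(2) by measurable
  \<comment> \<open>The restriction is undefined outside \<open>I\<close>, but \<open>\<Psi>\<close>
    only looks at vectors of \<open>I\<close>.\<close>
  have restr: "\<Psi> (restrict v I) = \<Psi> v" for v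
    unfolding \<Psi>_def using I by (simp cong: hval_cong sval_cong sder_cong add: hval_cong[of "restrict v I" _ v] sval_cong[of S "restrict v I" v] sder_cong[of S "restrict v I" v])
  have i1: "integrable M (\<lambda>\<omega>. hval (Suc n) h (Wv \<omega>) * f (sval S (Wv \<omega>)))"
    by (intro all_moments_integrable all_moments_mult all_moments_hval all_moments_lipschitz[OF f] all_moments_sval)
  have i2: "integrable M (\<lambda>\<omega>. hval n h (Wv \<omega>) * (f' (sval S (Wv \<omega>)) * (sder S (Wv \<omega>) \<bullet> h)))"
    by (intro all_moments_integrable all_moments_mult all_moments_hval all_moments_lipschitz[OF f] all_moments_sval all_moments_sder)
  have int: "integrable M (\<lambda>\<omega>. \<Psi> (Wv \<omega>))"
    unfolding \<Psi>_def by (intro Bochner_Integration.integrable_diff i1 i2)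
  have inner0: "(\<integral>a. std_normal_density a * \<Psi> (\<lambda>k. resample h k (a, \<omega>)) \<partial>lborel) = 0" for \<omega>
  proof -
    define r where "r = norm h"
    have r: "r > 0" using False by (simp add: r_def)
    define v where "v a k = resample h k (a, \<omega>)" for a k
    \<comment> \<open>Along \<open>a\<close> the path moves at speed
      \<open>(k \<bullet> h) / r\<close> in coordinate \<open>k\<close>. By the chain rule a
      functional then has derivative \<open>(sder S (v a) \<bullet> h) / r\<close>.\<close>
    have vd: "((\<lambda>a. v a k) has_real_derivative (k \<bullet> h) / r) (at a)" for a k
      unfolding v_def resample_def using r
      by (auto intro!: derivative_eq_intros simp: r_def[symmetric] power2_eq_square)
    have vpb: "poly_bounded (\<lambda>a. v a k)" for k
    proof -
      have "(\<lambda>a. v a k) = (\<lambda>a. (W k \<omega> - (k \<bullet> h) / (norm h)\<^sup>2 * W h \<omega>) + (k \<bullet> h) / (norm h)\<^sup>2 * norm h * a)"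
        by (auto simp: v_def resample_def algebra_simps add_divide_distrib diff_divide_distrib)
      moreover have "poly_bounded \<dots>"
        by (intro poly_bounded_add poly_bounded_mult poly_bounded_const poly_bounded_id)
      ultimately show ?thesis by (simp only:)
    qed
    have hpb: "poly_bounded (\<lambda>a. hval m k (v a))" for m k
    proof -
      have "poly_bounded (\<lambda>a. norm k ^ m * hermite m (inverse (norm k) * v a k))"
        by (intro poly_bounded_mult poly_bounded_const poly_bounded_hermite vpb)
      then show ?thesis by (simp add: hval_def divide_inverse mult.commute)
    qed
    have hd: "((\<lambda>a. hval m k (v a)) has_real_derivative real m * hval (m - 1) k (v a) * ((k \<bullet> h) / r)) (at a)" for m k a
      unfolding hval_def by (rule hval_has_derivative[OF vd]) simp
    have hc: "continuous_on UNIV (\<lambda>a. hval m k (v a))" for m k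
      using hd by (meson DERIV_isCont continuous_at_imp_continuous_on)
    have sd: "((\<lambda>a. sval S (v a)) has_real_derivative (sder S (v a) \<bullet> h) / r) (at a)" for a
    proof (induction S)
      case (Cons p S)
      obtain m c k where p: "p = (m, c, k)" by (cases p)
      show ?case unfolding p sval_simps sder_simps
        using r by (auto intro!: derivative_eq_intros Cons hd simp: inner_add_left field_simps)
    qed simp
    have spb: "poly_bounded (\<lambda>a. sval S (v a))"
      unfolding sval_def by (intro poly_bounded_sum_list) (auto intro!: poly_bounded_mult poly_bounded_const hpb)
    have spb': "poly_bounded (\<lambda>a. sder S (v a) \<bullet> h)"
      unfolding inner_sder by (intro poly_bounded_sum_list) (auto intro!: poly_bounded_mult poly_bounded_const hpb)
    have sc: "continuous_on UNIV (\<lambda>a. sval S (v a))"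
      using sd by (meson DERIV_isCont continuous_at_imp_continuous_on)
    have sc': "continuous_on UNIV (\<lambda>a. sder S (v a) \<bullet> h)"
    proof (induction S)
      case (Cons p S)
      obtain m c k where p: "p = (m, c, k)" by (cases p)
      show ?case unfolding p sder_simps inner_add_left inner_scaleR_left
        by (intro continuous_intros Cons hc)
    qed simp
    define u where "u a = f (sval S (v a))" for a
    define u' where "u' a = f' (sval S (v a)) * ((sder S (v a) \<bullet> h) / r)" for a
    have 1: "(\<integral>x. std_normal_density x * (hermite (Suc n) x * u x - hermite n x * u' x) \<partial>lborel) = 0"
    proof (rule hermite_integration_by_parts)
      show "(u has_real_derivative u' x) (at x)" for x
        unfolding u_def u'_def by (rule DERIV_chain2[OF K(2) sd])
      show "continuous_on UNIV u'" unfolding u'_def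
        using r by (intro continuous_intros sc' continuous_on_compose2[OF K(3) sc]) auto
      have "poly_bounded (\<lambda>a. \<bar>sval S (v a)\<bar>)" by (rule poly_bounded_mono[OF spb]) simp
      then have "poly_bounded (\<lambda>a. \<bar>f 0\<bar> + K * \<bar>sval S (v a)\<bar>)"
        by (intro poly_bounded_add poly_bounded_mult poly_bounded_const)
      then show "poly_bounded u"
        by (rule poly_bounded_mono) (use K in \<open>auto simp: u_def intro: order_trans[OF K(5)]\<close>)
      have "poly_bounded (\<lambda>a. f' (sval S (v a)))"
        by (rule poly_bounded_mono[OF poly_bounded_const[of K]]) (use K in \<open>auto intro: order_trans[OF K(4)]\<close>)
      then show "poly_bounded u'" unfolding u'_def divide_inverse
        by (intro poly_bounded_mult poly_bounded_const spb')
    qed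
    \<comment> \<open>Of the factor \<open>r ^ Suc n\<close>, the second term takes
      \<open>r ^ n\<close> from \<open>hval n\<close> and one more \<open>r\<close> from the
      quotient in \<open>u'\<close>.\<close>
    have 2: "\<Psi> (v a) = r ^ Suc n * (hermite (Suc n) a * u a - hermite n a * u' a)" for a
    proof -
      have vh: "v a h / norm h = a"
        using r by (simp add: v_def resample_def r_def[symmetric] power2_norm_eq_inner[symmetric])
      have *: "hval m h (v a) = r ^ m * hermite m a" for m
        unfolding hval_def vh by (simp add: r_def)
      show ?thesis using r unfolding \<Psi>_def * u_def u'_def by (simp add: algebra_simps)
    qed
    have "(\<integral>a. std_normal_density a * \<Psi> (v a) \<partial>lborel) =
       (\<integral>a. r ^ Suc n * (std_normal_density a * (hermite (Suc n) a * u a - hermite n a * u' a)) \<partial>lborel)"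
      unfolding 2 by (simp add: mult_ac)
    also have "\<dots> = 0" unfolding integral_mult_right_zero 1 by simp
    finally show ?thesis by (simp add: v_def[abs_def])
  qed
  have "(\<integral>\<omega>. \<Psi> (Wv \<omega>) \<partial>M) = (\<integral>\<omega>. \<Psi> (\<lambda>k\<in>I. W k \<omega>) \<partial>M)"
    by (simp add: restr)
  also have "\<dots> = (\<integral>\<omega>. (\<integral>a. std_normal_density a * \<Psi> (\<lambda>k\<in>I. resample h k (a, \<omega>)) \<partial>lborel) \<partial>M)"
  proof (rule integral_resample[OF I(1,2) False])
    show "integrable M (\<lambda>\<omega>. \<Psi> (\<lambda>k\<in>I. W k \<omega>))" using int by (simp only: restr)
  qed simp
  also have "\<dots> = 0" by (simp add: restr inner0)
  finally have "(\<integral>\<omega>. \<Psi> (Wv \<omega>) \<partial>M) = 0" .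
  then show ?thesis unfolding \<Psi>_def using i1 i2 by simp
qed

lemma sval_integration_by_parts:
  assumes f: "lipschitz_C1 f f'"
  shows "(\<integral>\<omega>. slap T (Wv \<omega>) * f (sval S (Wv \<omega>)) \<partial>M) =
    (\<integral>\<omega>. f' (sval S (Wv \<omega>)) * (sder T (Wv \<omega>) \<bullet> sder S (Wv \<omega>)) \<partial>M)"
proof (induction T)
  case (Cons p T)
  obtain m c k where p: "p = (m, c, k)" by (cases p)
  note im = all_moments_integrable all_moments_mult all_moments_hval all_moments_lipschitz[OF f] all_moments_sval all_moments_sder all_moments_slap all_moments_const
  \<comment> \<open>For \<open>m = 0\<close> the factor \<open>real m\<close> annihilates both
    sides, so the truncated \<open>m - 1\<close> causes no harm.\<close>
  have step: "(\<integral>\<omega>. real m * hval m k (Wv \<omega>) * f (sval S (Wv \<omega>)) \<partial>M) =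
     (\<integral>\<omega>. real m * hval (m - 1) k (Wv \<omega>) * (f' (sval S (Wv \<omega>)) * (sder S (Wv \<omega>) \<bullet> k)) \<partial>M)"
    using hval_integration_by_parts[OF f, of "m - 1" k S] by (cases m) (simp_all add: mult.assoc)
  have dots: "all_moments M (\<lambda>\<omega>. sder T (Wv \<omega>) \<bullet> sder S (Wv \<omega>))" for T
    unfolding inner_sder[of T]
    by (intro all_moments_sum_list) (auto intro!: all_moments_mult all_moments_const all_moments_hval all_moments_sder simp: inner_commute[of _ "sder _ _"])
  have "(\<integral>\<omega>. slap (p # T) (Wv \<omega>) * f (sval S (Wv \<omega>)) \<partial>M) =
    (\<integral>\<omega>. c * (real m * hval m k (Wv \<omega>) * f (sval S (Wv \<omega>))) + slap T (Wv \<omega>) * f (sval S (Wv \<omega>)) \<partial>M)"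
    by (simp add: p algebra_simps)
  also have "\<dots> = c * (\<integral>\<omega>. real m * hval m k (Wv \<omega>) * f (sval S (Wv \<omega>)) \<partial>M) + (\<integral>\<omega>. slap T (Wv \<omega>) * f (sval S (Wv \<omega>)) \<partial>M)"
    by (subst Bochner_Integration.integral_add) (auto intro!: im)
  also have "\<dots> = (\<integral>\<omega>. c * (real m * hval (m - 1) k (Wv \<omega>) * (f' (sval S (Wv \<omega>)) * (sder S (Wv \<omega>) \<bullet> k))) + f' (sval S (Wv \<omega>)) * (sder T (Wv \<omega>) \<bullet> sder S (Wv \<omega>)) \<partial>M)"
    unfolding step Cons by (subst Bochner_Integration.integral_add) (auto intro!: im dots)
  also have "\<dots> = (\<integral>\<omega>. f' (sval S (Wv \<omega>)) * (sder (p # T) (Wv \<omega>) \<bullet> sder S (Wv \<omega>)) \<partial>M)"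
    by (intro Bochner_Integration.integral_cong refl) (simp add: p inner_add_left inner_commute algebra_simps)
  finally show ?case .
qed simp

lemma expectation_hval_Suc: "(\<integral>\<omega>. hval (Suc n) h (Wv \<omega>) \<partial>M) = 0"
proof -
  have "lipschitz_C1 (\<lambda>_. 1) (\<lambda>_. 0)" by (auto simp: lipschitz_C1_def)
  from hval_integration_by_parts[OF this, of n h "[]"] show ?thesis by simp
qed

text \<open>Integration by parts with the identity as test function lowers both degrees by one at
  the price of \<open>real m * (h \<bullet> k)\<close>. The induction ends where one degree is zero:
  there the other factor has mean zero or is constant.\<close>

lemma expectation_hval_mult:
  "(\<integral>\<omega>. hval n h (Wv \<omega>) * hval m k (Wv \<omega>) \<partial>M) = (if n = m then fact n * (h \<bullet> k) ^ n else 0)"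
proof (induction n arbitrary: m)
  case 0
  then show ?case using expectation_hval_Suc[of _ k] by (cases m) (auto simp: prob_space)
next
  case (Suc n)
  have id: "lipschitz_C1 (\<lambda>x. x) (\<lambda>_. 1)" by (auto simp: lipschitz_C1_def intro!: exI[of _ 1])
  have "(\<integral>\<omega>. hval (Suc n) h (Wv \<omega>) * hval m k (Wv \<omega>) \<partial>M) =
    (\<integral>\<omega>. real m * (h \<bullet> k) * (hval n h (Wv \<omega>) * hval (m - 1) k (Wv \<omega>)) \<partial>M)"
    using hval_integration_by_parts[OF id, of n h "[(m, 1, k)]"] by (simp add: mult_ac inner_commute)
  also have "\<dots> = real m * (h \<bullet> k) * (if n = m - 1 then fact n * (h \<bullet> k) ^ n else 0)"
    by (simp only: integral_mult_right_zero Suc)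
  also have "\<dots> = (if Suc n = m then fact (Suc n) * (h \<bullet> k) ^ Suc n else 0)"
    by (cases m) auto
  finally show ?case .
qed

end

subsection \<open>Square integrable random variables\<close>

lemma sq_integrable_measurable: "sq_integrable M X \<Longrightarrow> X \<in> borel_measurable M"
  by (simp add: sq_integrable_def)

lemma sq_integrable_norm: "sq_integrable M X \<Longrightarrow> integrable M (\<lambda>\<omega>. (norm (X \<omega>))\<^sup>2)"
  by (simp add: sq_integrable_def)

lemma norm_add_sq_le: "(norm (x + y))\<^sup>2 \<le> 2 * ((norm x)\<^sup>2 + (norm y)\<^sup>2)" for x y :: "'e::real_normed_vector"
proof -
  have "(norm (x + y))\<^sup>2 \<le> (norm x + norm y)\<^sup>2" by (intro power_mono norm_triangle_ineq) auto
  also have "\<dots> \<le> 2 * ((norm x)\<^sup>2 + (norm y)\<^sup>2)"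
    using sum_squares_bound[of "norm x" "norm y"] by (simp add: power2_sum)
  finally show ?thesis .
qed

lemma sq_integrable_bound:
  assumes "sq_integrable M Y" "X \<in> borel_measurable M" "\<And>\<omega>. norm (X \<omega>) \<le> C * norm (Y \<omega>)"
  shows "sq_integrable M X"
  unfolding sq_integrable_def
proof
  note [measurable] = assms(2) sq_integrable_measurable[OF assms(1)]
  show "integrable M (\<lambda>\<omega>. (norm (X \<omega>))\<^sup>2)"
  proof (rule Bochner_Integration.integrable_bound)
    show "integrable M (\<lambda>\<omega>. C\<^sup>2 * (norm (Y \<omega>))\<^sup>2)"
      using assms(1) by (auto simp: sq_integrable_def)
    show "AE \<omega> in M. norm ((norm (X \<omega>))\<^sup>2) \<le> norm (C\<^sup>2 * (norm (Y \<omega>))\<^sup>2)"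
    proof (intro AE_I2)
      fix \<omega>
      have "(norm (X \<omega>))\<^sup>2 \<le> (C * norm (Y \<omega>))\<^sup>2" by (intro power_mono assms(3)) simp
      then show "norm ((norm (X \<omega>))\<^sup>2) \<le> norm (C\<^sup>2 * (norm (Y \<omega>))\<^sup>2)"
        by (simp add: power_mult_distrib)
    qed
  qed simp
qed (fact assms)

lemma sq_integrable_add:
  assumes "sq_integrable M X" "sq_integrable M Y" shows "sq_integrable M (\<lambda>\<omega>. X \<omega> + Y \<omega>)"
  unfolding sq_integrable_def
proof
  note [measurable] = sq_integrable_measurable[OF assms(1)] sq_integrable_measurable[OF assms(2)]
  show "(\<lambda>\<omega>. X \<omega> + Y \<omega>) \<in> borel_measurable M" by simp
  show "integrable M (\<lambda>\<omega>. (norm (X \<omega> + Y \<omega>))\<^sup>2)"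
  proof (rule Bochner_Integration.integrable_bound)
    show "integrable M (\<lambda>\<omega>. 2 * ((norm (X \<omega>))\<^sup>2 + (norm (Y \<omega>))\<^sup>2))"
      using assms by (auto simp: sq_integrable_def)
    show "AE \<omega> in M. norm ((norm (X \<omega> + Y \<omega>))\<^sup>2) \<le> norm (2 * ((norm (X \<omega>))\<^sup>2 + (norm (Y \<omega>))\<^sup>2))"
    proof (intro AE_I2)
      fix \<omega>
      have "0 \<le> 2 * ((norm (X \<omega>))\<^sup>2 + (norm (Y \<omega>))\<^sup>2)" by simp
      then show "norm ((norm (X \<omega> + Y \<omega>))\<^sup>2) \<le> norm (2 * ((norm (X \<omega>))\<^sup>2 + (norm (Y \<omega>))\<^sup>2))"
        using norm_add_sq_le[of "X \<omega>" "Y \<omega>"] by (simp only: real_norm_def abs_of_nonneg zero_le_power2)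
    qed
  qed simp
qed

lemma sq_integrable_scaleR: "sq_integrable M X \<Longrightarrow> sq_integrable M (\<lambda>\<omega>. c *\<^sub>R X \<omega>)"
proof (rule sq_integrable_bound[of M X _ "\<bar>c\<bar>"])
  assume X: "sq_integrable M X"
  then show "sq_integrable M X" .
  from sq_integrable_measurable[OF X] show "(\<lambda>\<omega>. c *\<^sub>R X \<omega>) \<in> borel_measurable M" by simp
qed simp

lemma sq_integrable_cmult: "sq_integrable M X \<Longrightarrow> sq_integrable M (\<lambda>\<omega>. c * X \<omega>)" for X :: "_ \<Rightarrow> real"
  using sq_integrable_scaleR[of M X c] by simp

lemma sq_integrable_diff:
  "sq_integrable M X \<Longrightarrow> sq_integrable M Y \<Longrightarrow> sq_integrable M (\<lambda>\<omega>. X \<omega> - Y \<omega>)"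
  using sq_integrable_add[OF _ sq_integrable_scaleR[of M Y "-1"], of X] by simp

lemma sq_integrable_zero: "sq_integrable M (\<lambda>_. 0)"
  by (simp add: sq_integrable_def)

lemma sq_integrable_sum: "(\<And>i. i \<in> I \<Longrightarrow> sq_integrable M (X i)) \<Longrightarrow> sq_integrable M (\<lambda>\<omega>. \<Sum>i\<in>I. X i \<omega>)"
  by (induction I rule: infinite_finite_induct) (auto intro!: sq_integrable_add sq_integrable_zero)

lemma sq_integrable_inner:
  fixes X :: "'w \<Rightarrow> 'h::{real_inner, second_countable_topology}"
  assumes "sq_integrable M X"
  shows "sq_integrable M (\<lambda>\<omega>. X \<omega> \<bullet> h)"
proof (rule sq_integrable_bound[OF assms])
  note [measurable] = sq_integrable_measurable[OF assms(1)]
  show "(\<lambda>\<omega>. X \<omega> \<bullet> h) \<in> borel_measurable M" by simp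
  show "norm (X \<omega> \<bullet> h) \<le> norm h * norm (X \<omega>)" for \<omega>
    using Cauchy_Schwarz_ineq2[of "X \<omega>" h] by (simp add: mult.commute)
qed

lemma sq_integrable_bounded_scaleR:
  assumes "sq_integrable M X" "c \<in> borel_measurable M" "\<And>\<omega>. \<bar>c \<omega>\<bar> \<le> K"
  shows "sq_integrable M (\<lambda>\<omega>. c \<omega> *\<^sub>R X \<omega>)"
proof (rule sq_integrable_bound[OF assms(1), of _ K])
  from assms(2) sq_integrable_measurable[OF assms(1)]
  show "(\<lambda>\<omega>. c \<omega> *\<^sub>R X \<omega>) \<in> borel_measurable M" by simp
  show "norm (c \<omega> *\<^sub>R X \<omega>) \<le> K * norm (X \<omega>)" for \<omega>
    using mult_right_mono[OF assms(3)[of \<omega>], of "norm (X \<omega>)"] by simp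
qed

lemma all_moments_sq_integrable: "all_moments M X \<Longrightarrow> sq_integrable M X"
  using all_moments_integrable_sq[of M X] all_moments_measurable[of M X] by (simp add: sq_integrable_def)

lemma sq_integrable_inner_integrable:
  fixes X Y :: "'w \<Rightarrow> 'h::{real_inner, second_countable_topology}"
  assumes "sq_integrable M X" "sq_integrable M Y"
  shows "integrable M (\<lambda>\<omega>. X \<omega> \<bullet> Y \<omega>)"
proof (rule Bochner_Integration.integrable_bound)
  note [measurable] = sq_integrable_measurable[OF assms(1)] sq_integrable_measurable[OF assms(2)]
  show "integrable M (\<lambda>\<omega>. (norm (X \<omega>))\<^sup>2 + (norm (Y \<omega>))\<^sup>2)"
    using assms by (auto simp: sq_integrable_def)
  show "(\<lambda>\<omega>. X \<omega> \<bullet> Y \<omega>) \<in> borel_measurable M" by simp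
  show "AE \<omega> in M. norm (X \<omega> \<bullet> Y \<omega>) \<le> norm ((norm (X \<omega>))\<^sup>2 + (norm (Y \<omega>))\<^sup>2)"
  proof (intro AE_I2)
    fix \<omega>
    have "\<bar>X \<omega> \<bullet> Y \<omega>\<bar> \<le> norm (X \<omega>) * norm (Y \<omega>)" by (rule Cauchy_Schwarz_ineq2)
    moreover have "2 * (norm (X \<omega>) * norm (Y \<omega>)) \<le> (norm (X \<omega>))\<^sup>2 + (norm (Y \<omega>))\<^sup>2"
      using sum_squares_bound[of "norm (X \<omega>)" "norm (Y \<omega>)"] by (simp add: mult.assoc)
    moreover have "0 \<le> norm (X \<omega>) * norm (Y \<omega>)" by simp
    ultimately have "\<bar>X \<omega> \<bullet> Y \<omega>\<bar> \<le> (norm (X \<omega>))\<^sup>2 + (norm (Y \<omega>))\<^sup>2" by linarith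
    then show "norm (X \<omega> \<bullet> Y \<omega>) \<le> norm ((norm (X \<omega>))\<^sup>2 + (norm (Y \<omega>))\<^sup>2)" by simp
  qed
qed

lemma sq_integrable_mult_integrable:
  "sq_integrable M X \<Longrightarrow> sq_integrable M Y \<Longrightarrow> integrable M (\<lambda>\<omega>. X \<omega> * Y \<omega>)" for X Y :: "'w \<Rightarrow> real"
  using sq_integrable_inner_integrable[of M X Y] by simp

lemma (in finite_measure) sq_integrable_const: "sq_integrable M (\<lambda>_. c)"
  by (simp add: sq_integrable_def)

lemma (in finite_measure) sq_integrable_integrable:
  "sq_integrable M X \<Longrightarrow> integrable M X" for X :: "_ \<Rightarrow> real"
  using sq_integrable_mult_integrable[OF _ sq_integrable_const, of X 1] by simp

lemma Cauchy_Schwarz_integral: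
  fixes X Y :: "'w \<Rightarrow> 'h::{real_inner, second_countable_topology}"
  assumes X: "sq_integrable M X" and Y: "sq_integrable M Y"
  shows "\<bar>\<integral>\<omega>. X \<omega> \<bullet> Y \<omega> \<partial>M\<bar> \<le> sqrt (\<integral>\<omega>. (norm (X \<omega>))\<^sup>2 \<partial>M) * sqrt (\<integral>\<omega>. (norm (Y \<omega>))\<^sup>2 \<partial>M)"
proof -
  define a b c where "a = (\<integral>\<omega>. (norm (X \<omega>))\<^sup>2 \<partial>M)" and "b = (\<integral>\<omega>. (norm (Y \<omega>))\<^sup>2 \<partial>M)"
    and "c = (\<integral>\<omega>. X \<omega> \<bullet> Y \<omega> \<partial>M)"
  note int = sq_integrable_inner_integrable[OF X Y] sq_integrable_norm[OF X] sq_integrable_norm[OF Y]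
  have q: "0 \<le> t\<^sup>2 * a + 2 * t * c + b" for t
  proof -
    have "0 \<le> (\<integral>\<omega>. (norm (t *\<^sub>R X \<omega> + Y \<omega>))\<^sup>2 \<partial>M)" by simp
    also have "\<dots> = (\<integral>\<omega>. t\<^sup>2 * (norm (X \<omega>))\<^sup>2 + 2 * t * (X \<omega> \<bullet> Y \<omega>) + (norm (Y \<omega>))\<^sup>2 \<partial>M)"
      unfolding power2_norm_eq_inner
      by (simp add: inner_add_left inner_add_right inner_commute power2_eq_square algebra_simps)
    also have "\<dots> = t\<^sup>2 * a + 2 * t * c + b"
      using int by (simp add: a_def b_def c_def)
    finally show ?thesis .
  qed
  have ab: "a \<ge> 0" "b \<ge> 0" by (auto simp: a_def b_def)
  have "c\<^sup>2 \<le> a * b"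
  proof (cases "a = 0")
    case True
    have "c = 0"
    proof (rule ccontr)
      assume "c \<noteq> 0"
      \<comment> \<open>This \<open>t\<close> is chosen so that the quadratic expression, affine
        because \<open>a = 0\<close>, takes the value \<open>- 1\<close>.\<close>
      then have "2 * (- (b + 1) / (2 * c)) * c = - (b + 1)" by simp
      then show False using q[of "- (b + 1) / (2 * c)"] True by simp
    qed
    then show ?thesis using True by simp
  next
    case False
    then have "a > 0" using ab by simp
    then show ?thesis using q[of "- c / a"] by (simp add: power2_eq_square field_simps)
  qed
  then have "\<bar>c\<bar> \<le> sqrt (a * b)" by (metis real_sqrt_abs real_sqrt_le_mono)
  then show ?thesis by (simp add: real_sqrt_mult a_def b_def c_def)
qed

section \<open>Convergence in L2\<close>

lemma L2_tendsto_iff: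
  assumes "\<And>k. sq_integrable M (Y k)" "sq_integrable M X"
  shows "L2_tendsto M Y X \<longleftrightarrow> (\<lambda>k. \<integral>\<omega>. (norm (Y k \<omega> - X \<omega>))\<^sup>2 \<partial>M) \<longlonglongrightarrow> 0"
proof -
  have "(\<integral>\<^sup>+\<omega>. ennreal ((norm (Y k \<omega> - X \<omega>))\<^sup>2) \<partial>M) = ennreal (\<integral>\<omega>. (norm (Y k \<omega> - X \<omega>))\<^sup>2 \<partial>M)" for k
    using assms by (intro nn_integral_eq_integral sq_integrable_norm sq_integrable_diff) auto
  then show ?thesis
    unfolding L2_tendsto_def by (simp add: ennreal_0[symmetric] del: ennreal_0)
qed

lemma L2_tendsto_add:
  assumes "\<And>k. sq_integrable M (Y k)" "sq_integrable M X" "\<And>k. sq_integrable M (Y' k)" "sq_integrable M X'"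
    and "L2_tendsto M Y X" "L2_tendsto M Y' X'"
  shows "L2_tendsto M (\<lambda>k \<omega>. Y k \<omega> + Y' k \<omega>) (\<lambda>\<omega>. X \<omega> + X' \<omega>)"
proof -
  have "(\<lambda>k. \<integral>\<omega>. (norm ((Y k \<omega> + Y' k \<omega>) - (X \<omega> + X' \<omega>)))\<^sup>2 \<partial>M) \<longlonglongrightarrow> 0"
  proof (rule Lim_null_comparison)
    have "(\<lambda>k. 2 * ((\<integral>\<omega>. (norm (Y k \<omega> - X \<omega>))\<^sup>2 \<partial>M) + (\<integral>\<omega>. (norm (Y' k \<omega> - X' \<omega>))\<^sup>2 \<partial>M))) \<longlonglongrightarrow> 2 * (0 + 0)"
      using assms by (intro tendsto_intros) (simp_all add: L2_tendsto_iff)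
    then show "(\<lambda>k. 2 * ((\<integral>\<omega>. (norm (Y k \<omega> - X \<omega>))\<^sup>2 \<partial>M) + (\<integral>\<omega>. (norm (Y' k \<omega> - X' \<omega>))\<^sup>2 \<partial>M))) \<longlonglongrightarrow> 0" by simp
    show "\<forall>\<^sub>F k in sequentially. norm (\<integral>\<omega>. (norm ((Y k \<omega> + Y' k \<omega>) - (X \<omega> + X' \<omega>)))\<^sup>2 \<partial>M) \<le>
       2 * ((\<integral>\<omega>. (norm (Y k \<omega> - X \<omega>))\<^sup>2 \<partial>M) + (\<integral>\<omega>. (norm (Y' k \<omega> - X' \<omega>))\<^sup>2 \<partial>M))"
    proof (intro always_eventually allI)
      fix k
      have i: "integrable M (\<lambda>\<omega>. (norm (Y k \<omega> - X \<omega>))\<^sup>2)" "integrable M (\<lambda>\<omega>. (norm (Y' k \<omega> - X' \<omega>))\<^sup>2)"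
        "integrable M (\<lambda>\<omega>. (norm ((Y k \<omega> + Y' k \<omega>) - (X \<omega> + X' \<omega>)))\<^sup>2)"
        using assms by (auto intro!: sq_integrable_norm sq_integrable_diff sq_integrable_add)
      have "(\<integral>\<omega>. (norm ((Y k \<omega> + Y' k \<omega>) - (X \<omega> + X' \<omega>)))\<^sup>2 \<partial>M) \<le>
        (\<integral>\<omega>. 2 * ((norm (Y k \<omega> - X \<omega>))\<^sup>2 + (norm (Y' k \<omega> - X' \<omega>))\<^sup>2) \<partial>M)"
      proof (rule integral_mono)
        show "(norm ((Y k \<omega> + Y' k \<omega>) - (X \<omega> + X' \<omega>)))\<^sup>2 \<le> 2 * ((norm (Y k \<omega> - X \<omega>))\<^sup>2 + (norm (Y' k \<omega> - X' \<omega>))\<^sup>2)" for \<omega>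
          using norm_add_sq_le[of "Y k \<omega> - X \<omega>" "Y' k \<omega> - X' \<omega>"] by (simp add: algebra_simps)
      qed (use i in auto)
      then show "norm (\<integral>\<omega>. (norm ((Y k \<omega> + Y' k \<omega>) - (X \<omega> + X' \<omega>)))\<^sup>2 \<partial>M) \<le>
       2 * ((\<integral>\<omega>. (norm (Y k \<omega> - X \<omega>))\<^sup>2 \<partial>M) + (\<integral>\<omega>. (norm (Y' k \<omega> - X' \<omega>))\<^sup>2 \<partial>M))"
        using i by simp
    qed
  qed
  then show ?thesis using assms by (subst L2_tendsto_iff) (auto intro!: sq_integrable_add)
qed

text \<open>One contraction estimate that serves scalar multiples, inner products with a fixed
  vector and Lipschitz functions alike.\<close>

lemma L2_tendsto_lipschitz_image:
  assumes "\<And>k. sq_integrable M (Y k)" "sq_integrable M X" "L2_tendsto M Y X"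
    and "\<And>k. sq_integrable M (Y' k)" "sq_integrable M X'"
    and le: "\<And>k \<omega>. norm (Y' k \<omega> - X' \<omega>) \<le> K * norm (Y k \<omega> - X \<omega>)"
  shows "L2_tendsto M Y' X'"
proof -
  have "(\<lambda>k. \<integral>\<omega>. (norm (Y' k \<omega> - X' \<omega>))\<^sup>2 \<partial>M) \<longlonglongrightarrow> 0"
  proof (rule Lim_null_comparison)
    show "(\<lambda>k. K\<^sup>2 * (\<integral>\<omega>. (norm (Y k \<omega> - X \<omega>))\<^sup>2 \<partial>M)) \<longlonglongrightarrow> 0"
      using assms by (intro tendsto_mult_right_zero) (simp add: L2_tendsto_iff)
    show "\<forall>\<^sub>F k in sequentially. norm (\<integral>\<omega>. (norm (Y' k \<omega> - X' \<omega>))\<^sup>2 \<partial>M) \<le> K\<^sup>2 * (\<integral>\<omega>. (norm (Y k \<omega> - X \<omega>))\<^sup>2 \<partial>M)"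
    proof (intro always_eventually allI)
      fix k
      have "(\<integral>\<omega>. (norm (Y' k \<omega> - X' \<omega>))\<^sup>2 \<partial>M) \<le> (\<integral>\<omega>. K\<^sup>2 * (norm (Y k \<omega> - X \<omega>))\<^sup>2 \<partial>M)"
      proof (rule integral_mono)
        show "integrable M (\<lambda>\<omega>. (norm (Y' k \<omega> - X' \<omega>))\<^sup>2)"
          using assms by (intro sq_integrable_norm sq_integrable_diff)
        show "integrable M (\<lambda>\<omega>. K\<^sup>2 * (norm (Y k \<omega> - X \<omega>))\<^sup>2)"
          using assms by (intro integrable_mult_right sq_integrable_norm sq_integrable_diff)
        show "(norm (Y' k \<omega> - X' \<omega>))\<^sup>2 \<le> K\<^sup>2 * (norm (Y k \<omega> - X \<omega>))\<^sup>2" for \<omega>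
          using power_mono[OF le[of k \<omega>], of 2] by (simp add: power_mult_distrib)
      qed
      then show "norm (\<integral>\<omega>. (norm (Y' k \<omega> - X' \<omega>))\<^sup>2 \<partial>M) \<le> K\<^sup>2 * (\<integral>\<omega>. (norm (Y k \<omega> - X \<omega>))\<^sup>2 \<partial>M)"
        by simp
    qed
  qed
  then show ?thesis using assms by (subst L2_tendsto_iff)
qed

lemma L2_tendsto_scaleR:
  assumes "\<And>k. sq_integrable M (Y k)" "sq_integrable M X" "L2_tendsto M Y X"
  shows "L2_tendsto M (\<lambda>k \<omega>. c *\<^sub>R Y k \<omega>) (\<lambda>\<omega>. c *\<^sub>R X \<omega>)"
  by (rule L2_tendsto_lipschitz_image[OF assms, where K="\<bar>c\<bar>"])
    (auto intro!: sq_integrable_scaleR assms simp: scaleR_diff_right[symmetric])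

lemma L2_tendsto_zero: "L2_tendsto M (\<lambda>_ _. 0) (\<lambda>_. 0)"
  by (simp add: L2_tendsto_def)

lemma L2_tendsto_sum:
  assumes "\<And>i k. i \<in> I \<Longrightarrow> sq_integrable M (Y i k)" "\<And>i. i \<in> I \<Longrightarrow> sq_integrable M (X i)"
    and "\<And>i. i \<in> I \<Longrightarrow> L2_tendsto M (Y i) (X i)"
  shows "L2_tendsto M (\<lambda>k \<omega>. \<Sum>i\<in>I. Y i k \<omega>) (\<lambda>\<omega>. \<Sum>i\<in>I. X i \<omega>)"
  using assms
  by (induction I rule: infinite_finite_induct)
    (auto intro!: L2_tendsto_add L2_tendsto_zero sq_integrable_sum)

lemma L2_tendsto_inner:
  fixes X :: "'w \<Rightarrow> 'h::{real_inner, second_countable_topology}"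
  assumes "\<And>k. sq_integrable M (Y k)" "sq_integrable M X" "L2_tendsto M Y X"
  shows "L2_tendsto M (\<lambda>k \<omega>. Y k \<omega> \<bullet> h) (\<lambda>\<omega>. X \<omega> \<bullet> h)"
proof (rule L2_tendsto_lipschitz_image[OF assms, where K="norm h"])
  show "norm (Y k \<omega> \<bullet> h - X \<omega> \<bullet> h) \<le> norm h * norm (Y k \<omega> - X \<omega>)" for k \<omega>
    using Cauchy_Schwarz_ineq2[of "Y k \<omega> - X \<omega>" h] by (simp add: inner_diff_left mult.commute)
qed (intro sq_integrable_inner assms)+

lemma L2_tendsto_integral_inner:
  fixes X :: "'w \<Rightarrow> 'h::{real_inner, second_countable_topology}"
  assumes "\<And>k. sq_integrable M (Y k)" "sq_integrable M X" "L2_tendsto M Y X" "sq_integrable M Z"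
  shows "(\<lambda>k. \<integral>\<omega>. Y k \<omega> \<bullet> Z \<omega> \<partial>M) \<longlonglongrightarrow> (\<integral>\<omega>. X \<omega> \<bullet> Z \<omega> \<partial>M)"
proof (rule LIM_zero_cancel, rule Lim_null_comparison)
  have "(\<lambda>k. sqrt (\<integral>\<omega>. (norm (Y k \<omega> - X \<omega>))\<^sup>2 \<partial>M) * sqrt (\<integral>\<omega>. (norm (Z \<omega>))\<^sup>2 \<partial>M)) \<longlonglongrightarrow> sqrt 0 * sqrt (\<integral>\<omega>. (norm (Z \<omega>))\<^sup>2 \<partial>M)"
    using assms by (intro tendsto_intros) (simp add: L2_tendsto_iff)
  then show "(\<lambda>k. sqrt (\<integral>\<omega>. (norm (Y k \<omega> - X \<omega>))\<^sup>2 \<partial>M) * sqrt (\<integral>\<omega>. (norm (Z \<omega>))\<^sup>2 \<partial>M)) \<longlonglongrightarrow> 0" by simp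
  show "\<forall>\<^sub>F k in sequentially. norm ((\<integral>\<omega>. Y k \<omega> \<bullet> Z \<omega> \<partial>M) - (\<integral>\<omega>. X \<omega> \<bullet> Z \<omega> \<partial>M)) \<le>
      sqrt (\<integral>\<omega>. (norm (Y k \<omega> - X \<omega>))\<^sup>2 \<partial>M) * sqrt (\<integral>\<omega>. (norm (Z \<omega>))\<^sup>2 \<partial>M)"
  proof (intro always_eventually allI)
    fix k
    have "(\<integral>\<omega>. Y k \<omega> \<bullet> Z \<omega> \<partial>M) - (\<integral>\<omega>. X \<omega> \<bullet> Z \<omega> \<partial>M) = (\<integral>\<omega>. (Y k \<omega> - X \<omega>) \<bullet> Z \<omega> \<partial>M)"
      using assms by (subst Bochner_Integration.integral_diff[symmetric])
        (auto intro!: sq_integrable_inner_integrable simp: inner_diff_left)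
    then show "norm ((\<integral>\<omega>. Y k \<omega> \<bullet> Z \<omega> \<partial>M) - (\<integral>\<omega>. X \<omega> \<bullet> Z \<omega> \<partial>M)) \<le>
      sqrt (\<integral>\<omega>. (norm (Y k \<omega> - X \<omega>))\<^sup>2 \<partial>M) * sqrt (\<integral>\<omega>. (norm (Z \<omega>))\<^sup>2 \<partial>M)"
      using assms Cauchy_Schwarz_integral[of M "\<lambda>\<omega>. Y k \<omega> - X \<omega>" Z] by (simp add: sq_integrable_diff)
  qed
qed

lemma L2_tendsto_integral_mult:
  fixes X :: "'w \<Rightarrow> real"
  assumes "\<And>k. sq_integrable M (Y k)" "sq_integrable M X" "L2_tendsto M Y X" "sq_integrable M Z"
  shows "(\<lambda>k. \<integral>\<omega>. Y k \<omega> * Z \<omega> \<partial>M) \<longlonglongrightarrow> (\<integral>\<omega>. X \<omega> * Z \<omega> \<partial>M)"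
  using L2_tendsto_integral_inner[OF assms] by simp

lemma L2_tendsto_subseq:
  assumes "L2_tendsto M Y X" "strict_mono r"
  shows "L2_tendsto M (\<lambda>k. Y (r k)) X"
  using LIMSEQ_subseq_LIMSEQ[OF assms(1)[unfolded L2_tendsto_def] assms(2)]
  by (simp add: L2_tendsto_def o_def)

lemma L2_tendsto_AE_subseq:
  fixes X :: "'w \<Rightarrow> real"
  assumes "\<And>k. sq_integrable M (Y k)" "sq_integrable M X" "L2_tendsto M Y X"
  obtains r where "strict_mono r" "AE \<omega> in M. (\<lambda>k. Y (r k) \<omega>) \<longlonglongrightarrow> X \<omega>"
proof -
  have "\<exists>r::nat\<Rightarrow>nat. strict_mono r \<and> (AE \<omega> in M. (\<lambda>n. (norm (Y (r n) \<omega> - X \<omega>))\<^sup>2) \<longlonglongrightarrow> 0)"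
  proof (rule tendsto_L1_AE_subseq)
    show "integrable M (\<lambda>\<omega>. (norm (Y n \<omega> - X \<omega>))\<^sup>2)" for n
      by (intro sq_integrable_norm sq_integrable_diff assms)
    show "(\<lambda>n. \<integral>\<omega>. norm ((norm (Y n \<omega> - X \<omega>))\<^sup>2) \<partial>M) \<longlonglongrightarrow> 0"
      using assms by (simp add: L2_tendsto_iff)
  qed
  then obtain r where r: "strict_mono r" "AE \<omega> in M. (\<lambda>n. (norm (Y (r n) \<omega> - X \<omega>))\<^sup>2) \<longlonglongrightarrow> 0" by blast
  have "AE \<omega> in M. (\<lambda>k. Y (r k) \<omega>) \<longlonglongrightarrow> X \<omega>"
    using r(2)
  proof eventually_elim
    case (elim \<omega>)
    from tendsto_real_sqrt[OF elim] have "(\<lambda>n. \<bar>Y (r n) \<omega> - X \<omega>\<bar>) \<longlonglongrightarrow> 0" by simp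
    then show ?case using LIM_zero_cancel tendsto_rabs_zero_iff by blast
  qed
  with r(1) show ?thesis using that by blast
qed

lemma L2_tendsto_lipschitz:
  assumes "lipschitz_C1 f f'" "\<And>k. sq_integrable M (Y k)" "sq_integrable M X" "L2_tendsto M Y X"
    "\<And>k. sq_integrable M (\<lambda>\<omega>. f (Y k \<omega>))" "sq_integrable M (\<lambda>\<omega>. f (X \<omega>))"
  shows "L2_tendsto M (\<lambda>k \<omega>. f (Y k \<omega>)) (\<lambda>\<omega>. f (X \<omega>))"
proof -
  obtain K where K: "\<And>x y. \<bar>f x - f y\<bar> \<le> K * \<bar>x - y\<bar>"
    by (rule lipschitz_C1E[OF assms(1)]) blast
  then show ?thesis
    by (intro L2_tendsto_lipschitz_image[OF assms(2-6), where K=K]) simp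
qed

section \<open>Weak convergence of Hilbert-valued variables\<close>

lemma sq_integrable_simple_approx:
  fixes T :: "'w \<Rightarrow> 'h::{real_inner, second_countable_topology}"
  assumes T: "sq_integrable M T" and "\<epsilon> > 0"
  obtains s where "simple_function M s" "sq_integrable M s" "(\<integral>\<omega>. (norm (T \<omega> - s \<omega>))\<^sup>2 \<partial>M) < \<epsilon>"
proof -
  note [measurable] = sq_integrable_measurable[OF T]
  obtain F where F: "\<And>i. simple_function M (F i)" "\<And>x. x \<in> space M \<Longrightarrow> (\<lambda>i. F i x) \<longlonglongrightarrow> T x"
    "\<And>i x. x \<in> space M \<Longrightarrow> dist (F i x) 0 \<le> 2 * dist (T x) 0"
    using borel_measurable_implies_sequence_metric[of T M 0] assms(1)[THEN sq_integrable_measurable] by metis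
  have [measurable]: "F i \<in> borel_measurable M" for i using F(1) by (rule borel_measurable_simple_function)
  have si: "sq_integrable M (F i)" for i
    unfolding sq_integrable_def
  proof
    show "integrable M (\<lambda>\<omega>. (norm (F i \<omega>))\<^sup>2)"
    proof (rule Bochner_Integration.integrable_bound)
      show "integrable M (\<lambda>\<omega>. 4 * (norm (T \<omega>))\<^sup>2)" using sq_integrable_norm[OF T] by simp
      show "AE \<omega> in M. norm ((norm (F i \<omega>))\<^sup>2) \<le> norm (4 * (norm (T \<omega>))\<^sup>2)"
      proof (intro AE_I2)
        fix \<omega> assume "\<omega> \<in> space M"
        from power_mono[OF F(3)[OF this, of i], of 2] show "norm ((norm (F i \<omega>))\<^sup>2) \<le> norm (4 * (norm (T \<omega>))\<^sup>2)"
          by (simp add: power_mult_distrib)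
      qed
    qed simp
  qed simp
  have "(\<lambda>i. \<integral>\<omega>. (norm (T \<omega> - F i \<omega>))\<^sup>2 \<partial>M) \<longlonglongrightarrow> (\<integral>\<omega>. 0 \<partial>M)"
  proof (rule integral_dominated_convergence)
    \<comment> \<open>The constant is \<open>10 = 2 * (1 + 4)\<close>: the approximants satisfy
      \<open>norm (F i \<omega>) \<le> 2 * norm (T \<omega>)\<close>, and the square of a difference
      costs a factor 2.\<close>
    show "integrable M (\<lambda>\<omega>. 10 * (norm (T \<omega>))\<^sup>2)" using sq_integrable_norm[OF T] by simp
    show "AE \<omega> in M. (\<lambda>i. (norm (T \<omega> - F i \<omega>))\<^sup>2) \<longlonglongrightarrow> 0"
    proof (intro AE_I2)
      fix \<omega> assume "\<omega> \<in> space M"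
      have "(\<lambda>i. (norm (T \<omega> - F i \<omega>))\<^sup>2) \<longlonglongrightarrow> (norm (T \<omega> - T \<omega>))\<^sup>2"
        by (intro tendsto_intros F(2) \<open>\<omega> \<in> space M\<close>)
      then show "(\<lambda>i. (norm (T \<omega> - F i \<omega>))\<^sup>2) \<longlonglongrightarrow> 0" by simp
    qed
    show "AE \<omega> in M. norm ((norm (T \<omega> - F i \<omega>))\<^sup>2) \<le> 10 * (norm (T \<omega>))\<^sup>2" for i
    proof (intro AE_I2)
      fix \<omega> assume "\<omega> \<in> space M"
      from power_mono[OF F(3)[OF this, of i], of 2] have "(norm (F i \<omega>))\<^sup>2 \<le> 4 * (norm (T \<omega>))\<^sup>2"
        by (simp add: power_mult_distrib)
      with norm_add_sq_le[of "T \<omega>" "- F i \<omega>"] show "norm ((norm (T \<omega> - F i \<omega>))\<^sup>2) \<le> 10 * (norm (T \<omega>))\<^sup>2"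
        by simp
    qed
  qed auto
  then have "\<forall>\<^sub>F i in sequentially. (\<integral>\<omega>. (norm (T \<omega> - F i \<omega>))\<^sup>2 \<partial>M) < \<epsilon>"
    using \<open>\<epsilon> > 0\<close> by (auto dest: order_tendstoD(2))
  then obtain i where "(\<integral>\<omega>. (norm (T \<omega> - F i \<omega>))\<^sup>2 \<partial>M) < \<epsilon>"
    by (auto simp: eventually_sequentially)
  with si F(1) show ?thesis using that by blast
qed

text \<open>A simple function has finitely many values \<open>v\<close>, so the pairing is a finite
  sum of scalar pairings \<open>D k \<omega> \<bullet> v\<close> with indicators, and each of them
  converges.\<close>

lemma integral_inner_simple_tendsto:
  fixes D :: "nat \<Rightarrow> 'w \<Rightarrow> 'h::{real_inner, second_countable_topology}"
  assumes "finite_measure M"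
    and D: "\<And>k. sq_integrable M (D k)" and weak: "\<And>h. L2_tendsto M (\<lambda>k \<omega>. D k \<omega> \<bullet> h) (\<lambda>_. 0)"
    and s: "simple_function M s"
  shows "(\<lambda>k. \<integral>\<omega>. D k \<omega> \<bullet> s \<omega> \<partial>M) \<longlonglongrightarrow> 0"
proof -
  interpret finite_measure M by fact
  have fin: "finite (s ` space M)" using s by (simp add: simple_function_def)
  have meas: "s -` {v} \<inter> space M \<in> sets M" for v by (rule simple_functionD(2)[OF s])
  have ind: "sq_integrable M (\<lambda>\<omega>. indicator (s -` {v} \<inter> space M) \<omega> :: real)" for v
    unfolding sq_integrable_def using meas[of v]
    by (auto intro!: integrable_const_bound[where B=1] borel_measurable_indicator split: split_indicator)
  have eq: "D k \<omega> \<bullet> s \<omega> = (\<Sum>v\<in>s ` space M. (D k \<omega> \<bullet> v) * indicator (s -` {v} \<inter> space M) \<omega>)" if "\<omega> \<in> space M" for k \<omega>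
  proof -
    have "(\<Sum>v\<in>s ` space M. (D k \<omega> \<bullet> v) * indicator (s -` {v} \<inter> space M) \<omega>) = (\<Sum>v\<in>s ` space M. if v = s \<omega> then D k \<omega> \<bullet> v else 0)"
      using that by (intro sum.cong) (auto simp: indicator_def)
    also have "\<dots> = D k \<omega> \<bullet> s \<omega>" using fin that by (simp add: sum.delta)
    finally show ?thesis by simp
  qed
  have int: "integrable M (\<lambda>\<omega>. (D k \<omega> \<bullet> v) * indicator (s -` {v} \<inter> space M) \<omega>)" for k v
    by (rule sq_integrable_mult_integrable[OF sq_integrable_inner[OF D] ind])
  have "(\<integral>\<omega>. D k \<omega> \<bullet> s \<omega> \<partial>M) = (\<Sum>v\<in>s ` space M. \<integral>\<omega>. (D k \<omega> \<bullet> v) * indicator (s -` {v} \<inter> space M) \<omega> \<partial>M)" for k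
  proof -
    have "(\<integral>\<omega>. D k \<omega> \<bullet> s \<omega> \<partial>M) = (\<integral>\<omega>. (\<Sum>v\<in>s ` space M. (D k \<omega> \<bullet> v) * indicator (s -` {v} \<inter> space M) \<omega>) \<partial>M)"
      by (rule Bochner_Integration.integral_cong[OF refl eq])
    also have "\<dots> = (\<Sum>v\<in>s ` space M. \<integral>\<omega>. (D k \<omega> \<bullet> v) * indicator (s -` {v} \<inter> space M) \<omega> \<partial>M)"
      by (rule Bochner_Integration.integral_sum[OF int])
    finally show ?thesis .
  qed
  moreover have "(\<lambda>k. \<Sum>v\<in>s ` space M. \<integral>\<omega>. (D k \<omega> \<bullet> v) * indicator (s -` {v} \<inter> space M) \<omega> \<partial>M) \<longlonglongrightarrow> (\<Sum>v\<in>s ` space M. \<integral>\<omega>. 0 * indicator (s -` {v} \<inter> space M) \<omega> \<partial>M)"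
    by (intro tendsto_sum L2_tendsto_integral_mult sq_integrable_inner D weak ind sq_integrable_zero)
  ultimately show ?thesis by simp
qed

text \<open>Simple functions are dense in L2, and the norm bound makes the error of replacing
  \<open>T\<close> by a simple function uniform in \<open>k\<close>.\<close>

lemma weak_L2_tendsto_integral_inner:
  fixes D :: "nat \<Rightarrow> 'w \<Rightarrow> 'h::{real_inner, second_countable_topology}"
  assumes "finite_measure M"
    and D: "\<And>k. sq_integrable M (D k)" and weak: "\<And>h. L2_tendsto M (\<lambda>k \<omega>. D k \<omega> \<bullet> h) (\<lambda>_. 0)"
    and bd: "\<And>k. (\<integral>\<omega>. (norm (D k \<omega>))\<^sup>2 \<partial>M) \<le> C" and T: "sq_integrable M T"
  shows "(\<lambda>k. \<integral>\<omega>. D k \<omega> \<bullet> T \<omega> \<partial>M) \<longlonglongrightarrow> 0"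
proof (rule LIMSEQ_I)
  fix e :: real assume e: "e > 0"
  have C: "C \<ge> 0" using bd[of 0] by (smt (verit) integral_nonneg_AE AE_I2 zero_le_power2)
  \<comment> \<open>Chosen so that \<open>(sqrt C + 1) * sqrt \<epsilon> = e / 2\<close>; the added
    1 keeps the denominator positive when \<open>C = 0\<close>.\<close>
  define \<epsilon> where "\<epsilon> = (e / (2 * (sqrt C + 1)))\<^sup>2"
  have sc: "sqrt C + 1 > 0" using C by (simp add: add_nonneg_pos)
  have "\<epsilon> > 0" using e sc by (simp add: \<epsilon>_def)
  then obtain s where s: "simple_function M s" "sq_integrable M s" "(\<integral>\<omega>. (norm (T \<omega> - s \<omega>))\<^sup>2 \<partial>M) < \<epsilon>"
    using sq_integrable_simple_approx[OF T] by metis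
  have "(\<lambda>k. \<integral>\<omega>. D k \<omega> \<bullet> s \<omega> \<partial>M) \<longlonglongrightarrow> 0"
    by (rule integral_inner_simple_tendsto) (use assms s in auto)
  then have "\<exists>n0. \<forall>k\<ge>n0. norm ((\<integral>\<omega>. D k \<omega> \<bullet> s \<omega> \<partial>M) - 0) < e / 2"
    using e by (intro LIMSEQ_D) auto
  then obtain n0 where n0: "\<And>k. k \<ge> n0 \<Longrightarrow> \<bar>\<integral>\<omega>. D k \<omega> \<bullet> s \<omega> \<partial>M\<bar> < e / 2" by auto
  have "norm ((\<integral>\<omega>. D k \<omega> \<bullet> T \<omega> \<partial>M) - 0) < e" if "k \<ge> n0" for k
  proof -
    have "(\<integral>\<omega>. D k \<omega> \<bullet> T \<omega> \<partial>M) = (\<integral>\<omega>. D k \<omega> \<bullet> s \<omega> + D k \<omega> \<bullet> (T \<omega> - s \<omega>) \<partial>M)"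
      by (simp add: inner_diff_right)
    also have "\<dots> = (\<integral>\<omega>. D k \<omega> \<bullet> s \<omega> \<partial>M) + (\<integral>\<omega>. D k \<omega> \<bullet> (T \<omega> - s \<omega>) \<partial>M)"
      by (intro Bochner_Integration.integral_add sq_integrable_inner_integrable D s sq_integrable_diff T)
    finally have 1: "(\<integral>\<omega>. D k \<omega> \<bullet> T \<omega> \<partial>M) = (\<integral>\<omega>. D k \<omega> \<bullet> s \<omega> \<partial>M) + (\<integral>\<omega>. D k \<omega> \<bullet> (T \<omega> - s \<omega>) \<partial>M)" .
    have "\<bar>\<integral>\<omega>. D k \<omega> \<bullet> (T \<omega> - s \<omega>) \<partial>M\<bar> \<le> sqrt (\<integral>\<omega>. (norm (D k \<omega>))\<^sup>2 \<partial>M) * sqrt (\<integral>\<omega>. (norm (T \<omega> - s \<omega>))\<^sup>2 \<partial>M)"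
      by (intro Cauchy_Schwarz_integral D s sq_integrable_diff T)
    also have "\<dots> \<le> sqrt C * sqrt \<epsilon>"
      using bd[of k] s(3) C by (intro mult_mono) auto
    also have "\<dots> \<le> (sqrt C + 1) * sqrt \<epsilon>"
      by (intro mult_right_mono) (auto simp: \<epsilon>_def)
    also have "\<dots> = e / 2"
    proof -
      have "sqrt \<epsilon> = e / (2 * (sqrt C + 1))" using sc e by (simp add: \<epsilon>_def)
      moreover have "(sqrt C + 1) * (e / (2 * (sqrt C + 1))) = e / 2" using sc by (simp add: divide_simps)
      ultimately show ?thesis by simp
    qed
    finally show ?thesis using n0[OF that] 1 by simp
  qed
  then show "\<exists>n0. \<forall>k\<ge>n0. norm ((\<integral>\<omega>. D k \<omega> \<bullet> T \<omega> \<partial>M) - 0) < e" by blast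
qed

subsection \<open>Symmetric tensors and the isometry\<close>

definition orthonormal :: "'h::real_inner set \<Rightarrow> bool"
  where "orthonormal B \<longleftrightarrow> finite B \<and> pairwise orthogonal B \<and> (\<forall>b\<in>B. norm b = 1)"

lemma orthonormal_inner: "orthonormal B \<Longrightarrow> b \<in> B \<Longrightarrow> c \<in> B \<Longrightarrow> b \<bullet> c = (if b = c then 1 else 0)"
  by (auto simp: orthonormal_def pairwise_def orthogonal_def dot_square_norm)

lemma orthonormal_expand:
  assumes B: "orthonormal B" and h: "h \<in> span B"
  shows "(\<Sum>b\<in>B. (h \<bullet> b) *\<^sub>R b) = h"
proof -
  have fin: "finite B" using B by (simp add: orthonormal_def)
  obtain u where u: "h = (\<Sum>b\<in>B. u b *\<^sub>R b)" using h span_finite[OF fin] by auto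
  have "h \<bullet> c = u c" if "c \<in> B" for c
  proof -
    have "h \<bullet> c = (\<Sum>b\<in>B. u b * (b \<bullet> c))" by (simp add: u inner_sum_left)
    also have "\<dots> = (\<Sum>b\<in>B. if b = c then u b else 0)"
      using orthonormal_inner[OF B _ that] by (intro sum.cong) auto
    finally show ?thesis using fin that by simp
  qed
  then show ?thesis unfolding u by (intro sum.cong) auto
qed

lemma orthonormal_parseval:
  assumes B: "orthonormal B" and h: "h \<in> span B"
  shows "(\<Sum>b\<in>B. (h \<bullet> b) * (k \<bullet> b)) = h \<bullet> k"
proof -
  have "h \<bullet> k = (\<Sum>b\<in>B. (h \<bullet> b) *\<^sub>R b) \<bullet> k" by (simp add: orthonormal_expand[OF assms])
  also have "\<dots> = (\<Sum>b\<in>B. (h \<bullet> b) * (b \<bullet> k))" by (simp add: inner_sum_left)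
  finally show ?thesis by (simp only: inner_commute[of k])
qed

text \<open>One Gram-Schmidt step: the component of \<open>h\<close> orthogonal to \<open>B\<close>
  is either zero or is normalized and adjoined.\<close>

lemma orthonormal_extend:
  assumes B: "orthonormal B"
  obtains B' where "orthonormal B'" "B \<subseteq> B'" "h \<in> span B'"
proof -
  have fin: "finite B" using B by (simp add: orthonormal_def)
  define p where "p = (\<Sum>b\<in>B. (h \<bullet> b) *\<^sub>R b)"
  define e where "e = h - p"
  have p: "p \<in> span B" unfolding p_def by (intro span_sum span_scale span_base)
  have eb: "e \<bullet> c = 0" if "c \<in> B" for c
  proof -
    have "p \<bullet> c = (\<Sum>b\<in>B. (h \<bullet> b) * (b \<bullet> c))" by (simp add: p_def inner_sum_left)
    also have "\<dots> = (\<Sum>b\<in>B. if b = c then h \<bullet> b else 0)"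
      using orthonormal_inner[OF B _ that] by (intro sum.cong) auto
    finally show ?thesis using fin that by (simp add: e_def inner_diff_left)
  qed
  show ?thesis
  proof (cases "e = 0")
    case True
    then have "h \<in> span B" using p by (simp add: e_def)
    then show ?thesis using that[OF B] by blast
  next
    case False
    define b' where "b' = e /\<^sub>R norm e"
    have "orthonormal (insert b' B)"
      using B False eb by (auto simp: orthonormal_def b'_def pairwise_insert orthogonal_def inner_commute)
    moreover have "h \<in> span (insert b' B)"
    proof -
      have "h = p + norm e *\<^sub>R b'" using False by (simp add: b'_def e_def)
      moreover have "p \<in> span (insert b' B)" using p span_mono[of B "insert b' B"] by blast
      ultimately show ?thesis by (metis span_add span_scale span_base insertI1)
    qed
    ultimately show ?thesis using that by blast
  qed
qed

lemma orthonormal_cover: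
  assumes "finite S"
  obtains B :: "'h::real_inner set" where "orthonormal B" "S \<subseteq> span B"
proof -
  have "\<exists>B :: 'h set. orthonormal B \<and> S \<subseteq> span B"
    using assms
  proof (induction S rule: finite_induct)
    case empty
    show ?case by (intro exI[of _ "{}"]) (simp add: orthonormal_def)
  next
    case (insert x S)
    then obtain B where B: "orthonormal B" "S \<subseteq> span B" by blast
    obtain B' where "orthonormal B'" "B \<subseteq> B'" "x \<in> span B'" using orthonormal_extend[OF B(1)] by metis
    with B(2) show ?case using span_mono[of B B'] by blast
  qed
  then show ?thesis using that by blast
qed

section \<open>Tensor norms computed on finite orthonormal sets\<close>

lemma sum_lists_Suc:
  "(\<Sum>xs\<in>{xs. set xs \<subseteq> B \<and> length xs = Suc n}. f xs) =
    (\<Sum>xs\<in>{xs. set xs \<subseteq> B \<and> length xs = n}. \<Sum>b\<in>B. f (b # xs))"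
proof -
  have "(\<Sum>xs\<in>{xs. set xs \<subseteq> B \<and> length xs = Suc n}. f xs) =
    (\<Sum>p\<in>{xs. set xs \<subseteq> B \<and> length xs = n} \<times> B. f (snd p # fst p))"
    unfolding lists_length_Suc_eq
    by (subst sum.reindex) (auto simp: inj_on_def case_prod_beta')
  then show ?thesis by (simp add: sum.cartesian_product case_prod_beta')
qed

lemma sum_lists_prod:
  fixes F :: "'b \<Rightarrow> real"
  shows "(\<Sum>xs\<in>{xs. set xs \<subseteq> B \<and> length xs = n}. \<Prod>x\<leftarrow>xs. F x) = (\<Sum>b\<in>B. F b) ^ n"
proof (induction n)
  case 0
  have "{xs. set xs \<subseteq> B \<and> length xs = 0} = {[]}" by auto
  then show ?case by simp
next
  case (Suc n)
  have "(\<Sum>xs\<in>{xs. set xs \<subseteq> B \<and> length xs = Suc n}. \<Prod>x\<leftarrow>xs. F x) =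
    (\<Sum>xs\<in>{xs. set xs \<subseteq> B \<and> length xs = n}. (\<Prod>x\<leftarrow>xs. F x) * (\<Sum>b\<in>B. F b))"
    unfolding sum_lists_Suc by (simp add: sum_distrib_right mult.commute)
  also have "\<dots> = (\<Sum>xs\<in>{xs. set xs \<subseteq> B \<and> length xs = n}. \<Prod>x\<leftarrow>xs. F x) * (\<Sum>b\<in>B. F b)"
    by (rule sum_distrib_right[symmetric])
  finally show ?case by (simp only: Suc power_Suc2)
qed

lemma tensor_power_mult: "tensor_power h xs * tensor_power k xs = (\<Prod>x\<leftarrow>xs. (h \<bullet> x) * (k \<bullet> x))"
  unfolding tensor_power_def by (induction xs) (auto simp: mult_ac)

text \<open>The distributive law turns the sum over lists into a power of a sum over
  \<open>B\<close>, which Parseval evaluates as soon as one of the two vectors lies in the span.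
  This is the scalar product of two tensor powers.\<close>

lemma sum_tensor_power_mult:
  assumes "orthonormal B" "h \<in> span B"
  shows "(\<Sum>xs\<in>{xs. set xs \<subseteq> B \<and> length xs = n}. tensor_power h xs * tensor_power k xs) = (h \<bullet> k) ^ n"
  by (simp only: tensor_power_mult sum_lists_prod orthonormal_parseval[OF assms])

lemma tensor_norm_sq_cong:
  "(\<And>xs. length xs = n \<Longrightarrow> (f xs)\<^sup>2 = (g xs)\<^sup>2) \<Longrightarrow> tensor_norm_sq n f = tensor_norm_sq n g"
  unfolding tensor_norm_sq_def by (intro SUP_cong sum.cong) auto

lemma ennreal_tendsto_0_le:
  fixes a b :: "nat \<Rightarrow> ennreal"
  assumes "a \<longlonglongrightarrow> c" "c = 0" "\<And>k. b k \<le> a k" shows "b \<longlonglongrightarrow> 0"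
  using assms by (intro tendsto_sandwich[of "\<lambda>_. 0" b sequentially a]) auto

lemma tensor_norm_sq_ge:
  assumes "orthonormal B"
  shows "ennreal (\<Sum>xs\<in>{xs. set xs \<subseteq> B \<and> length xs = n}. (f xs)\<^sup>2) \<le> tensor_norm_sq n f"
proof -
  have "ennreal (\<Sum>xs\<in>{xs. set xs \<subseteq> B \<and> length xs = n}. (f xs)\<^sup>2) =
    (\<Sum>xs\<in>{xs. set xs \<subseteq> B \<and> length xs = n}. ennreal ((f xs)\<^sup>2))"
    by (rule sum_ennreal[symmetric]) simp
  also have "\<dots> \<le> tensor_norm_sq n f"
    unfolding tensor_norm_sq_def using assms by (intro SUP_upper) (auto simp: orthonormal_def)
  finally show ?thesis .
qed

lemma tensor_norm_sq_leI:
  assumes "\<And>B. orthonormal B \<Longrightarrow> ennreal (\<Sum>xs\<in>{xs. set xs \<subseteq> B \<and> length xs = n}. (f xs)\<^sup>2) \<le> c"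
  shows "tensor_norm_sq n f \<le> c"
  unfolding tensor_norm_sq_def
proof (rule SUP_least)
  fix B assume "B \<in> {B :: 'a set. finite B \<and> pairwise orthogonal B \<and> (\<forall>b\<in>B. norm b = 1)}"
  then have "orthonormal B" by (simp add: orthonormal_def)
  from assms[OF this] show "(\<Sum>xs\<in>{xs. set xs \<subseteq> B \<and> length xs = n}. ennreal ((f xs)\<^sup>2)) \<le> c"
    by (subst sum_ennreal) auto
qed

lemma tensor_norm_sq_diff:
  "tensor_norm_sq n (\<lambda>xs. f xs - g xs) \<le> 2 * (tensor_norm_sq n f + tensor_norm_sq n g)"
proof (rule tensor_norm_sq_leI)
  fix B :: "'a set" assume B: "orthonormal B"
  let ?L = "{xs. set xs \<subseteq> B \<and> length xs = n}"
  have "(\<Sum>xs\<in>?L. (f xs - g xs)\<^sup>2) \<le> (\<Sum>xs\<in>?L. 2 * ((f xs)\<^sup>2 + (g xs)\<^sup>2))"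
  proof (rule sum_mono)
    show "(f xs - g xs)\<^sup>2 \<le> 2 * ((f xs)\<^sup>2 + (g xs)\<^sup>2)" for xs
      using norm_add_sq_le[of "f xs" "- g xs"] by simp
  qed
  also have "\<dots> = 2 * ((\<Sum>xs\<in>?L. (f xs)\<^sup>2) + (\<Sum>xs\<in>?L. (g xs)\<^sup>2))"
    by (simp add: sum_distrib_left sum.distrib)
  finally have "ennreal (\<Sum>xs\<in>?L. (f xs - g xs)\<^sup>2) \<le> ennreal (2 * ((\<Sum>xs\<in>?L. (f xs)\<^sup>2) + (\<Sum>xs\<in>?L. (g xs)\<^sup>2)))"
    by (rule ennreal_leI)
  also have "\<dots> = 2 * (ennreal (\<Sum>xs\<in>?L. (f xs)\<^sup>2) + ennreal (\<Sum>xs\<in>?L. (g xs)\<^sup>2))"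
    by (simp add: ennreal_mult sum_nonneg)
  also have "\<dots> \<le> 2 * (tensor_norm_sq n f + tensor_norm_sq n g)"
    by (intro mult_left_mono add_mono tensor_norm_sq_ge B) auto
  finally show "ennreal (\<Sum>xs\<in>?L. (f xs - g xs)\<^sup>2) \<le> 2 * (tensor_norm_sq n f + tensor_norm_sq n g)" .
qed

text \<open>Enlarge the orthonormal set until its span contains \<open>h\<close>, expand the first
  argument in it, and apply Cauchy-Schwarz in that slot; the coefficients of \<open>h\<close>
  contribute its squared norm.\<close>

lemma tensor_norm_sq_contract:
  fixes a :: "'h::real_inner list \<Rightarrow> real"
  assumes lin: "\<And>xs. length xs = m \<Longrightarrow> linear (\<lambda>x. a (x # xs))"
  shows "tensor_norm_sq m (\<lambda>xs. a (h # xs)) \<le> ennreal ((norm h)\<^sup>2) * tensor_norm_sq (Suc m) a"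
proof (rule tensor_norm_sq_leI)
  fix B :: "'h set" assume B: "orthonormal B"
  obtain B' where B': "orthonormal B'" "B \<subseteq> B'" "h \<in> span B'" using orthonormal_extend[OF B] by metis
  have fin': "finite B'" using B' by (simp add: orthonormal_def)
  let ?L = "\<lambda>B n. {xs. set xs \<subseteq> B \<and> length xs = n}"
  have "(\<Sum>xs\<in>?L B m. (a (h # xs))\<^sup>2) \<le> (\<Sum>xs\<in>?L B' m. (a (h # xs))\<^sup>2)"
    using B'(2) fin' by (intro sum_mono2 finite_lists_length_eq) auto
  also have "\<dots> \<le> (\<Sum>xs\<in>?L B' m. (norm h)\<^sup>2 * (\<Sum>b\<in>B'. (a (b # xs))\<^sup>2))"
  proof (rule sum_mono)
    fix xs assume "xs \<in> ?L B' m"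
    then have l: "linear (\<lambda>x. a (x # xs))" using lin by simp
    have "a (h # xs) = a ((\<Sum>b\<in>B'. (h \<bullet> b) *\<^sub>R b) # xs)" using orthonormal_expand[OF B'(1,3)] by simp
    also have "\<dots> = (\<Sum>b\<in>B'. (h \<bullet> b) * a (b # xs))"
      using linear_sum[OF l, of "\<lambda>b. (h \<bullet> b) *\<^sub>R b" B'] linear_cmul[OF l] by simp
    finally have "(a (h # xs))\<^sup>2 \<le> (\<Sum>b\<in>B'. (h \<bullet> b)\<^sup>2) * (\<Sum>b\<in>B'. (a (b # xs))\<^sup>2)"
      by (simp add: Cauchy_Schwarz_ineq_sum)
    also have "(\<Sum>b\<in>B'. (h \<bullet> b)\<^sup>2) = (norm h)\<^sup>2"
      using orthonormal_parseval[OF B'(1,3), of h] by (simp add: power2_eq_square power2_norm_eq_inner[symmetric] dot_square_norm)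
    finally show "(a (h # xs))\<^sup>2 \<le> (norm h)\<^sup>2 * (\<Sum>b\<in>B'. (a (b # xs))\<^sup>2)" .
  qed
  also have "\<dots> = (norm h)\<^sup>2 * (\<Sum>xs\<in>?L B' (Suc m). (a xs)\<^sup>2)"
    unfolding sum_lists_Suc by (simp add: sum_distrib_left)
  finally have "ennreal (\<Sum>xs\<in>?L B m. (a (h # xs))\<^sup>2) \<le> ennreal ((norm h)\<^sup>2 * (\<Sum>xs\<in>?L B' (Suc m). (a xs)\<^sup>2))"
    by (rule ennreal_leI)
  also have "\<dots> = ennreal ((norm h)\<^sup>2) * ennreal (\<Sum>xs\<in>?L B' (Suc m). (a xs)\<^sup>2)"
    by (simp add: ennreal_mult sum_nonneg)
  also have "\<dots> \<le> ennreal ((norm h)\<^sup>2) * tensor_norm_sq (Suc m) a"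
    by (intro mult_left_mono tensor_norm_sq_ge B') auto
  finally show "ennreal (\<Sum>xs\<in>?L B m. (a (h # xs))\<^sup>2) \<le> ennreal ((norm h)\<^sup>2) * tensor_norm_sq (Suc m) a" .
qed

text \<open>The degree is not recorded: it is the length of the argument list here, while for the
  integrals \<open>homog n\<close> attaches it.\<close>

definition kern :: "(real \<times> 'h::real_inner) list \<Rightarrow> 'h list \<Rightarrow> real"
  where "kern S xs = (\<Sum>(c, h)\<leftarrow>S. c * tensor_power h xs)"

definition homog :: "nat \<Rightarrow> (real \<times> 'h::real_inner) list \<Rightarrow> (nat \<times> real \<times> 'h) list"
  where "homog n S = map (\<lambda>(c, h). (n, c, h)) S"

text \<open>Inserting \<open>k\<close> into one slot of a tensor power only rescales its
  coefficient. On kernels this is the contraction; on integrals it is, up to the degree as a factor,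
  the derivative in direction \<open>k\<close>.\<close>

definition kcontract :: "'h::real_inner \<Rightarrow> (real \<times> 'h) list \<Rightarrow> (real \<times> 'h) list"
  where "kcontract k S = map (\<lambda>(c, h). (c * (h \<bullet> k), h)) S"

definition kneg :: "(real \<times> 'h::real_inner) list \<Rightarrow> (real \<times> 'h) list"
  where "kneg S = map (\<lambda>(c, h). (- c, h)) S"

lemma kern_simps[simp]: "kern [] xs = 0" "kern ((c, h) # S) xs = c * tensor_power h xs + kern S xs"
  "kern (S @ T) xs = kern S xs + kern T xs"
  by (auto simp: kern_def)

lemma homog_simps[simp]: "homog n [] = []" "homog n ((c, h) # S) = (n, c, h) # homog n S"
  "homog n (S @ T) = homog n S @ homog n T"
  by (auto simp: homog_def)

lemma kcontract_simps[simp]: "kcontract k [] = []" "kcontract k ((c, h) # S) = (c * (h \<bullet> k), h) # kcontract k S"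
  by (auto simp: kcontract_def)

lemma kneg_simps[simp]: "kneg [] = []" "kneg ((c, h) # S) = (- c, h) # kneg S"
  by (auto simp: kneg_def)

lemma sval_homog: "sval (homog n S) v = (\<Sum>(c, h)\<leftarrow>S. c * (norm h ^ n * hermite n (v h / norm h)))"
  by (induction S) (auto simp: hval_def)

lemma slap_homog: "slap (homog n S) v = real n * sval (homog n S) v"
  by (induction S) (auto simp: algebra_simps)

lemma sder_homog: "sder (homog (Suc m) S) v \<bullet> k = real (Suc m) * sval (homog m (kcontract k S)) v"
  by (induction S) (auto simp: algebra_simps inner_add_left)

lemma sval_kneg: "sval (homog n (kneg S)) v = - sval (homog n S) v"
  by (induction S) auto

lemma kern_kneg: "kern (kneg S) xs = - kern S xs"
  by (induction S) auto

lemma kern_kcontract: "kern (kcontract k S) xs = kern S (k # xs)"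
  by (induction S) (auto simp: tensor_power_def)

lemma linear_kern: "linear (\<lambda>x. kern S (x # xs))"
proof (induction S)
  case (Cons p S)
  obtain c h where p: "p = (c, h)" by (cases p)
  have "linear (\<lambda>x. (c * tensor_power h xs) *\<^sub>R (h \<bullet> x))"
    by (intro linear_compose_scale_right bounded_linear.linear bounded_linear_inner_right)
  then have "linear (\<lambda>x. (c * tensor_power h xs) *\<^sub>R (h \<bullet> x) + kern S (x # xs))"
    using Cons by (intro linear_compose_add)
  then show ?case unfolding p by (simp add: tensor_power_def mult_ac)
qed (simp add: linear_zero)

lemma symmetric_tensors_linear:
  "f \<in> symmetric_tensors (Suc m) \<Longrightarrow> length xs = m \<Longrightarrow> linear (\<lambda>x. f (x # xs))"
proof -
  assume "f \<in> symmetric_tensors (Suc m)" and "length xs = m"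
  then have "\<And>xs ys. length xs + length ys + 1 = Suc m \<Longrightarrow> linear (\<lambda>x. f (xs @ x # ys))"
    by (simp add: symmetric_tensors_def)
  from this[of "[]" xs] show ?thesis using \<open>length xs = m\<close> by simp
qed

context isonormal_process
begin

lemma expectation_hval_sval_homog:
  assumes B: "orthonormal B" and h: "h \<in> span B"
  shows "(\<integral>\<omega>. hval n h (Wv \<omega>) * sval (homog n T) (Wv \<omega>) \<partial>M) =
    fact n * (\<Sum>xs\<in>{xs. set xs \<subseteq> B \<and> length xs = n}. tensor_power h xs * kern T xs)"
proof (induction T)
  case (Cons p T)
  obtain d k where p: "p = (d, k)" by (cases p)
  note im = all_moments_integrable all_moments_mult all_moments_hval all_moments_sval all_moments_const
  have "(\<integral>\<omega>. hval n h (Wv \<omega>) * sval (homog n (p # T)) (Wv \<omega>) \<partial>M) =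
    (\<integral>\<omega>. d * (hval n h (Wv \<omega>) * hval n k (Wv \<omega>)) + hval n h (Wv \<omega>) * sval (homog n T) (Wv \<omega>) \<partial>M)"
    by (simp add: p algebra_simps)
  also have "\<dots> = d * (fact n * (h \<bullet> k) ^ n) + (\<integral>\<omega>. hval n h (Wv \<omega>) * sval (homog n T) (Wv \<omega>) \<partial>M)"
    by (subst Bochner_Integration.integral_add) (auto intro!: im simp: expectation_hval_mult)
  also have "\<dots> = fact n * (\<Sum>xs\<in>{xs. set xs \<subseteq> B \<and> length xs = n}. tensor_power h xs * kern (p # T) xs)"
    unfolding Cons sum_tensor_power_mult[OF B h, symmetric]
    by (simp add: p algebra_simps sum.distrib sum_distrib_left)
  finally show ?case .
qed simp

text \<open>The Wiener isometry for simple integrals. By bilinearity it reduces to two tensor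
  powers, where both sides are \<open>fact n * (h \<bullet> k) ^ n\<close>.\<close>

lemma expectation_sval_homog_mult:
  assumes B: "orthonormal B" and S: "snd ` set S \<subseteq> span B"
  shows "(\<integral>\<omega>. sval (homog n S) (Wv \<omega>) * sval (homog n T) (Wv \<omega>) \<partial>M) =
    fact n * (\<Sum>xs\<in>{xs. set xs \<subseteq> B \<and> length xs = n}. kern S xs * kern T xs)"
  using S
proof (induction S)
  case (Cons p S)
  obtain c h where p: "p = (c, h)" by (cases p)
  note im = all_moments_integrable all_moments_mult all_moments_hval all_moments_sval all_moments_const
  have "(\<integral>\<omega>. sval (homog n (p # S)) (Wv \<omega>) * sval (homog n T) (Wv \<omega>) \<partial>M) =
    (\<integral>\<omega>. c * (hval n h (Wv \<omega>) * sval (homog n T) (Wv \<omega>)) + sval (homog n S) (Wv \<omega>) * sval (homog n T) (Wv \<omega>) \<partial>M)"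
    by (simp add: p algebra_simps)
  also have "\<dots> = c * (\<integral>\<omega>. hval n h (Wv \<omega>) * sval (homog n T) (Wv \<omega>) \<partial>M) + (\<integral>\<omega>. sval (homog n S) (Wv \<omega>) * sval (homog n T) (Wv \<omega>) \<partial>M)"
    by (subst Bochner_Integration.integral_add) (auto intro!: im)
  also have "\<dots> = fact n * (\<Sum>xs\<in>{xs. set xs \<subseteq> B \<and> length xs = n}. kern (p # S) xs * kern T xs)"
  proof -
    have "h \<in> span B" using Cons.prems by (simp add: p)
    note expectation_hval_sval_homog[OF B this, of n T]
    moreover have "(\<integral>\<omega>. sval (homog n S) (Wv \<omega>) * sval (homog n T) (Wv \<omega>) \<partial>M) =
      fact n * (\<Sum>xs\<in>{xs. set xs \<subseteq> B \<and> length xs = n}. kern S xs * kern T xs)"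
      using Cons by simp
    ultimately show ?thesis
      by (simp add: p algebra_simps sum.distrib sum_distrib_left)
  qed
  finally show ?case .
qed simp

text \<open>One finite orthonormal set computes the left side exactly, while the tensor norm is a
  supremum over all of them; the inequality is what passes to limits.\<close>

lemma expectation_sval_homog_sq_le:
  "ennreal (\<integral>\<omega>. (sval (homog n S) (Wv \<omega>))\<^sup>2 \<partial>M) \<le> ennreal (fact n) * tensor_norm_sq n (kern S)"
proof -
  obtain B where B: "orthonormal B" "snd ` set S \<subseteq> span B" using orthonormal_cover[of "snd ` set S"] by auto
  have "(\<integral>\<omega>. (sval (homog n S) (Wv \<omega>))\<^sup>2 \<partial>M) = fact n * (\<Sum>xs\<in>{xs. set xs \<subseteq> B \<and> length xs = n}. (kern S xs)\<^sup>2)"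
    using expectation_sval_homog_mult[OF B] by (simp add: power2_eq_square)
  then have "ennreal (\<integral>\<omega>. (sval (homog n S) (Wv \<omega>))\<^sup>2 \<partial>M) = ennreal (fact n) * ennreal (\<Sum>xs\<in>{xs. set xs \<subseteq> B \<and> length xs = n}. (kern S xs)\<^sup>2)"
    by (simp add: ennreal_mult sum_nonneg)
  also have "\<dots> \<le> ennreal (fact n) * tensor_norm_sq n (kern S)"
    by (intro mult_left_mono tensor_norm_sq_ge B) auto
  finally show ?thesis .
qed

lemma expectation_sval_homog_orthogonal:
  assumes "n \<noteq> m"
  shows "(\<integral>\<omega>. sval (homog n S) (Wv \<omega>) * sval (homog m T) (Wv \<omega>) \<partial>M) = 0"
proof (induction S)
  case (Cons p S)
  obtain c h where p: "p = (c, h)" by (cases p)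
  note im = all_moments_integrable all_moments_mult all_moments_hval all_moments_sval all_moments_const
  have h0: "(\<integral>\<omega>. hval n h (Wv \<omega>) * sval (homog m T) (Wv \<omega>) \<partial>M) = 0"
  proof (induction T)
    case (Cons q T)
    obtain d k where q: "q = (d, k)" by (cases q)
    have "(\<integral>\<omega>. hval n h (Wv \<omega>) * sval (homog m (q # T)) (Wv \<omega>) \<partial>M) =
      (\<integral>\<omega>. d * (hval n h (Wv \<omega>) * hval m k (Wv \<omega>)) + hval n h (Wv \<omega>) * sval (homog m T) (Wv \<omega>) \<partial>M)"
      by (simp add: q algebra_simps)
    also have "\<dots> = 0" using assms
      by (subst Bochner_Integration.integral_add) (auto intro!: im simp: expectation_hval_mult Cons)
    finally show ?case .
  qed simp
  have "(\<integral>\<omega>. sval (homog n (p # S)) (Wv \<omega>) * sval (homog m T) (Wv \<omega>) \<partial>M) =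
    (\<integral>\<omega>. c * (hval n h (Wv \<omega>) * sval (homog m T) (Wv \<omega>)) + sval (homog n S) (Wv \<omega>) * sval (homog m T) (Wv \<omega>) \<partial>M)"
    by (simp add: p algebra_simps)
  also have "\<dots> = 0"
    by (subst Bochner_Integration.integral_add) (auto intro!: im simp: h0 Cons)
  finally show ?case .
qed simp

lemma sq_integrable_sval: "sq_integrable M (\<lambda>\<omega>. sval S (Wv \<omega>))"
  by (rule all_moments_sq_integrable[OF all_moments_sval])

lemma sq_integrable_sder: "sq_integrable M (\<lambda>\<omega>. sder S (Wv \<omega>))"
proof (induction S)
  case (Cons p S)
  obtain n c h where p: "p = (n, c, h)" by (cases p)
  have "sq_integrable M (\<lambda>\<omega>. (c * (real n * hval (n - 1) h (Wv \<omega>))) *\<^sub>R h)"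
  proof (rule sq_integrable_bound)
    show "sq_integrable M (\<lambda>\<omega>. c * (real n * hval (n - 1) h (Wv \<omega>)))"
      by (intro sq_integrable_cmult all_moments_sq_integrable all_moments_hval)
    show "norm ((c * (real n * hval (n - 1) h (Wv \<omega>))) *\<^sub>R h) \<le> norm h * norm (c * (real n * hval (n - 1) h (Wv \<omega>)))" for \<omega>
      by simp
  qed measurable
  then show ?case using Cons by (simp add: p sq_integrable_add)
qed (simp add: sq_integrable_zero)

lemma multiple_integralE:
  assumes "multiple_integral M W n f Y"
  obtains S where "L2_tendsto M (\<lambda>k \<omega>. sval (homog n (S k)) (Wv \<omega>)) Y"
    "(\<lambda>k. tensor_norm_sq n (\<lambda>xs. kern (S k) xs - f xs)) \<longlonglongrightarrow> 0" "f \<in> symmetric_tensors n" "sq_integrable M Y"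
  using assms unfolding multiple_integral_def sval_homog kern_def by blast

text \<open>Both sequences of simple integrals have kernels converging to \<open>xs \<mapsto> f (h # xs)\<close>, so the isometry identifies
  their limits.\<close>

lemma sder_homog_tendsto:
  assumes f: "f \<in> symmetric_tensors (Suc m)"
    and S: "(\<lambda>k. tensor_norm_sq (Suc m) (\<lambda>xs. kern (S k) xs - f xs)) \<longlonglongrightarrow> 0"
    and V: "multiple_integral M W m (\<lambda>xs. f (h # xs)) V"
  shows "L2_tendsto M (\<lambda>k \<omega>. sder (homog (Suc m) (S k)) (Wv \<omega>) \<bullet> h) (\<lambda>\<omega>. real (Suc m) * V \<omega>)"
proof -
  obtain S' where S': "L2_tendsto M (\<lambda>k \<omega>. sval (homog m (S' k)) (Wv \<omega>)) V"
    "(\<lambda>k. tensor_norm_sq m (\<lambda>xs. kern (S' k) xs - f (h # xs))) \<longlonglongrightarrow> 0" and V2: "sq_integrable M V"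
    by (rule multiple_integralE[OF V]) (rule that)
  \<comment> \<open>The difference of the two approximations is written as a single list, so that
    the isometry controls it through its kernel.\<close>
  define R where "R k = kcontract h (S k) @ kneg (S' k)" for k
  have Rle: "tensor_norm_sq m (kern (R k)) \<le>
     2 * (ennreal ((norm h)\<^sup>2) * tensor_norm_sq (Suc m) (\<lambda>xs. kern (S k) xs - f xs) + tensor_norm_sq m (\<lambda>xs. kern (S' k) xs - f (h # xs)))" for k
  proof -
    have "tensor_norm_sq m (kern (R k)) = tensor_norm_sq m (\<lambda>xs. (kern (S k) (h # xs) - f (h # xs)) - (kern (S' k) xs - f (h # xs)))"
      by (intro tensor_norm_sq_cong) (simp add: R_def kern_kcontract kern_kneg)
    also have "\<dots> \<le> 2 * (tensor_norm_sq m (\<lambda>xs. kern (S k) (h # xs) - f (h # xs)) + tensor_norm_sq m (\<lambda>xs. kern (S' k) xs - f (h # xs)))"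
      by (rule tensor_norm_sq_diff)
    also have "\<dots> \<le> 2 * (ennreal ((norm h)\<^sup>2) * tensor_norm_sq (Suc m) (\<lambda>xs. kern (S k) xs - f xs) + tensor_norm_sq m (\<lambda>xs. kern (S' k) xs - f (h # xs)))"
    proof (intro mult_left_mono add_mono order_refl)
      show "tensor_norm_sq m (\<lambda>xs. kern (S k) (h # xs) - f (h # xs)) \<le>
        ennreal ((norm h)\<^sup>2) * tensor_norm_sq (Suc m) (\<lambda>xs. kern (S k) xs - f xs)"
        by (rule tensor_norm_sq_contract[of m "\<lambda>xs. kern (S k) xs - f xs" h])
          (rule linear_compose_sub[OF linear_kern symmetric_tensors_linear[OF f]])
    qed simp
    finally show ?thesis .
  qed
  have "(\<lambda>k. 2 * (ennreal ((norm h)\<^sup>2) * tensor_norm_sq (Suc m) (\<lambda>xs. kern (S k) xs - f xs) + tensor_norm_sq m (\<lambda>xs. kern (S' k) xs - f (h # xs))))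
      \<longlonglongrightarrow> 2 * (ennreal ((norm h)\<^sup>2) * 0 + 0)"
    by (intro ennreal_tendsto_cmult tendsto_add S S') auto
  then have "(\<lambda>k. tensor_norm_sq m (kern (R k))) \<longlonglongrightarrow> 0"
    by (rule ennreal_tendsto_0_le[OF _ _ Rle]) simp
  then have "(\<lambda>k. ennreal (fact m) * tensor_norm_sq m (kern (R k))) \<longlonglongrightarrow> ennreal (fact m) * 0"
    by (intro ennreal_tendsto_cmult) auto
  then have "(\<lambda>k. ennreal (\<integral>\<omega>. (sval (homog m (R k)) (Wv \<omega>))\<^sup>2 \<partial>M)) \<longlonglongrightarrow> 0"
    by (rule ennreal_tendsto_0_le) (auto intro!: expectation_sval_homog_sq_le)
  then have lim: "(\<lambda>k. \<integral>\<omega>. (sval (homog m (R k)) (Wv \<omega>))\<^sup>2 \<partial>M) \<longlonglongrightarrow> 0"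
    by (simp add: ennreal_0[symmetric] del: ennreal_0)
  have 1: "L2_tendsto M (\<lambda>k \<omega>. sval (homog m (R k)) (Wv \<omega>)) (\<lambda>_. 0)"
    using lim by (subst L2_tendsto_iff) (auto intro!: sq_integrable_sval sq_integrable_zero)
  have "L2_tendsto M (\<lambda>k \<omega>. sval (homog m (R k)) (Wv \<omega>) + sval (homog m (S' k)) (Wv \<omega>)) (\<lambda>\<omega>. 0 + V \<omega>)"
    by (intro L2_tendsto_add 1 S' V2 sq_integrable_sval sq_integrable_zero)
  then have "L2_tendsto M (\<lambda>k \<omega>. real (Suc m) *\<^sub>R (sval (homog m (R k)) (Wv \<omega>) + sval (homog m (S' k)) (Wv \<omega>))) (\<lambda>\<omega>. real (Suc m) *\<^sub>R (0 + V \<omega>))"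
    by (intro L2_tendsto_scaleR) (auto intro!: V2 sq_integrable_add sq_integrable_sval)
  then show ?thesis by (simp add: R_def sval_kneg sder_homog del: of_nat_Suc)
qed

end

subsection \<open>Integration by parts for chaos expansions\<close>

context isonormal_process
begin

lemma sq_integrable_lipschitz:
  assumes "lipschitz_C1 f f'" "sq_integrable M X"
  shows "sq_integrable M (\<lambda>\<omega>. f (X \<omega>))"
proof -
  obtain K where K: "K \<ge> 0" "\<And>x. \<bar>f x\<bar> \<le> \<bar>f 0\<bar> + K * \<bar>x\<bar>" and [measurable]: "f \<in> borel_measurable borel"
    by (rule lipschitz_C1E[OF assms(1)]) blast
  have [measurable]: "X \<in> borel_measurable M" by (rule sq_integrable_measurable[OF assms(2)])
  have "sq_integrable M (\<lambda>\<omega>. \<bar>X \<omega>\<bar>)"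
    by (rule sq_integrable_bound[OF assms(2), of _ 1]) auto
  then have "sq_integrable M (\<lambda>\<omega>. \<bar>f 0\<bar> + K * \<bar>X \<omega>\<bar>)"
    by (intro sq_integrable_add sq_integrable_const sq_integrable_cmult)
  then show ?thesis
  proof (rule sq_integrable_bound[where C=1])
    show "norm (f (X \<omega>)) \<le> 1 * norm (\<bar>f 0\<bar> + K * \<bar>X \<omega>\<bar>)" for \<omega>
      using K(2)[of "X \<omega>"] K(1) by simp
  qed simp
qed

lemma sq_integrable_deriv_scaleR:
  assumes "lipschitz_C1 f f'" "X \<in> borel_measurable M" "sq_integrable M U"
  shows "sq_integrable M (\<lambda>\<omega>. f' (X \<omega>) *\<^sub>R U \<omega>)"
proof -
  obtain K where K: "K \<ge> 0" "\<And>x. \<bar>f' x\<bar> \<le> K" and [measurable]: "f' \<in> borel_measurable borel"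
    by (rule lipschitz_C1E[OF assms(1)]) blast
  note [measurable] = assms(2)
  show ?thesis by (rule sq_integrable_bounded_scaleR[OF assms(3), of _ K]) (use K in auto)
qed

text \<open>The other factor \<open>T\<close> is kept simple. Its derivative then involves finitely
  many fixed vectors, so \<open>U\<close> is seen only through scalar pairings, and the property
  survives limits that are weak in \<open>U\<close>.\<close>

definition ibp_simple :: "('w \<Rightarrow> real) \<Rightarrow> ('w \<Rightarrow> 'h) \<Rightarrow> bool"
  where "ibp_simple X U \<longleftrightarrow> (\<forall>f f' T. lipschitz_C1 f f' \<longrightarrow>
    (\<integral>\<omega>. slap T (Wv \<omega>) * f (X \<omega>) \<partial>M) = (\<integral>\<omega>. f' (X \<omega>) * (sder T (Wv \<omega>) \<bullet> U \<omega>) \<partial>M))"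

lemma ibp_simple_sval: "ibp_simple (\<lambda>\<omega>. sval S (Wv \<omega>)) (\<lambda>\<omega>. sder S (Wv \<omega>))"
  unfolding ibp_simple_def using sval_integration_by_parts by blast

text \<open>The error is split in two: with the limit \<open>U'\<close> in place,
  \<open>f' (X k \<omega>)\<close> converges boundedly almost surely, and the remainder in
  \<open>U k - U'\<close> is controlled by Cauchy-Schwarz and the bound on
  \<open>f'\<close>.\<close>

lemma integral_deriv_inner_tendsto:
  assumes f: "lipschitz_C1 f f'"
    and X: "\<And>k. sq_integrable M (X k)" "sq_integrable M X'" and AE: "AE \<omega> in M. (\<lambda>k. X k \<omega>) \<longlonglongrightarrow> X' \<omega>"
    and U: "\<And>k. sq_integrable M (U k)" "sq_integrable M U'" "L2_tendsto M U U'"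
    and P: "sq_integrable M P"
  shows "(\<lambda>k. \<integral>\<omega>. f' (X k \<omega>) * (P \<omega> * U k \<omega>) \<partial>M) \<longlonglongrightarrow> (\<integral>\<omega>. f' (X' \<omega>) * (P \<omega> * U' \<omega>) \<partial>M)"
proof -
  obtain K where K: "K \<ge> 0" "\<And>x. \<bar>f' x\<bar> \<le> K" "continuous_on UNIV f'" and [measurable]: "f' \<in> borel_measurable borel"
    by (rule lipschitz_C1E[OF f]) blast
  note [measurable] = sq_integrable_measurable[OF X(1)] sq_integrable_measurable[OF X(2)]
    sq_integrable_measurable[OF U(1)] sq_integrable_measurable[OF U(2)] sq_integrable_measurable[OF P]
  have PU: "integrable M (\<lambda>\<omega>. P \<omega> * U' \<omega>)" by (rule sq_integrable_mult_integrable[OF P U(2)])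
  have fP: "sq_integrable M (\<lambda>\<omega>. f' (X k \<omega>) * P \<omega>)" for k
    using sq_integrable_deriv_scaleR[OF f _ P, of "X k"] by simp
  have 1: "(\<lambda>k. \<integral>\<omega>. f' (X k \<omega>) * (P \<omega> * U' \<omega>) \<partial>M) \<longlonglongrightarrow> (\<integral>\<omega>. f' (X' \<omega>) * (P \<omega> * U' \<omega>) \<partial>M)"
  proof (rule integral_dominated_convergence)
    show "integrable M (\<lambda>\<omega>. K * \<bar>P \<omega> * U' \<omega>\<bar>)" using PU by simp
    show "AE \<omega> in M. (\<lambda>k. f' (X k \<omega>) * (P \<omega> * U' \<omega>)) \<longlonglongrightarrow> f' (X' \<omega>) * (P \<omega> * U' \<omega>)"
      using AE
    proof eventually_elim
      case (elim \<omega>)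
      have "(\<lambda>k. f' (X k \<omega>)) \<longlonglongrightarrow> f' (X' \<omega>)"
        using K(3) elim by (intro isCont_tendsto_compose[of _ f']) (auto simp: continuous_on_eq_continuous_at)
      then show ?case by (intro tendsto_intros)
    qed
    show "AE \<omega> in M. norm (f' (X k \<omega>) * (P \<omega> * U' \<omega>)) \<le> K * \<bar>P \<omega> * U' \<omega>\<bar>" for k
    proof (intro AE_I2)
      fix \<omega>
      show "norm (f' (X k \<omega>) * (P \<omega> * U' \<omega>)) \<le> K * \<bar>P \<omega> * U' \<omega>\<bar>"
        unfolding real_norm_def abs_mult[of "f' _"] by (intro mult_right_mono K) simp
    qed
  qed auto
  have 2: "(\<lambda>k. \<integral>\<omega>. f' (X k \<omega>) * (P \<omega> * (U k \<omega> - U' \<omega>)) \<partial>M) \<longlonglongrightarrow> 0"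
  proof (rule Lim_null_comparison)
    have "(\<lambda>k. sqrt (\<integral>\<omega>. (norm (U k \<omega> - U' \<omega>))\<^sup>2 \<partial>M) * sqrt (K\<^sup>2 * (\<integral>\<omega>. (norm (P \<omega>))\<^sup>2 \<partial>M))) \<longlonglongrightarrow> sqrt 0 * sqrt (K\<^sup>2 * (\<integral>\<omega>. (norm (P \<omega>))\<^sup>2 \<partial>M))"
      using U by (intro tendsto_intros) (simp add: L2_tendsto_iff)
    then show "(\<lambda>k. sqrt (\<integral>\<omega>. (norm (U k \<omega> - U' \<omega>))\<^sup>2 \<partial>M) * sqrt (K\<^sup>2 * (\<integral>\<omega>. (norm (P \<omega>))\<^sup>2 \<partial>M))) \<longlonglongrightarrow> 0" by simp
    show "\<forall>\<^sub>F k in sequentially. norm (\<integral>\<omega>. f' (X k \<omega>) * (P \<omega> * (U k \<omega> - U' \<omega>)) \<partial>M) \<le>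
       sqrt (\<integral>\<omega>. (norm (U k \<omega> - U' \<omega>))\<^sup>2 \<partial>M) * sqrt (K\<^sup>2 * (\<integral>\<omega>. (norm (P \<omega>))\<^sup>2 \<partial>M))"
    proof (intro always_eventually allI)
      fix k
      have "\<bar>\<integral>\<omega>. (U k \<omega> - U' \<omega>) \<bullet> (f' (X k \<omega>) * P \<omega>) \<partial>M\<bar> \<le> sqrt (\<integral>\<omega>. (norm (U k \<omega> - U' \<omega>))\<^sup>2 \<partial>M) * sqrt (\<integral>\<omega>. (norm (f' (X k \<omega>) * P \<omega>))\<^sup>2 \<partial>M)"
        by (intro Cauchy_Schwarz_integral sq_integrable_diff U fP)
      also have "\<dots> \<le> sqrt (\<integral>\<omega>. (norm (U k \<omega> - U' \<omega>))\<^sup>2 \<partial>M) * sqrt (K\<^sup>2 * (\<integral>\<omega>. (norm (P \<omega>))\<^sup>2 \<partial>M))"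
      proof (intro mult_left_mono real_sqrt_le_mono)
        have "(\<integral>\<omega>. (norm (f' (X k \<omega>) * P \<omega>))\<^sup>2 \<partial>M) \<le> (\<integral>\<omega>. K\<^sup>2 * (norm (P \<omega>))\<^sup>2 \<partial>M)"
        proof (rule integral_mono)
          fix \<omega>
          have "(\<bar>f' (X k \<omega>)\<bar>)\<^sup>2 \<le> K\<^sup>2" by (intro power_mono K) simp
          then show "(norm (f' (X k \<omega>) * P \<omega>))\<^sup>2 \<le> K\<^sup>2 * (norm (P \<omega>))\<^sup>2"
            by (simp add: power_mult_distrib abs_mult mult_right_mono)
        qed (use sq_integrable_norm[OF fP] sq_integrable_norm[OF P] in auto)
        then show "(\<integral>\<omega>. (norm (f' (X k \<omega>) * P \<omega>))\<^sup>2 \<partial>M) \<le> K\<^sup>2 * (\<integral>\<omega>. (norm (P \<omega>))\<^sup>2 \<partial>M)" by simp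
      qed simp
      finally show "norm (\<integral>\<omega>. f' (X k \<omega>) * (P \<omega> * (U k \<omega> - U' \<omega>)) \<partial>M) \<le>
       sqrt (\<integral>\<omega>. (norm (U k \<omega> - U' \<omega>))\<^sup>2 \<partial>M) * sqrt (K\<^sup>2 * (\<integral>\<omega>. (norm (P \<omega>))\<^sup>2 \<partial>M))"
        by (simp add: mult_ac)
    qed
  qed
  have eq: "(\<integral>\<omega>. f' (X k \<omega>) * (P \<omega> * (U k \<omega> - U' \<omega>)) \<partial>M) + (\<integral>\<omega>. f' (X k \<omega>) * (P \<omega> * U' \<omega>) \<partial>M) = (\<integral>\<omega>. f' (X k \<omega>) * (P \<omega> * U k \<omega>) \<partial>M)" for k
  proof -
    have "integrable M (\<lambda>\<omega>. f' (X k \<omega>) * (P \<omega> * U' \<omega>))" "integrable M (\<lambda>\<omega>. f' (X k \<omega>) * (P \<omega> * (U k \<omega> - U' \<omega>)))"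
      using sq_integrable_mult_integrable[OF fP[of k] U(2)] sq_integrable_mult_integrable[OF fP[of k] sq_integrable_diff[OF U(1)[of k] U(2)]]
      by (simp_all add: mult.assoc)
    then show ?thesis by (subst Bochner_Integration.integral_add[symmetric]) (auto simp: algebra_simps)
  qed
  from tendsto_add[OF 2 1] show ?thesis by (simp add: eq)
qed

text \<open>The side with \<open>f\<close> converges because \<open>f\<close> is Lipschitz. For the
  other side a subsequence makes \<open>X\<close> converge almost surely, as \<open>f'\<close> is
  only continuous, and the entries of \<open>T\<close> are treated one at a time.\<close>

lemma ibp_simple_closed:
  assumes ibp: "\<And>k. ibp_simple (X k) (U k)"
    and X: "\<And>k. sq_integrable M (X k)" "sq_integrable M X'" "L2_tendsto M X X'"
    and U: "\<And>k. sq_integrable M (U k)" "sq_integrable M U'" "\<And>h. L2_tendsto M (\<lambda>k \<omega>. U k \<omega> \<bullet> h) (\<lambda>\<omega>. U' \<omega> \<bullet> h)"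
  shows "ibp_simple X' U'"
  unfolding ibp_simple_def
proof (intro allI impI)
  fix f f' :: "real \<Rightarrow> real" and T :: "(nat \<times> real \<times> 'h) list" assume f: "lipschitz_C1 f f'"
  obtain r where r: "strict_mono r" "AE \<omega> in M. (\<lambda>k. X (r k) \<omega>) \<longlonglongrightarrow> X' \<omega>"
    using L2_tendsto_AE_subseq[OF X] by metis
  have "(\<lambda>k. \<integral>\<omega>. f (X (r k) \<omega>) * slap T (Wv \<omega>) \<partial>M) \<longlonglongrightarrow> (\<integral>\<omega>. f (X' \<omega>) * slap T (Wv \<omega>) \<partial>M)"
    by (intro L2_tendsto_integral_mult L2_tendsto_lipschitz[OF f] sq_integrable_lipschitz[OF f] X
        all_moments_sq_integrable all_moments_slap L2_tendsto_subseq[OF _ r(1)])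
  then have l: "(\<lambda>k. \<integral>\<omega>. slap T (Wv \<omega>) * f (X (r k) \<omega>) \<partial>M) \<longlonglongrightarrow> (\<integral>\<omega>. slap T (Wv \<omega>) * f (X' \<omega>) \<partial>M)"
    by (simp only: mult.commute)
  have rr: "(\<lambda>k. \<integral>\<omega>. f' (X (r k) \<omega>) * (sder T (Wv \<omega>) \<bullet> U (r k) \<omega>) \<partial>M) \<longlonglongrightarrow> (\<integral>\<omega>. f' (X' \<omega>) * (sder T (Wv \<omega>) \<bullet> U' \<omega>) \<partial>M)"
  proof (induction T)
    case (Cons p T)
    obtain n c h where p: "p = (n, c, h)" by (cases p)
    define P where "P \<omega> = c * (real n * hval (n - 1) h (Wv \<omega>))" for \<omega>
    have P: "sq_integrable M P" unfolding P_def
      by (intro sq_integrable_cmult all_moments_sq_integrable all_moments_hval)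
    have split: "(\<integral>\<omega>. f' (A \<omega>) * (sder (p # T) (Wv \<omega>) \<bullet> B \<omega>) \<partial>M) =
        (\<integral>\<omega>. f' (A \<omega>) * (P \<omega> * (B \<omega> \<bullet> h)) \<partial>M) + (\<integral>\<omega>. f' (A \<omega>) * (sder T (Wv \<omega>) \<bullet> B \<omega>) \<partial>M)"
      if "sq_integrable M A" "sq_integrable M B" for A B
    proof -
      have "integrable M (\<lambda>\<omega>. (f' (A \<omega>) *\<^sub>R P \<omega>) * (B \<omega> \<bullet> h))"
        by (intro sq_integrable_mult_integrable sq_integrable_deriv_scaleR[OF f] sq_integrable_measurable that sq_integrable_inner P)
      moreover have "integrable M (\<lambda>\<omega>. (f' (A \<omega>) *\<^sub>R sder T (Wv \<omega>)) \<bullet> B \<omega>)"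
        by (intro sq_integrable_inner_integrable sq_integrable_deriv_scaleR[OF f] sq_integrable_measurable that sq_integrable_sder)
      ultimately show ?thesis
        by (subst Bochner_Integration.integral_add[symmetric])
          (auto simp: p P_def inner_add_left inner_commute algebra_simps intro!: Bochner_Integration.integral_cong)
    qed
    show ?case unfolding split[OF X(1) U(1)] split[OF X(2) U(2)]
      by (intro tendsto_add Cons integral_deriv_inner_tendsto[OF f] X r sq_integrable_inner U P L2_tendsto_subseq[OF _ r(1), where Y="\<lambda>k \<omega>. U k \<omega> \<bullet> h"])
  qed simp
  have "(\<integral>\<omega>. slap T (Wv \<omega>) * f (X (r k) \<omega>) \<partial>M) = (\<integral>\<omega>. f' (X (r k) \<omega>) * (sder T (Wv \<omega>) \<bullet> U (r k) \<omega>) \<partial>M)" for k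
    using ibp f unfolding ibp_simple_def by blast
  with rr have "(\<lambda>k. \<integral>\<omega>. slap T (Wv \<omega>) * f (X (r k) \<omega>) \<partial>M) \<longlonglongrightarrow> (\<integral>\<omega>. f' (X' \<omega>) * (sder T (Wv \<omega>) \<bullet> U' \<omega>) \<partial>M)" by simp
  from LIMSEQ_unique[OF l this]
  show "(\<integral>\<omega>. slap T (Wv \<omega>) * f (X' \<omega>) \<partial>M) = (\<integral>\<omega>. f' (X' \<omega>) * (sder T (Wv \<omega>) \<bullet> U' \<omega>) \<partial>M)" .
qed

text \<open>
  \<open>J\<close> and \<open>V\<close> are versions of \<open>I\<^sub>n(f)\<close> and of its derivative \<open>n I\<^bsub>n-1\<^esub>(f(r, \<cdot>))\<close>; the simple functionals
  approximating \<open>J\<close> have derivatives converging weakly to \<open>V\<close>.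
\<close>

definition chaos_pair :: "nat \<Rightarrow> ('w \<Rightarrow> real) \<Rightarrow> ('w \<Rightarrow> 'h) \<Rightarrow> bool"
  where "chaos_pair n J V \<longleftrightarrow> sq_integrable M J \<and> sq_integrable M V \<and>
    (\<exists>S. L2_tendsto M (\<lambda>k \<omega>. sval (homog n (S k)) (Wv \<omega>)) J \<and>
      (\<forall>h. L2_tendsto M (\<lambda>k \<omega>. sder (homog n (S k)) (Wv \<omega>) \<bullet> h) (\<lambda>\<omega>. V \<omega> \<bullet> h)))"

lemma chaos_pair_0:
  assumes J: "multiple_integral M W 0 f J"
  shows "chaos_pair 0 J (\<lambda>_. 0)"
proof -
  obtain S where S: "L2_tendsto M (\<lambda>k \<omega>. sval (homog 0 (S k)) (Wv \<omega>)) J" "sq_integrable M J"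
    by (rule multiple_integralE[OF J]) (rule that)
  have "sder (homog 0 T) v = 0" for T :: "(real \<times> 'h) list" and v
    by (induction T) auto
  then show ?thesis unfolding chaos_pair_def using S sq_integrable_zero
    by (auto intro!: exI[of _ S] simp: L2_tendsto_zero)
qed

lemma chaos_pair_Suc:
  assumes J: "multiple_integral M W (Suc m) f J" and V: "kernel_integral M W m f V"
  shows "chaos_pair (Suc m) J (\<lambda>\<omega>. real (Suc m) *\<^sub>R V \<omega>)"
proof -
  obtain S where S: "L2_tendsto M (\<lambda>k \<omega>. sval (homog (Suc m) (S k)) (Wv \<omega>)) J" "sq_integrable M J"
    "(\<lambda>k. tensor_norm_sq (Suc m) (\<lambda>xs. kern (S k) xs - f xs)) \<longlonglongrightarrow> 0" "f \<in> symmetric_tensors (Suc m)"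
    by (rule multiple_integralE[OF J]) (rule that)
  have V': "sq_integrable M V" "\<And>h. multiple_integral M W m (\<lambda>xs. f (h # xs)) (\<lambda>\<omega>. V \<omega> \<bullet> h)"
    using V by (auto simp: kernel_integral_def)
  show ?thesis unfolding chaos_pair_def
    using S V' sder_homog_tendsto[OF S(4,3) V'(2)]
    by (intro conjI exI[of _ S]) (auto intro!: sq_integrable_scaleR simp del: of_nat_Suc)
qed

text \<open>Integration by parts of a homogeneous functional against itself, on which
  \<open>slap\<close> acts as multiplication by the degree. It turns L2 boundedness of the
  functionals into the norm bound that weak convergence of their derivatives requires.\<close>

lemma expectation_norm_sder_homog:
  "(\<integral>\<omega>. (norm (sder (homog n S) (Wv \<omega>)))\<^sup>2 \<partial>M) = real n * (\<integral>\<omega>. (sval (homog n S) (Wv \<omega>))\<^sup>2 \<partial>M)"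
proof -
  have id: "lipschitz_C1 (\<lambda>x. x) (\<lambda>_. 1)" by (auto simp: lipschitz_C1_def intro!: exI[of _ 1])
  have "(\<integral>\<omega>. real n * (sval (homog n S) (Wv \<omega>))\<^sup>2 \<partial>M) = (\<integral>\<omega>. sder (homog n S) (Wv \<omega>) \<bullet> sder (homog n S) (Wv \<omega>) \<partial>M)"
    using sval_integration_by_parts[OF id, of "homog n S" "homog n S"] by (simp add: slap_homog power2_eq_square mult.assoc)
  then show ?thesis by (simp add: power2_norm_eq_inner)
qed

lemma L2_tendsto_norm_bounded:
  fixes Y :: "nat \<Rightarrow> 'w \<Rightarrow> real"
  assumes Y: "\<And>k. sq_integrable M (Y k)" and X: "sq_integrable M X" and lim: "L2_tendsto M Y X"
  obtains C where "\<And>k. (\<integral>\<omega>. (Y k \<omega>)\<^sup>2 \<partial>M) \<le> C"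
proof -
  have "Bseq (\<lambda>k. \<integral>\<omega>. (norm (Y k \<omega> - X \<omega>))\<^sup>2 \<partial>M)"
    using lim Y X by (intro convergent_imp_Bseq convergentI[of _ 0]) (simp add: L2_tendsto_iff)
  then obtain D where D': "\<And>k. norm (\<integral>\<omega>. (norm (Y k \<omega> - X \<omega>))\<^sup>2 \<partial>M) \<le> D"
    unfolding Bseq_def by auto
  have D: "(\<integral>\<omega>. (norm (Y k \<omega> - X \<omega>))\<^sup>2 \<partial>M) \<le> D" for k using D'[of k] by simp
  have "(\<integral>\<omega>. (Y k \<omega>)\<^sup>2 \<partial>M) \<le> 2 * (D + (\<integral>\<omega>. (norm (X \<omega>))\<^sup>2 \<partial>M))" for k
  proof -
    have i: "integrable M (\<lambda>\<omega>. (norm (Y k \<omega> - X \<omega>))\<^sup>2)" "integrable M (\<lambda>\<omega>. (norm (X \<omega>))\<^sup>2)" "integrable M (\<lambda>\<omega>. (norm (Y k \<omega>))\<^sup>2)"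
      by (intro sq_integrable_norm sq_integrable_diff Y X)+
    have "(\<integral>\<omega>. (norm (Y k \<omega>))\<^sup>2 \<partial>M) \<le> (\<integral>\<omega>. 2 * ((norm (Y k \<omega> - X \<omega>))\<^sup>2 + (norm (X \<omega>))\<^sup>2) \<partial>M)"
    proof (rule integral_mono)
      show "(norm (Y k \<omega>))\<^sup>2 \<le> 2 * ((norm (Y k \<omega> - X \<omega>))\<^sup>2 + (norm (X \<omega>))\<^sup>2)" for \<omega>
        using norm_add_sq_le[of "Y k \<omega> - X \<omega>" "X \<omega>"] by simp
    qed (use i in auto)
    also have "\<dots> = 2 * ((\<integral>\<omega>. (norm (Y k \<omega> - X \<omega>))\<^sup>2 \<partial>M) + (\<integral>\<omega>. (norm (X \<omega>))\<^sup>2 \<partial>M))"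
      using i by simp
    also have "\<dots> \<le> 2 * (D + (\<integral>\<omega>. (norm (X \<omega>))\<^sup>2 \<partial>M))" using D[of k] by simp
    finally show ?thesis by simp
  qed
  then show ?thesis using that by blast
qed

text \<open>Here the simple factor of \<open>ibp_simple\<close> is sent to its limit while
  \<open>X\<close> and \<open>U\<close> stay fixed. The derivatives are tested against the fixed
  variable \<open>f' (X \<omega>) *\<^sub>R U \<omega>\<close>, for which weak convergence is
  enough.\<close>

lemma chaos_pair_integration_by_parts:
  assumes JV: "chaos_pair n J V" and X: "sq_integrable M X" "sq_integrable M U" "ibp_simple X U"
    and f: "lipschitz_C1 f f'"
  shows "(\<integral>\<omega>. real n * J \<omega> * f (X \<omega>) \<partial>M) = (\<integral>\<omega>. V \<omega> \<bullet> (f' (X \<omega>) *\<^sub>R U \<omega>) \<partial>M)"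
proof -
  obtain S where S: "L2_tendsto M (\<lambda>k \<omega>. sval (homog n (S k)) (Wv \<omega>)) J"
      "\<And>h. L2_tendsto M (\<lambda>k \<omega>. sder (homog n (S k)) (Wv \<omega>) \<bullet> h) (\<lambda>\<omega>. V \<omega> \<bullet> h)"
    and J: "sq_integrable M J" and V: "sq_integrable M V"
    using JV unfolding chaos_pair_def by blast
  define T where "T = (\<lambda>\<omega>. f' (X \<omega>) *\<^sub>R U \<omega>)"
  have T: "sq_integrable M T" unfolding T_def
    by (intro sq_integrable_deriv_scaleR[OF f] sq_integrable_measurable X)
  have fX: "sq_integrable M (\<lambda>\<omega>. f (X \<omega>))" by (rule sq_integrable_lipschitz[OF f X(1)])
  define D where "D k \<omega> = sder (homog n (S k)) (Wv \<omega>)" for k \<omega>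
  have D: "sq_integrable M (D k)" for k unfolding D_def by (rule sq_integrable_sder)
  obtain C where C: "\<And>k. (\<integral>\<omega>. (sval (homog n (S k)) (Wv \<omega>))\<^sup>2 \<partial>M) \<le> C"
    using L2_tendsto_norm_bounded[OF sq_integrable_sval J S(1)] by metis
  have "(\<lambda>k. \<integral>\<omega>. (D k \<omega> - V \<omega>) \<bullet> T \<omega> \<partial>M) \<longlonglongrightarrow> 0"
  proof (rule weak_L2_tendsto_integral_inner)
    show "finite_measure M" by (rule finite_measure_axioms)
    show "sq_integrable M (\<lambda>\<omega>. D k \<omega> - V \<omega>)" for k by (intro sq_integrable_diff D V)
    show "sq_integrable M T" by (rule T)
    show "L2_tendsto M (\<lambda>k \<omega>. (D k \<omega> - V \<omega>) \<bullet> h) (\<lambda>_. 0)" for h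
      using S(2)[of h] by (simp add: L2_tendsto_def D_def inner_diff_left)
    show "(\<integral>\<omega>. (norm (D k \<omega> - V \<omega>))\<^sup>2 \<partial>M) \<le> 2 * (real n * C + (\<integral>\<omega>. (norm (V \<omega>))\<^sup>2 \<partial>M))" for k
    proof -
      have i: "integrable M (\<lambda>\<omega>. (norm (D k \<omega> - V \<omega>))\<^sup>2)" "integrable M (\<lambda>\<omega>. (norm (D k \<omega>))\<^sup>2)" "integrable M (\<lambda>\<omega>. (norm (V \<omega>))\<^sup>2)"
        by (intro sq_integrable_norm sq_integrable_diff D V)+
      have "(\<integral>\<omega>. (norm (D k \<omega> - V \<omega>))\<^sup>2 \<partial>M) \<le> (\<integral>\<omega>. 2 * ((norm (D k \<omega>))\<^sup>2 + (norm (V \<omega>))\<^sup>2) \<partial>M)"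
      proof (rule integral_mono)
        show "(norm (D k \<omega> - V \<omega>))\<^sup>2 \<le> 2 * ((norm (D k \<omega>))\<^sup>2 + (norm (V \<omega>))\<^sup>2)" for \<omega>
          using norm_add_sq_le[of "D k \<omega>" "- V \<omega>"] by simp
      qed (use i in auto)
      also have "\<dots> = 2 * (real n * (\<integral>\<omega>. (sval (homog n (S k)) (Wv \<omega>))\<^sup>2 \<partial>M) + (\<integral>\<omega>. (norm (V \<omega>))\<^sup>2 \<partial>M))"
        using i expectation_norm_sder_homog[of n "S k"] by (simp add: D_def)
      also have "\<dots> \<le> 2 * (real n * C + (\<integral>\<omega>. (norm (V \<omega>))\<^sup>2 \<partial>M))"
        by (intro mult_left_mono add_right_mono C) auto
      finally show ?thesis .
    qed
  qed
  moreover have "(\<integral>\<omega>. (D k \<omega> - V \<omega>) \<bullet> T \<omega> \<partial>M) = (\<integral>\<omega>. D k \<omega> \<bullet> T \<omega> \<partial>M) - (\<integral>\<omega>. V \<omega> \<bullet> T \<omega> \<partial>M)" for k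
    unfolding inner_diff_left by (intro Bochner_Integration.integral_diff sq_integrable_inner_integrable D V T)
  moreover have "(\<integral>\<omega>. D k \<omega> \<bullet> T \<omega> \<partial>M) = real n * (\<integral>\<omega>. sval (homog n (S k)) (Wv \<omega>) * f (X \<omega>) \<partial>M)" for k
  proof -
    have "(\<integral>\<omega>. slap (homog n (S k)) (Wv \<omega>) * f (X \<omega>) \<partial>M) = (\<integral>\<omega>. f' (X \<omega>) * (D k \<omega> \<bullet> U \<omega>) \<partial>M)"
      using X(3) f unfolding ibp_simple_def D_def by blast
    then show ?thesis by (simp add: slap_homog T_def mult.assoc)
  qed
  ultimately have "(\<lambda>k. real n * (\<integral>\<omega>. sval (homog n (S k)) (Wv \<omega>) * f (X \<omega>) \<partial>M)) \<longlonglongrightarrow> (\<integral>\<omega>. V \<omega> \<bullet> T \<omega> \<partial>M)"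
    by (simp add: LIM_zero_cancel)
  moreover have "(\<lambda>k. real n * (\<integral>\<omega>. sval (homog n (S k)) (Wv \<omega>) * f (X \<omega>) \<partial>M)) \<longlonglongrightarrow> real n * (\<integral>\<omega>. J \<omega> * f (X \<omega>) \<partial>M)"
    by (intro tendsto_mult tendsto_const L2_tendsto_integral_mult sq_integrable_sval J S fX)
  ultimately have "real n * (\<integral>\<omega>. J \<omega> * f (X \<omega>) \<partial>M) = (\<integral>\<omega>. V \<omega> \<bullet> T \<omega> \<partial>M)"
    by (rule LIMSEQ_unique[rotated])
  then show ?thesis by (simp add: T_def mult.assoc)
qed

text \<open>Two successive limits: the simple approximations inside each chaos at a fixed truncation
  level, then the truncation level itself.\<close>

lemma malliavin_derivative_ibp_simple:
  assumes "malliavin_derivative M W X U"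
  shows "ibp_simple X U" "sq_integrable M X" "sq_integrable M U"
proof -
  obtain f J V where ch: "chaos_expansion M W f J X" and V: "\<And>m. kernel_integral M W m (f (Suc m)) (V m)"
    and U: "sq_integrable M U" "L2_tendsto M (\<lambda>N \<omega>. \<Sum>m<N. real (Suc m) *\<^sub>R V m \<omega>) U"
    using assms unfolding malliavin_derivative_def by blast
  have J: "\<And>n. multiple_integral M W n (f n) (J n)" and X: "sq_integrable M X" "L2_tendsto M (\<lambda>N \<omega>. \<Sum>n<N. J n \<omega>) X"
    using ch by (auto simp: chaos_expansion_def)
  \<comment> \<open>Reindexed so that \<open>V' n\<close> is the derivative of \<open>J n\<close>,
    with zero for the constant component. Sums of \<open>J\<close> over \<open>n < Suc N\<close>
    then match sums of \<open>V\<close> over \<open>m < N\<close>.\<close>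
  define V' where "V' n = (case n of 0 \<Rightarrow> (\<lambda>_. 0) | Suc m \<Rightarrow> (\<lambda>\<omega>. real (Suc m) *\<^sub>R V m \<omega>))" for n
  have cp: "chaos_pair n (J n) (V' n)" for n
    using chaos_pair_0[OF J[of 0]] chaos_pair_Suc[OF J V] by (cases n) (simp_all add: V'_def del: of_nat_Suc)
  have sq: "sq_integrable M (J n)" "sq_integrable M (V' n)" for n
    using cp by (auto simp: chaos_pair_def)
  have "\<exists>S. \<forall>n. L2_tendsto M (\<lambda>k \<omega>. sval (homog n (S n k)) (Wv \<omega>)) (J n) \<and>
      (\<forall>h. L2_tendsto M (\<lambda>k \<omega>. sder (homog n (S n k)) (Wv \<omega>) \<bullet> h) (\<lambda>\<omega>. V' n \<omega> \<bullet> h))"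
    using cp unfolding chaos_pair_def by (intro choice) blast
  then obtain S where S: "\<And>n. L2_tendsto M (\<lambda>k \<omega>. sval (homog n (S n k)) (Wv \<omega>)) (J n)"
      "\<And>n h. L2_tendsto M (\<lambda>k \<omega>. sder (homog n (S n k)) (Wv \<omega>) \<bullet> h) (\<lambda>\<omega>. V' n \<omega> \<bullet> h)"
    by blast
  have part: "ibp_simple (\<lambda>\<omega>. \<Sum>n<N. J n \<omega>) (\<lambda>\<omega>. \<Sum>n<N. V' n \<omega>)" for N
  proof (rule ibp_simple_closed)
    \<comment> \<open>Concatenating the lists makes a sum over several degrees a single simple
      functional.\<close>
    define R where "R k = concat (map (\<lambda>n. homog n (S n k)) [0..<N])" for k
    have Rv: "sval (R k) v = (\<Sum>n<N. sval (homog n (S n k)) v)" for k v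
      unfolding R_def by (induction N) auto
    have Rd: "sder (R k) v = (\<Sum>n<N. sder (homog n (S n k)) v)" for k v
      unfolding R_def by (induction N) auto
    show "ibp_simple (\<lambda>\<omega>. sval (R k) (Wv \<omega>)) (\<lambda>\<omega>. sder (R k) (Wv \<omega>))" for k by (rule ibp_simple_sval)
    show "sq_integrable M (\<lambda>\<omega>. sval (R k) (Wv \<omega>))" "sq_integrable M (\<lambda>\<omega>. sder (R k) (Wv \<omega>))" for k
      by (rule sq_integrable_sval sq_integrable_sder)+
    show "sq_integrable M (\<lambda>\<omega>. \<Sum>n<N. J n \<omega>)" "sq_integrable M (\<lambda>\<omega>. \<Sum>n<N. V' n \<omega>)"
      by (intro sq_integrable_sum sq)+
    show "L2_tendsto M (\<lambda>k \<omega>. sval (R k) (Wv \<omega>)) (\<lambda>\<omega>. \<Sum>n<N. J n \<omega>)"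
      unfolding Rv by (intro L2_tendsto_sum sq_integrable_sval sq S)
    show "L2_tendsto M (\<lambda>k \<omega>. sder (R k) (Wv \<omega>) \<bullet> h) (\<lambda>\<omega>. (\<Sum>n<N. V' n \<omega>) \<bullet> h)" for h
      unfolding Rd inner_sum_left by (intro L2_tendsto_sum sq_integrable_inner sq_integrable_sder sq S)
  qed
  have V'sum: "(\<Sum>n<Suc N. V' n \<omega>) = (\<Sum>m<N. real (Suc m) *\<^sub>R V m \<omega>)" for N \<omega>
    by (simp add: sum.lessThan_Suc_shift V'_def del: sum.lessThan_Suc of_nat_Suc)
  show "ibp_simple X U"
  proof (rule ibp_simple_closed)
    show "ibp_simple (\<lambda>\<omega>. \<Sum>n<Suc N. J n \<omega>) (\<lambda>\<omega>. \<Sum>n<Suc N. V' n \<omega>)" for N by (rule part)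
    show "sq_integrable M (\<lambda>\<omega>. \<Sum>n<Suc N. J n \<omega>)" "sq_integrable M (\<lambda>\<omega>. \<Sum>n<Suc N. V' n \<omega>)" for N
      by (intro sq_integrable_sum sq)+
    show "L2_tendsto M (\<lambda>N \<omega>. \<Sum>n<Suc N. J n \<omega>) X"
      using L2_tendsto_subseq[OF X(2), of Suc] by (simp add: strict_mono_def del: sum.lessThan_Suc)
    show "L2_tendsto M (\<lambda>N \<omega>. (\<Sum>n<Suc N. V' n \<omega>) \<bullet> h) (\<lambda>\<omega>. U \<omega> \<bullet> h)" for h
    proof (rule L2_tendsto_inner)
      show "sq_integrable M (\<lambda>\<omega>. \<Sum>n<Suc N. V' n \<omega>)" for N by (intro sq_integrable_sum sq)
      show "L2_tendsto M (\<lambda>N \<omega>. \<Sum>n<Suc N. V' n \<omega>) U" unfolding V'sum by (rule U)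
    qed (rule U)
  qed (use X U in auto)
  show "sq_integrable M X" "sq_integrable M U" by fact+
qed

lemma multiple_integral_orthogonal:
  assumes J: "multiple_integral M W n f J" and J': "multiple_integral M W m f' J'" and "n \<noteq> m"
  shows "(\<integral>\<omega>. J \<omega> * J' \<omega> \<partial>M) = 0"
proof -
  obtain S where S: "L2_tendsto M (\<lambda>k \<omega>. sval (homog n (S k)) (Wv \<omega>)) J" "sq_integrable M J"
    by (rule multiple_integralE[OF J]) (rule that)
  obtain S' where S': "L2_tendsto M (\<lambda>k \<omega>. sval (homog m (S' k)) (Wv \<omega>)) J'" "sq_integrable M J'"
    by (rule multiple_integralE[OF J']) (rule that)
  have 1: "(\<integral>\<omega>. J \<omega> * sval (homog m (S' l)) (Wv \<omega>) \<partial>M) = 0" for l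
    using L2_tendsto_integral_mult[OF sq_integrable_sval S(2,1) sq_integrable_sval, of "homog m (S' l)"]
    by (simp add: expectation_sval_homog_orthogonal[OF \<open>n \<noteq> m\<close>] LIMSEQ_const_iff)
  have "(\<lambda>l. \<integral>\<omega>. sval (homog m (S' l)) (Wv \<omega>) * J \<omega> \<partial>M) \<longlonglongrightarrow> (\<integral>\<omega>. J' \<omega> * J \<omega> \<partial>M)"
    by (rule L2_tendsto_integral_mult[OF sq_integrable_sval S'(2,1) S(2)])
  then show ?thesis using 1 by (simp add: mult.commute LIMSEQ_const_iff)
qed

lemma multiple_integral_expectation:
  assumes J: "multiple_integral M W (Suc n) f J"
  shows "(\<integral>\<omega>. J \<omega> \<partial>M) = 0"
proof -
  obtain S where S: "L2_tendsto M (\<lambda>k \<omega>. sval (homog (Suc n) (S k)) (Wv \<omega>)) J" "sq_integrable M J"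
    by (rule multiple_integralE[OF J]) (rule that)
  have "(\<integral>\<omega>. sval (homog (Suc n) T) (Wv \<omega>) * 1 \<partial>M) = 0" for T
    \<comment> \<open>The list \<open>[(1, 0)]\<close> in degree zero is the constant 1, so a
      vanishing mean is orthogonality to degree zero.\<close>
    using expectation_sval_homog_orthogonal[of "Suc n" 0 T "[(1, 0)]"] by simp
  with L2_tendsto_integral_mult[OF sq_integrable_sval S(2,1) sq_integrable_const[of 1]]
  show ?thesis by (simp add: LIMSEQ_const_iff)
qed

text \<open>The approximants of degree zero are constants \<open>c k\<close>. Pairing them with 1
  and with \<open>J\<close> shows that the second moment of \<open>J\<close> is its squared mean, so
  its variance is zero.\<close>

lemma multiple_integral_0_const:
  assumes J: "multiple_integral M W 0 f J"
  shows "AE \<omega> in M. J \<omega> = (\<integral>\<omega>. J \<omega> \<partial>M)"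
proof -
  obtain S where S: "L2_tendsto M (\<lambda>k \<omega>. sval (homog 0 (S k)) (Wv \<omega>)) J" "sq_integrable M J"
    by (rule multiple_integralE[OF J]) (rule that)
  define c where "c k = (\<Sum>(c, h)\<leftarrow>S k. c)" for k
  have c: "sval (homog 0 (S k)) v = c k" for k v
    unfolding c_def sval_homog by simp
  have i: "integrable M J" by (rule sq_integrable_integrable[OF S(2)])
  note [measurable] = sq_integrable_measurable[OF S(2)]
  have "(\<lambda>k. \<integral>\<omega>. c k * 1 \<partial>M) \<longlonglongrightarrow> (\<integral>\<omega>. J \<omega> * 1 \<partial>M)"
    using L2_tendsto_integral_mult[OF sq_integrable_sval S(2,1) sq_integrable_const[of 1]] by (simp add: c)
  then have lim: "c \<longlonglongrightarrow> (\<integral>\<omega>. J \<omega> \<partial>M)" by (simp add: prob_space)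
  have "(\<lambda>k. \<integral>\<omega>. c k * J \<omega> \<partial>M) \<longlonglongrightarrow> (\<integral>\<omega>. J \<omega> * J \<omega> \<partial>M)"
    using L2_tendsto_integral_mult[OF sq_integrable_sval S(2,1) S(2)] by (simp add: c)
  moreover have "(\<lambda>k. \<integral>\<omega>. c k * J \<omega> \<partial>M) \<longlonglongrightarrow> (\<integral>\<omega>. J \<omega> \<partial>M) * (\<integral>\<omega>. J \<omega> \<partial>M)"
    using tendsto_mult[OF lim tendsto_const[of "\<integral>\<omega>. J \<omega> \<partial>M"]] i by simp
  ultimately have eq: "(\<integral>\<omega>. J \<omega> * J \<omega> \<partial>M) = (\<integral>\<omega>. J \<omega> \<partial>M) * (\<integral>\<omega>. J \<omega> \<partial>M)"
    by (rule LIMSEQ_unique)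
  have i2: "integrable M (\<lambda>\<omega>. J \<omega> * J \<omega>)" by (rule sq_integrable_mult_integrable[OF S(2) S(2)])
  have "variance J = 0"
    using variance_eq[OF i] i2 eq by (simp add: power2_eq_square)
  moreover have "integrable M (\<lambda>\<omega>. (J \<omega> - (\<integral>\<omega>. J \<omega> \<partial>M))\<^sup>2)"
    using sq_integrable_norm[OF sq_integrable_diff[OF S(2) sq_integrable_const]] by simp
  ultimately have "AE \<omega> in M. (J \<omega> - (\<integral>\<omega>. J \<omega> \<partial>M))\<^sup>2 = 0"
    by (subst (asm) integral_nonneg_eq_0_iff_AE) auto
  then show ?thesis by eventually_elim simp
qed

text \<open>Uniqueness of the chaos decomposition, to reconcile two expansions of the same variable
  that are chosen independently. Let \<open>\<Delta>\<close> be the difference of the components of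
  degree \<open>n\<close>; it is orthogonal to all other degrees, so pairing \<open>Y\<close> with
  it in both ways gives it norm zero.\<close>

lemma chaos_components_eq:
  assumes J: "\<And>n. multiple_integral M W n (f n) (J n)" and J': "\<And>n. multiple_integral M W n (f' n) (J' n)"
    and Y: "sq_integrable M Y" "L2_tendsto M (\<lambda>N \<omega>. \<Sum>n<N. J n \<omega>) Y"
    and Y': "L2_tendsto M (\<lambda>N \<omega>. \<Sum>n<N. c n * J' n \<omega>) Y"
  shows "AE \<omega> in M. J n \<omega> = c n * J' n \<omega>"
proof -
  have sq: "sq_integrable M (J n)" "sq_integrable M (J' n)" for n
    using J J' by (auto simp: multiple_integral_def)
  define \<Delta> where "\<Delta> \<omega> = J n \<omega> - c n * J' n \<omega>" for \<omega>
  have \<Delta>: "sq_integrable M \<Delta>" unfolding \<Delta>_def by (intro sq_integrable_diff sq_integrable_cmult sq)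
  have pair: "(\<integral>\<omega>. A \<omega> * \<Delta> \<omega> \<partial>M) = (\<integral>\<omega>. A \<omega> * J n \<omega> \<partial>M) - c n * (\<integral>\<omega>. A \<omega> * J' n \<omega> \<partial>M)" if "sq_integrable M A" for A
  proof -
    have "(\<integral>\<omega>. A \<omega> * \<Delta> \<omega> \<partial>M) = (\<integral>\<omega>. A \<omega> * J n \<omega> - c n * (A \<omega> * J' n \<omega>) \<partial>M)"
      by (simp add: \<Delta>_def algebra_simps)
    then show ?thesis using sq_integrable_mult_integrable[OF that sq(1)] sq_integrable_mult_integrable[OF that sq(2)] by simp
  qed
  have orth: "(\<integral>\<omega>. J m \<omega> * \<Delta> \<omega> \<partial>M) = 0" "(\<integral>\<omega>. J' m \<omega> * \<Delta> \<omega> \<partial>M) = 0" if "m \<noteq> n" for m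
    using that by (simp_all add: pair sq multiple_integral_orthogonal[OF J J] multiple_integral_orthogonal[OF J J']
        multiple_integral_orthogonal[OF J' J] multiple_integral_orthogonal[OF J' J'])
  have fin: "(\<integral>\<omega>. (\<Sum>m<N. d m * A m \<omega>) * \<Delta> \<omega> \<partial>M) = d n * (\<integral>\<omega>. A n \<omega> * \<Delta> \<omega> \<partial>M)"
    if "n < N" "\<And>m. sq_integrable M (A m)" "\<And>m. m \<noteq> n \<Longrightarrow> (\<integral>\<omega>. A m \<omega> * \<Delta> \<omega> \<partial>M) = 0" for N A d
  proof -
    have "(\<integral>\<omega>. (\<Sum>m<N. d m * A m \<omega>) * \<Delta> \<omega> \<partial>M) = (\<integral>\<omega>. (\<Sum>m<N. d m * (A m \<omega> * \<Delta> \<omega>)) \<partial>M)"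
      by (simp add: sum_distrib_right mult.assoc)
    also have "\<dots> = (\<Sum>m<N. d m * (\<integral>\<omega>. A m \<omega> * \<Delta> \<omega> \<partial>M))"
      by (subst Bochner_Integration.integral_sum) (auto intro!: sq_integrable_mult_integrable that \<Delta>)
    also have "\<dots> = (\<Sum>m<N. if m = n then d n * (\<integral>\<omega>. A n \<omega> * \<Delta> \<omega> \<partial>M) else 0)"
      using that(3) by (intro sum.cong) auto
    finally show ?thesis using that(1) by simp
  qed
  have "(\<lambda>N. \<integral>\<omega>. (\<Sum>m<N. J m \<omega>) * \<Delta> \<omega> \<partial>M) \<longlonglongrightarrow> (\<integral>\<omega>. Y \<omega> * \<Delta> \<omega> \<partial>M)"
    by (intro L2_tendsto_integral_mult sq_integrable_sum sq Y \<Delta>)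
  moreover have "(\<lambda>N. \<integral>\<omega>. (\<Sum>m<N. J m \<omega>) * \<Delta> \<omega> \<partial>M) \<longlonglongrightarrow> (\<integral>\<omega>. J n \<omega> * \<Delta> \<omega> \<partial>M)"
    using fin[of _ J "\<lambda>_. 1"] sq orth
    by (intro tendsto_eventually eventually_sequentiallyI[of "Suc n"]) simp
  ultimately have 1: "(\<integral>\<omega>. Y \<omega> * \<Delta> \<omega> \<partial>M) = (\<integral>\<omega>. J n \<omega> * \<Delta> \<omega> \<partial>M)" by (rule LIMSEQ_unique)
  have "(\<lambda>N. \<integral>\<omega>. (\<Sum>m<N. c m * J' m \<omega>) * \<Delta> \<omega> \<partial>M) \<longlonglongrightarrow> (\<integral>\<omega>. Y \<omega> * \<Delta> \<omega> \<partial>M)"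
    by (intro L2_tendsto_integral_mult sq_integrable_sum sq_integrable_cmult sq Y Y' \<Delta>)
  moreover have "(\<lambda>N. \<integral>\<omega>. (\<Sum>m<N. c m * J' m \<omega>) * \<Delta> \<omega> \<partial>M) \<longlonglongrightarrow> c n * (\<integral>\<omega>. J' n \<omega> * \<Delta> \<omega> \<partial>M)"
    using fin[of _ J' c] sq orth
    by (intro tendsto_eventually eventually_sequentiallyI[of "Suc n"]) simp
  ultimately have 2: "(\<integral>\<omega>. Y \<omega> * \<Delta> \<omega> \<partial>M) = c n * (\<integral>\<omega>. J' n \<omega> * \<Delta> \<omega> \<partial>M)" by (rule LIMSEQ_unique)
  have "(\<integral>\<omega>. (norm (\<Delta> \<omega>))\<^sup>2 \<partial>M) = (\<integral>\<omega>. J n \<omega> * \<Delta> \<omega> - c n * (J' n \<omega> * \<Delta> \<omega>) \<partial>M)"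
    by (intro Bochner_Integration.integral_cong refl) (simp add: \<Delta>_def power2_eq_square algebra_simps)
  also have "\<dots> = 0"
    using 1 2 sq_integrable_mult_integrable[OF sq(1) \<Delta>] sq_integrable_mult_integrable[OF sq(2) \<Delta>] by simp
  finally have "AE \<omega> in M. (norm (\<Delta> \<omega>))\<^sup>2 = 0"
    using sq_integrable_norm[OF \<Delta>] by (subst (asm) integral_nonneg_eq_0_iff_AE) auto
  then show ?thesis by eventually_elim (simp add: \<Delta>_def)
qed

text \<open>The component of degree \<open>n\<close> of \<open>Y\<close> is that of \<open>X\<close>
  divided by \<open>n\<close>, so \<open>X\<close> is obtained from \<open>Y\<close> by multiplying
  each component by its degree. Applying the formula for a single chaos to the components of
  \<open>Y\<close> and summing gives the pairing with \<open>DY\<close>.\<close>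

theorem malliavin_integration_by_parts:
  assumes DX: "malliavin_derivative M W X DX" and Y: "neg_OU_inverse M W X Y"
    and DY: "malliavin_derivative M W Y DY" and mean: "(\<integral>\<omega>. X \<omega> \<partial>M) = 0" and f: "lipschitz_C1 f f'"
  shows "(\<integral>\<omega>. X \<omega> * f (X \<omega>) \<partial>M) = (\<integral>\<omega>. f' (X \<omega>) * (DX \<omega> \<bullet> DY \<omega>) \<partial>M)"
proof -
  note X = malliavin_derivative_ibp_simple[OF DX]
  obtain k1 J1 where ch1: "chaos_expansion M W k1 J1 X" and Y1: "sq_integrable M Y"
      "L2_tendsto M (\<lambda>N \<omega>. \<Sum>n=1..N. (1 / real n) * J1 n \<omega>) Y"
    using Y unfolding neg_OU_inverse_def by blast
  have J1: "\<And>n. multiple_integral M W n (k1 n) (J1 n)" and X1: "L2_tendsto M (\<lambda>N \<omega>. \<Sum>n<N. J1 n \<omega>) X"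
    using ch1 by (auto simp: chaos_expansion_def)
  obtain k J V where ch: "chaos_expansion M W k J Y" and V: "\<And>m. kernel_integral M W m (k (Suc m)) (V m)"
    and U: "sq_integrable M DY" "L2_tendsto M (\<lambda>N \<omega>. \<Sum>m<N. real (Suc m) *\<^sub>R V m \<omega>) DY"
    using DY unfolding malliavin_derivative_def by blast
  have J: "\<And>n. multiple_integral M W n (k n) (J n)" and Y2: "L2_tendsto M (\<lambda>N \<omega>. \<Sum>n<N. J n \<omega>) Y"
    using ch by (auto simp: chaos_expansion_def)
  have sq: "sq_integrable M (J n)" "sq_integrable M (J1 n)" "sq_integrable M (V n)" for n
    using J J1 V by (auto simp: multiple_integral_def kernel_integral_def)
  \<comment> \<open>Division by zero makes \<open>c 0 = 0\<close>, so sums from \<open>0\<close>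
    agree with the sum from \<open>1\<close> that defines the inverse.\<close>
  define c where "c n = 1 / real n" for n
  have "(\<Sum>n<Suc N. c n * J1 n \<omega>) = (\<Sum>n=1..N. (1 / real n) * J1 n \<omega>)" for N \<omega>
    by (simp add: c_def lessThan_Suc_atMost atMost_atLeast0 sum.atLeast_Suc_atMost[of 0])
  then have "L2_tendsto M (\<lambda>N \<omega>. \<Sum>n<Suc N. c n * J1 n \<omega>) Y"
    using Y1(2) by (simp only:)
  then have Y3: "L2_tendsto M (\<lambda>N \<omega>. \<Sum>n<N. c n * J1 n \<omega>) Y"
    unfolding L2_tendsto_def by (rule LIMSEQ_imp_Suc)
  have comp: "AE \<omega> in M. J n \<omega> = c n * J1 n \<omega>" for n
    by (rule chaos_components_eq[OF J J1 Y1(1) Y2 Y3])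
  \<comment> \<open>Only here the vanishing mean of \<open>X\<close> enters: multiplication by the
    degree cannot recover a constant component.\<close>
  have J10: "AE \<omega> in M. J1 0 \<omega> = 0"
  proof -
    have lim: "(\<lambda>N. \<integral>\<omega>. (\<Sum>n<N. J1 n \<omega>) * 1 \<partial>M) \<longlonglongrightarrow> (\<integral>\<omega>. X \<omega> * 1 \<partial>M)"
      by (intro L2_tendsto_integral_mult sq_integrable_sum sq X X1 sq_integrable_const)
    have eq: "(\<integral>\<omega>. (\<Sum>n<Suc N. J1 n \<omega>) * 1 \<partial>M) = (\<integral>\<omega>. J1 0 \<omega> \<partial>M)" for N
    proof -
      have "(\<integral>\<omega>. (\<Sum>n<Suc N. J1 n \<omega>) * 1 \<partial>M) = (\<Sum>n<Suc N. \<integral>\<omega>. J1 n \<omega> \<partial>M)"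
        using sq_integrable_integrable[OF sq(2)] by (subst Bochner_Integration.integral_sum[symmetric]) auto
      then show ?thesis
        by (simp add: sum.lessThan_Suc_shift multiple_integral_expectation[OF J1] del: sum.lessThan_Suc)
    qed
    have "(\<lambda>N. \<integral>\<omega>. J1 0 \<omega> \<partial>M) \<longlonglongrightarrow> (\<integral>\<omega>. X \<omega> * 1 \<partial>M)"
      using LIMSEQ_Suc[OF lim] unfolding eq .
    then have "(\<integral>\<omega>. J1 0 \<omega> \<partial>M) = (\<integral>\<omega>. X \<omega> \<partial>M)" by (simp add: LIMSEQ_const_iff)
    then show ?thesis using multiple_integral_0_const[OF J1[of 0]] mean by simp
  qed
  define T where "T = (\<lambda>\<omega>. f' (X \<omega>) *\<^sub>R DX \<omega>)"
  have T: "sq_integrable M T" unfolding T_def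
    by (intro sq_integrable_deriv_scaleR[OF f] sq_integrable_measurable X)
  have fX: "sq_integrable M (\<lambda>\<omega>. f (X \<omega>))" by (rule sq_integrable_lipschitz[OF f X(2)])
  have step: "(\<integral>\<omega>. J1 (Suc m) \<omega> * f (X \<omega>) \<partial>M) = (\<integral>\<omega>. (real (Suc m) *\<^sub>R V m \<omega>) \<bullet> T \<omega> \<partial>M)" for m
  proof -
    have "(\<integral>\<omega>. real (Suc m) * J (Suc m) \<omega> * f (X \<omega>) \<partial>M) = (\<integral>\<omega>. (real (Suc m) *\<^sub>R V m \<omega>) \<bullet> T \<omega> \<partial>M)"
      unfolding T_def by (rule chaos_pair_integration_by_parts[OF chaos_pair_Suc[OF J V] X(2,3,1) f])
    moreover have "(\<integral>\<omega>. real (Suc m) * J (Suc m) \<omega> * f (X \<omega>) \<partial>M) = (\<integral>\<omega>. J1 (Suc m) \<omega> * f (X \<omega>) \<partial>M)"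
    proof (rule integral_cong_AE)
      note [measurable] = sq_integrable_measurable[OF sq(1)] sq_integrable_measurable[OF sq(2)] sq_integrable_measurable[OF fX]
      show "(\<lambda>\<omega>. real (Suc m) * J (Suc m) \<omega> * f (X \<omega>)) \<in> borel_measurable M" "(\<lambda>\<omega>. J1 (Suc m) \<omega> * f (X \<omega>)) \<in> borel_measurable M"
        by measurable
      show "AE \<omega> in M. real (Suc m) * J (Suc m) \<omega> * f (X \<omega>) = J1 (Suc m) \<omega> * f (X \<omega>)"
        using comp[of "Suc m"] by eventually_elim (simp add: c_def del: of_nat_Suc)
    qed
    ultimately show ?thesis by simp
  qed
  have "(\<integral>\<omega>. (\<Sum>n<Suc N. J1 n \<omega>) * f (X \<omega>) \<partial>M) = (\<integral>\<omega>. (\<Sum>m<N. real (Suc m) *\<^sub>R V m \<omega>) \<bullet> T \<omega> \<partial>M)" for N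
  proof -
    have "(\<integral>\<omega>. (\<Sum>n<Suc N. J1 n \<omega>) * f (X \<omega>) \<partial>M) = (\<Sum>n<Suc N. \<integral>\<omega>. J1 n \<omega> * f (X \<omega>) \<partial>M)"
      unfolding sum_distrib_right by (intro Bochner_Integration.integral_sum sq_integrable_mult_integrable sq fX)
    also have "\<dots> = (\<integral>\<omega>. J1 0 \<omega> * f (X \<omega>) \<partial>M) + (\<Sum>m<N. \<integral>\<omega>. J1 (Suc m) \<omega> * f (X \<omega>) \<partial>M)"
      by (simp add: sum.lessThan_Suc_shift del: sum.lessThan_Suc)
    also have "(\<integral>\<omega>. J1 0 \<omega> * f (X \<omega>) \<partial>M) = 0"
      using J10 by (intro integral_eq_zero_AE) (auto elim: eventually_mono)
    also have "0 + (\<Sum>m<N. \<integral>\<omega>. J1 (Suc m) \<omega> * f (X \<omega>) \<partial>M) = (\<integral>\<omega>. (\<Sum>m<N. real (Suc m) *\<^sub>R V m \<omega>) \<bullet> T \<omega> \<partial>M)"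
      unfolding step inner_sum_left
      by (subst Bochner_Integration.integral_sum) (auto intro!: sq_integrable_inner_integrable sq_integrable_scaleR sq T simp del: inner_scaleR_left of_nat_Suc)
    finally show ?thesis .
  qed
  moreover have "(\<lambda>N. \<integral>\<omega>. (\<Sum>n<Suc N. J1 n \<omega>) * f (X \<omega>) \<partial>M) \<longlonglongrightarrow> (\<integral>\<omega>. X \<omega> * f (X \<omega>) \<partial>M)"
    by (intro L2_tendsto_integral_mult sq_integrable_sum sq X L2_tendsto_subseq[OF X1, of Suc] fX) (simp add: strict_mono_def)
  moreover have "(\<lambda>N. \<integral>\<omega>. (\<Sum>m<N. real (Suc m) *\<^sub>R V m \<omega>) \<bullet> T \<omega> \<partial>M) \<longlonglongrightarrow> (\<integral>\<omega>. DY \<omega> \<bullet> T \<omega> \<partial>M)"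
    by (intro L2_tendsto_integral_inner sq_integrable_sum sq_integrable_scaleR sq U T)
  ultimately have "(\<integral>\<omega>. X \<omega> * f (X \<omega>) \<partial>M) = (\<integral>\<omega>. DY \<omega> \<bullet> T \<omega> \<partial>M)"
    by (simp only: LIMSEQ_unique)
  also have "\<dots> = (\<integral>\<omega>. f' (X \<omega>) * (DX \<omega> \<bullet> DY \<omega>) \<partial>M)"
    by (simp add: T_def inner_commute)
  finally show ?thesis .
qed

end

subsection \<open>Tail integrals\<close>

text \<open>Composing with the clamp freezes a function outside \<open>[b, v]\<close>, so it only
  has to be smooth on that interval and its growth is irrelevant.\<close>

definition clamp_real :: "real \<Rightarrow> real \<Rightarrow> real \<Rightarrow> real"
  where "clamp_real b v x = max b (min v x)"

text \<open>One notion for several quantities: \<open>Y = 1\<close> gives the tail probability,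
  \<open>Y = X\<close> the tail mean, and the square of \<open>X\<close> controls the limits at
  infinity.\<close>

definition tail_integral :: "'w measure \<Rightarrow> ('w \<Rightarrow> real) \<Rightarrow> ('w \<Rightarrow> real) \<Rightarrow> real \<Rightarrow> real"
  where "tail_integral M Y X z = (\<integral>\<omega>. (if z < X \<omega> then Y \<omega> else 0) \<partial>M)"

lemma clamp_real_measurable[measurable]: "clamp_real b v \<in> borel_measurable borel"
  unfolding clamp_real_def by measurable

lemma integral_FTC_clamp:
  fixes u u' :: "real \<Rightarrow> real"
  assumes "b \<le> v" and u: "\<And>y. b \<le> y \<Longrightarrow> y \<le> v \<Longrightarrow> (u has_real_derivative u' y) (at y)"
    and c: "\<And>y. b \<le> y \<Longrightarrow> y \<le> v \<Longrightarrow> isCont u' y"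
  shows "(\<integral>y. (if y < x then indicator {b<..v} y * u' y else 0) \<partial>lborel) = u (clamp_real b v x) - u b"
proof -
  define w where "w = clamp_real b v x"
  have w: "b \<le> w" "w \<le> v" using assms(1) by (auto simp: w_def clamp_real_def)
  have "(\<integral>y. u' y * indicator {b..w} y \<partial>lborel) = u w - u b"
    by (rule integral_FTC_Icc_real) (use w u c in auto)
  moreover have "(\<integral>y. u' y * indicator {b..w} y \<partial>lborel) = (\<integral>y. (if y < x then indicator {b<..v} y * u' y else 0) \<partial>lborel)"
  proof (rule integral_cong_AE)
    have m: "(\<lambda>y. u' y * indicator {b..v} y) \<in> borel_measurable lborel"
      using has_bochner_integral_FTC_Icc_real[of b v u u'] assms by (auto simp: has_bochner_integral_iff)
    have "(\<lambda>y. (u' y * indicator {b..v} y) * indicator {b..w} y) \<in> borel_measurable lborel"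
      using m by measurable
    also have "(\<lambda>y. (u' y * indicator {b..v} y) * indicator {b..w} y) = (\<lambda>y. u' y * indicator {b..w} y)"
      using w by (auto simp: fun_eq_iff split: split_indicator)
    finally show "(\<lambda>y. u' y * indicator {b..w} y) \<in> borel_measurable lborel" .
    have "(\<lambda>y. if y < x then indicator {b<..v} y * (u' y * indicator {b..v} y) else 0) \<in> borel_measurable lborel"
      using m by measurable
    also have "(\<lambda>y. if y < x then indicator {b<..v} y * (u' y * indicator {b..v} y) else 0) = (\<lambda>y. if y < x then indicator {b<..v} y * u' y else 0)"
      by (auto simp: fun_eq_iff split: split_indicator)
    finally show "(\<lambda>y. if y < x then indicator {b<..v} y * u' y else 0) \<in> borel_measurable lborel" .
    have "AE y in lborel. y \<noteq> b \<and> y \<noteq> w" by (intro AE_conjI AE_lborel_singleton)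
    then show "AE y in lborel. u' y * indicator {b..w} y = (if y < x then indicator {b<..v} y * u' y else 0)"
    proof eventually_elim
      case (elim y)
      then show ?case using w by (auto simp: w_def clamp_real_def split: split_indicator)
    qed
  qed
  ultimately show ?thesis by (simp add: w_def)
qed

lemma (in prob_space) tail_integral_measurable[measurable]:
  assumes [measurable]: "X \<in> borel_measurable M" "Y \<in> borel_measurable M"
  shows "tail_integral M Y X \<in> borel_measurable borel"
  unfolding tail_integral_def by measurable

text \<open>\<open>u (clamp_real b v x) - u b\<close> is the integral of \<open>u'\<close> over the
  points of the interval that lie below \<open>x\<close>. Fubini exchanges it with the
  expectation.\<close>

lemma (in prob_space) expectation_clamp:
  fixes u u' :: "real \<Rightarrow> real"
  assumes "b \<le> v" and u: "\<And>y. b \<le> y \<Longrightarrow> y \<le> v \<Longrightarrow> (u has_real_derivative u' y) (at y)"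
    and c: "\<And>y. b \<le> y \<Longrightarrow> y \<le> v \<Longrightarrow> isCont u' y"
    and X[measurable]: "X \<in> borel_measurable M" and Y: "integrable M Y"
  shows "(\<integral>\<omega>. Y \<omega> * u (clamp_real b v (X \<omega>)) \<partial>M) =
      u b * (\<integral>\<omega>. Y \<omega> \<partial>M) + (\<integral>y. indicator {b<..v} y * (u' y * tail_integral M Y X y) \<partial>lborel)"
    and "integrable lborel (\<lambda>y. indicator {b<..v} y * (u' y * tail_integral M Y X y))"
    and "integrable M (\<lambda>\<omega>. Y \<omega> * u (clamp_real b v (X \<omega>)))"
proof -
  interpret P: pair_sigma_finite M lborel ..
  have [measurable]: "Y \<in> borel_measurable M" using Y by simp
  define w where "w y = indicator {b<..v} y * u' y" for y
  have "continuous_on {b..v} u'" using c by (auto intro: continuous_at_imp_continuous_on)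
  then have cmp: "compact (u' ` {b..v})" by (rule compact_continuous_image) simp
  then obtain C where C: "\<And>y. y \<in> {b..v} \<Longrightarrow> \<bar>u' y\<bar> \<le> C"
    by (metis bounded_iff compact_imp_bounded imageI real_norm_def)
  have "0 \<le> \<bar>u' b\<bar>" by simp
  then have C0: "C \<ge> 0" using C[of b] assms(1) by (simp del: abs_ge_zero)
  have "integrable lborel (\<lambda>x. u' x * indicator {b..v} x)"
    using has_bochner_integral_FTC_Icc_real[of b v u u'] assms by (auto simp: has_bochner_integral_iff)
  then have "(\<lambda>x. (u' x * indicator {b..v} x) * indicator {b<..v} x) \<in> borel_measurable lborel" by measurable
  also have "(\<lambda>x. (u' x * indicator {b..v} x) * indicator {b<..v} x) = w"
    by (auto simp: w_def fun_eq_iff split: split_indicator)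
  finally have [measurable]: "w \<in> borel_measurable borel" by simp
  have wb: "\<bar>w y\<bar> \<le> C * indicator {b..v} y" for y
    using C[of y] C0 by (auto simp: w_def split: split_indicator)
  have wint: "integrable lborel w"
  proof (rule Bochner_Integration.integrable_bound)
    show "integrable lborel (\<lambda>y. C * indicator {b..v} y)"
      by (intro integrable_mult_right integrable_real_indicator) (auto simp: emeasure_lborel_Icc_eq)
    show "AE y in lborel. norm (w y) \<le> norm (C * indicator {b..v} y)"
      using wb by (intro AE_I2) (metis abs_ge_self order_trans real_norm_def)
  qed simp
  define k where "k \<omega> y = (if y < X \<omega> then Y \<omega> * w y else 0)" for \<omega> y
  have km[measurable]: "(\<lambda>(\<omega>, y). k \<omega> y) \<in> borel_measurable (M \<Otimes>\<^sub>M lborel)" unfolding k_def by measurable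
  have kint: "integrable (M \<Otimes>\<^sub>M lborel) (\<lambda>(\<omega>, y). k \<omega> y)"
  proof (rule P.Fubini_integrable)
    have i: "integrable lborel (k \<omega>)" if [simp]: "\<omega> \<in> space M" for \<omega>
    proof (rule Bochner_Integration.integrable_bound)
      show "integrable lborel (\<lambda>y. Y \<omega> * w y)" using wint by simp
      show "k \<omega> \<in> borel_measurable lborel" unfolding k_def by measurable
    qed (auto simp: k_def)
    then show "AE \<omega> in M. integrable lborel (\<lambda>y. case (\<omega>, y) of (\<omega>, y) \<Rightarrow> k \<omega> y)" by simp
    show "integrable M (\<lambda>\<omega>. \<integral>y. norm (case (\<omega>, y) of (\<omega>, y) \<Rightarrow> k \<omega> y) \<partial>lborel)"
    proof (rule Bochner_Integration.integrable_bound)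
      show "integrable M (\<lambda>\<omega>. Y \<omega> * (\<integral>y. \<bar>w y\<bar> \<partial>lborel))" using Y by simp
      show "(\<lambda>\<omega>. \<integral>y. norm (case (\<omega>, y) of (\<omega>, y) \<Rightarrow> k \<omega> y) \<partial>lborel) \<in> borel_measurable M" by measurable
      show "AE \<omega> in M. norm (\<integral>y. norm (case (\<omega>, y) of (\<omega>, y) \<Rightarrow> k \<omega> y) \<partial>lborel) \<le> norm (Y \<omega> * (\<integral>y. \<bar>w y\<bar> \<partial>lborel))"
      proof (intro AE_I2)
        fix \<omega> assume \<omega>: "\<omega> \<in> space M"
        have "(\<integral>y. \<bar>k \<omega> y\<bar> \<partial>lborel) \<le> (\<integral>y. \<bar>Y \<omega>\<bar> * \<bar>w y\<bar> \<partial>lborel)"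
        proof (rule integral_mono)
          show "integrable lborel (\<lambda>y. \<bar>k \<omega> y\<bar>)" using i[OF \<omega>] by simp
          show "integrable lborel (\<lambda>y. \<bar>Y \<omega>\<bar> * \<bar>w y\<bar>)" using wint by simp
        qed (auto simp: k_def abs_mult)
        then show "norm (\<integral>y. norm (case (\<omega>, y) of (\<omega>, y) \<Rightarrow> k \<omega> y) \<partial>lborel) \<le> norm (Y \<omega> * (\<integral>y. \<bar>w y\<bar> \<partial>lborel))"
          by (simp add: abs_mult)
      qed
    qed
  qed simp
  have inner1: "(\<integral>y. k \<omega> y \<partial>lborel) = Y \<omega> * u (clamp_real b v (X \<omega>)) - u b * Y \<omega>" for \<omega>
  proof -
    have "(\<integral>y. k \<omega> y \<partial>lborel) = Y \<omega> * (\<integral>y. (if y < X \<omega> then indicator {b<..v} y * u' y else 0) \<partial>lborel)"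
      unfolding integral_mult_right_zero[symmetric]
      by (rule Bochner_Integration.integral_cong) (auto simp: k_def w_def)
    then show ?thesis using integral_FTC_clamp[OF assms(1) u c, of "X \<omega>"] by (simp add: algebra_simps)
  qed
  have inner2: "(\<integral>\<omega>. k \<omega> y \<partial>M) = indicator {b<..v} y * (u' y * tail_integral M Y X y)" for y
  proof -
    have "(\<integral>\<omega>. k \<omega> y \<partial>M) = (\<integral>\<omega>. w y * (if y < X \<omega> then Y \<omega> else 0) \<partial>M)"
      by (rule Bochner_Integration.integral_cong) (auto simp: k_def)
    then show ?thesis by (simp add: tail_integral_def w_def)
  qed
  have "integrable M (\<lambda>\<omega>. \<integral>y. k \<omega> y \<partial>lborel)"
    using P.integrable_fst'[OF kint] by simp
  then have "integrable M (\<lambda>\<omega>. (Y \<omega> * u (clamp_real b v (X \<omega>)) - u b * Y \<omega>) + u b * Y \<omega>)"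
    unfolding inner1 using Y by (intro Bochner_Integration.integrable_add) auto
  then show i2: "integrable M (\<lambda>\<omega>. Y \<omega> * u (clamp_real b v (X \<omega>)))" by simp
  show "integrable lborel (\<lambda>y. indicator {b<..v} y * (u' y * tail_integral M Y X y))"
    using P.integrable_snd[OF kint] unfolding inner2 .
  have "(\<integral>\<omega>. (\<integral>y. k \<omega> y \<partial>lborel) \<partial>M) = (\<integral>y. (\<integral>\<omega>. k \<omega> y \<partial>M) \<partial>lborel)"
    using P.Fubini_integral[OF kint] by simp
  then show "(\<integral>\<omega>. Y \<omega> * u (clamp_real b v (X \<omega>)) \<partial>M) =
      u b * (\<integral>\<omega>. Y \<omega> \<partial>M) + (\<integral>y. indicator {b<..v} y * (u' y * tail_integral M Y X y) \<partial>lborel)"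
    unfolding inner1 inner2 using i2 Y by simp
qed

section \<open>Centered square integrable variables with a density\<close>

locale centered_rv = prob_space M for M :: "'w measure" +
  fixes X :: "'w \<Rightarrow> real" and r :: "real \<Rightarrow> real"
  assumes sq: "sq_integrable M X" and mean: "(\<integral>\<omega>. X \<omega> \<partial>M) = 0"
    and density: "distributed M lborel X (\<lambda>x. ennreal (r x))" and r_nonneg: "\<And>x. 0 \<le> r x"
begin

abbreviation tail :: "real \<Rightarrow> real"
  where "tail \<equiv> tail_integral M (\<lambda>_. 1) X"

abbreviation tmean :: "real \<Rightarrow> real"
  where "tmean \<equiv> tail_integral M X X"

lemma X_measurable[measurable]: "X \<in> borel_measurable M"
  by (rule sq_integrable_measurable[OF sq])

lemma r_measurable[measurable]: "r \<in> borel_measurable borel"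
proof -
  have "(\<lambda>x. enn2real (ennreal (r x))) \<in> borel_measurable lborel"
    using distributed_borel_measurable[OF density] by measurable
  then show ?thesis using r_nonneg by simp
qed

lemma X_integrable: "integrable M X"
  by (rule sq_integrable_integrable[OF sq])

lemma X_sq_integrable: "integrable M (\<lambda>\<omega>. (X \<omega>)\<^sup>2)"
  using sq_integrable_norm[OF sq] by simp

lemma integral_law: "h \<in> borel_measurable borel \<Longrightarrow> (\<integral>\<omega>. h (X \<omega>) \<partial>M) = (\<integral>x. r x * h x \<partial>lborel)" for h :: "real \<Rightarrow> real"
  using distributed_integral[OF density, of h] r_nonneg by simp

lemma integrable_law: "h \<in> borel_measurable borel \<Longrightarrow> integrable M (\<lambda>\<omega>. h (X \<omega>)) \<longleftrightarrow> integrable lborel (\<lambda>x. r x * h x)" for h :: "real \<Rightarrow> real"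
  using distributed_integrable[OF density, of h] r_nonneg by simp

lemma tail_eq: "tail z = \<P>(\<omega> in M. z < X \<omega>)"
proof -
  have "tail z = (\<integral>\<omega>. indicator {\<omega>\<in>space M. z < X \<omega>} \<omega> \<partial>M)"
    unfolding tail_integral_def by (rule Bochner_Integration.integral_cong) auto
  then show ?thesis by simp
qed

lemma tail_nonneg: "0 \<le> tail z" and tail_le_1: "tail z \<le> 1"
  by (simp_all add: tail_eq)

lemma integrable_if: "integrable M Y \<Longrightarrow> integrable M (\<lambda>\<omega>. if z < X \<omega> then Y \<omega> else 0)"
  for Y :: "'w \<Rightarrow> real"
proof -
  assume Y: "integrable M Y"
  then have [measurable]: "Y \<in> borel_measurable M" by simp
  show ?thesis by (rule Bochner_Integration.integrable_bound[OF Y]) auto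
qed

lemma integrable_if_le: "integrable M Y \<Longrightarrow> integrable M (\<lambda>\<omega>. if X \<omega> \<le> z then Y \<omega> else 0)"
  for Y :: "'w \<Rightarrow> real"
proof -
  assume Y: "integrable M Y"
  then have [measurable]: "Y \<in> borel_measurable M" by simp
  show ?thesis by (rule Bochner_Integration.integrable_bound[OF Y]) auto
qed

text \<open>The mean is zero, so the right and left partial means cancel. This makes
  \<open>tmean\<close> nonnegative on both sides of the origin and supplies the boundary terms at
  left endpoints.\<close>

lemma tmean_alt: "tmean z = - (\<integral>\<omega>. (if X \<omega> \<le> z then X \<omega> else 0) \<partial>M)"
proof -
  have "(\<integral>\<omega>. X \<omega> \<partial>M) = (\<integral>\<omega>. (if z < X \<omega> then X \<omega> else 0) + (if X \<omega> \<le> z then X \<omega> else 0) \<partial>M)"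
    by (rule Bochner_Integration.integral_cong) auto
  also have "\<dots> = tmean z + (\<integral>\<omega>. (if X \<omega> \<le> z then X \<omega> else 0) \<partial>M)"
    unfolding tail_integral_def using X_integrable
    by (intro Bochner_Integration.integral_add integrable_if integrable_if_le)
  finally show ?thesis using mean by simp
qed

lemma tmean_nonneg: "0 \<le> tmean z"
proof (cases "z \<ge> 0")
  case True
  then show ?thesis unfolding tail_integral_def by (intro integral_nonneg_AE AE_I2) auto
next
  case False
  have "0 \<le> (\<integral>\<omega>. - (if X \<omega> \<le> z then X \<omega> else 0) \<partial>M)"
    using False by (intro integral_nonneg_AE AE_I2) auto
  then show ?thesis by (simp add: tmean_alt)
qed

lemma tmean_ge: "z * tail z \<le> tmean z"
proof -
  have "z * tail z = (\<integral>\<omega>. (if z < X \<omega> then z else 0) \<partial>M)"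
    unfolding tail_integral_def integral_mult_right_zero[symmetric]
    by (rule Bochner_Integration.integral_cong) auto
  also have "\<dots> \<le> tmean z"
    unfolding tail_integral_def using X_integrable by (intro integral_mono integrable_if) auto
  finally show ?thesis .
qed

text \<open>The left counterpart of \<open>tmean_ge\<close>; together the two fix the signs of the
  derivatives of \<open>p\<close> and \<open>s\<close>.\<close>

lemma tmean_ge_left: "- z * (1 - tail z) \<le> tmean z"
proof -
  have "1 - tail z = (\<integral>\<omega>. 1 - (if z < X \<omega> then 1 else 0) \<partial>M)"
    unfolding tail_integral_def by (subst Bochner_Integration.integral_diff) (auto intro!: integrable_if simp: prob_space)
  also have "\<dots> = (\<integral>\<omega>. (if X \<omega> \<le> z then 1 else 0) \<partial>M)"
    by (rule Bochner_Integration.integral_cong) auto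
  finally have "- z * (1 - tail z) = (\<integral>\<omega>. - z * (if X \<omega> \<le> z then 1 else 0) \<partial>M)"
    by (simp only: integral_mult_right_zero)
  also have "\<dots> = (\<integral>\<omega>. (if X \<omega> \<le> z then - z else 0) \<partial>M)"
    by (rule Bochner_Integration.integral_cong) auto
  also have "\<dots> \<le> (\<integral>\<omega>. - (if X \<omega> \<le> z then X \<omega> else 0) \<partial>M)"
    using X_integrable by (intro integral_mono integrable_if_le Bochner_Integration.integrable_minus) auto
  finally show ?thesis by (simp add: tmean_alt)
qed

lemma tail_integral_tendsto_0:
  assumes Y: "integrable M Y" shows "(tail_integral M Y X \<longlongrightarrow> 0) at_top"
proof -
  have [measurable]: "Y \<in> borel_measurable M" using Y by simp
  have "((\<lambda>z. \<integral>\<omega>. (if z < X \<omega> then Y \<omega> else 0) \<partial>M) \<longlongrightarrow> (\<integral>\<omega>. 0 \<partial>M)) at_top"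
  proof (rule integral_dominated_convergence_at_top)
    show "integrable M (\<lambda>\<omega>. \<bar>Y \<omega>\<bar>)" using Y by simp
    show "\<forall>\<^sub>F z in at_top. AE \<omega> in M. norm (if z < X \<omega> then Y \<omega> else 0) \<le> \<bar>Y \<omega>\<bar>" by auto
    show "AE \<omega> in M. ((\<lambda>z. if z < X \<omega> then Y \<omega> else 0) \<longlongrightarrow> 0) at_top"
    proof (intro AE_I2 tendsto_eventually)
      fix \<omega> show "\<forall>\<^sub>F z in at_top. (if z < X \<omega> then Y \<omega> else 0) = 0"
        using eventually_ge_at_top[of "X \<omega>"] by eventually_elim auto
    qed
  qed auto
  then show ?thesis by (simp add: tail_integral_def[abs_def])
qed

text \<open>Let the clamp interval grow to the whole line. The identity comes first: there monotone
  convergence gives integrability of \<open>tmean\<close>, which then dominates the integrand for a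
  general \<open>f\<close>.\<close>

lemma expectation_lipschitz:
  assumes f: "lipschitz_C1 f f'"
  shows "integrable lborel tmean" "(\<integral>\<omega>. X \<omega> * f (X \<omega>) \<partial>M) = (\<integral>y. f' y * tmean y \<partial>lborel)"
proof -
  have lim: "(\<lambda>n. \<integral>\<omega>. X \<omega> * f (clamp_real (- real n) (real n) (X \<omega>)) \<partial>M) \<longlonglongrightarrow> (\<integral>\<omega>. X \<omega> * f (X \<omega>) \<partial>M)"
    if f: "lipschitz_C1 f f'" for f f'
  proof -
    obtain K where K: "K \<ge> 0" "\<And>x. \<bar>f x\<bar> \<le> \<bar>f 0\<bar> + K * \<bar>x\<bar>" and [measurable]: "f \<in> borel_measurable borel"
      by (rule lipschitz_C1E[OF f]) blast
    show ?thesis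
    proof (rule integral_dominated_convergence)
      show "integrable M (\<lambda>\<omega>. \<bar>f 0\<bar> * \<bar>X \<omega>\<bar> + K * (X \<omega>)\<^sup>2)" using X_integrable X_sq_integrable by simp
      show "AE \<omega> in M. (\<lambda>n. X \<omega> * f (clamp_real (- real n) (real n) (X \<omega>))) \<longlonglongrightarrow> X \<omega> * f (X \<omega>)"
      proof (intro AE_I2 tendsto_eventually)
        fix \<omega>
        obtain N :: nat where "\<bar>X \<omega>\<bar> \<le> real N" using real_arch_simple by blast
        then show "\<forall>\<^sub>F n in sequentially. X \<omega> * f (clamp_real (- real n) (real n) (X \<omega>)) = X \<omega> * f (X \<omega>)"
          by (intro eventually_sequentiallyI[of N]) (auto simp: clamp_real_def)
      qed
      show "AE \<omega> in M. norm (X \<omega> * f (clamp_real (- real n) (real n) (X \<omega>))) \<le> \<bar>f 0\<bar> * \<bar>X \<omega>\<bar> + K * (X \<omega>)\<^sup>2" for n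
      proof (intro AE_I2)
        fix \<omega>
        define x where "x = X \<omega>"
        have "\<bar>clamp_real (- real n) (real n) x\<bar> \<le> \<bar>x\<bar>" by (auto simp: clamp_real_def)
        then have "K * \<bar>clamp_real (- real n) (real n) x\<bar> \<le> K * \<bar>x\<bar>" using K(1) by (rule mult_left_mono)
        with K(2)[of "clamp_real (- real n) (real n) x"]
        have "\<bar>f (clamp_real (- real n) (real n) x)\<bar> \<le> \<bar>f 0\<bar> + K * \<bar>x\<bar>" by linarith
        then have "\<bar>x\<bar> * \<bar>f (clamp_real (- real n) (real n) x)\<bar> \<le> \<bar>x\<bar> * (\<bar>f 0\<bar> + K * \<bar>x\<bar>)"
          by (intro mult_left_mono) auto
        also have "\<dots> = \<bar>f 0\<bar> * \<bar>x\<bar> + K * x\<^sup>2"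
          by (simp add: distrib_left power2_eq_square abs_mult_self_eq mult_ac flip: abs_mult)
        finally show "norm (X \<omega> * f (clamp_real (- real n) (real n) (X \<omega>))) \<le> \<bar>f 0\<bar> * \<bar>X \<omega>\<bar> + K * (X \<omega>)\<^sup>2"
          by (simp add: x_def abs_mult)
      qed
    qed auto
  qed
  have part: "(\<integral>\<omega>. X \<omega> * f (clamp_real (- real n) (real n) (X \<omega>)) \<partial>M) = (\<integral>y. indicator {- real n<..real n} y * (f' y * tmean y) \<partial>lborel)"
    "integrable lborel (\<lambda>y. indicator {- real n<..real n} y * (f' y * tmean y))"
    if f: "lipschitz_C1 f f'" for f f' n
    using expectation_clamp[of "- real n" "real n" f f' X X] f X_integrable mean
    by (auto simp: lipschitz_C1_def continuous_on_eq_continuous_at)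
  have id: "lipschitz_C1 (\<lambda>x. x) (\<lambda>_. 1)" by (auto simp: lipschitz_C1_def intro!: exI[of _ 1])
  show int: "integrable lborel tmean"
  proof (rule integrable_monotone_convergence)
    show "integrable lborel (\<lambda>y. indicator {- real n<..real n} y * (1 * tmean y))" for n by (rule part(2)[OF id])
    show "AE y in lborel. mono (\<lambda>n. indicator {- real n<..real n} y * (1 * tmean y))"
      using tmean_nonneg by (intro AE_I2 monoI) (auto split: split_indicator)
    show "AE y in lborel. (\<lambda>n. indicator {- real n<..real n} y * (1 * tmean y)) \<longlonglongrightarrow> tmean y"
    proof (intro AE_I2 tendsto_eventually)
      fix y :: real
      obtain N :: nat where "\<bar>y\<bar> < real N" using reals_Archimedean2 by blast
      then show "\<forall>\<^sub>F n in sequentially. indicator {- real n<..real n} y * (1 * tmean y) = tmean y"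
        by (intro eventually_sequentiallyI[of N]) (auto split: split_indicator)
    qed
    show "(\<lambda>n. \<integral>y. indicator {- real n<..real n} y * (1 * tmean y) \<partial>lborel) \<longlonglongrightarrow> (\<integral>\<omega>. X \<omega> * X \<omega> \<partial>M)"
      using lim[OF id] unfolding part(1)[OF id] .
  qed simp
  obtain K where K: "K \<ge> 0" "\<And>x. \<bar>f' x\<bar> \<le> K" and [measurable]: "f' \<in> borel_measurable borel"
    by (rule lipschitz_C1E[OF f]) blast
  have "(\<lambda>n. \<integral>y. indicator {- real n<..real n} y * (f' y * tmean y) \<partial>lborel) \<longlonglongrightarrow> (\<integral>y. f' y * tmean y \<partial>lborel)"
  proof (rule integral_dominated_convergence)
    show "integrable lborel (\<lambda>y. K * tmean y)" using int by simp
    show "AE y in lborel. (\<lambda>n. indicator {- real n<..real n} y * (f' y * tmean y)) \<longlonglongrightarrow> f' y * tmean y"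
    proof (intro AE_I2 tendsto_eventually)
      fix y :: real
      obtain N :: nat where "\<bar>y\<bar> < real N" using reals_Archimedean2 by blast
      then show "\<forall>\<^sub>F n in sequentially. indicator {- real n<..real n} y * (f' y * tmean y) = f' y * tmean y"
        by (intro eventually_sequentiallyI[of N]) (auto split: split_indicator)
    qed
    show "AE y in lborel. norm (indicator {- real n<..real n} y * (f' y * tmean y)) \<le> K * tmean y" for n
    proof (intro AE_I2)
      fix y
      have "\<bar>f' y\<bar> * tmean y \<le> K * tmean y" by (intro mult_right_mono K tmean_nonneg)
      then show "norm (indicator {- real n<..real n} y * (f' y * tmean y)) \<le> K * tmean y"
        using K(1) tmean_nonneg[of y] by (auto simp: abs_mult split: split_indicator)
    qed
  qed auto
  with lim[OF f] show "(\<integral>\<omega>. X \<omega> * f (X \<omega>) \<partial>M) = (\<integral>y. f' y * tmean y \<partial>lborel)"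
    unfolding part(1)[OF f] by (rule LIMSEQ_unique)
qed

lemma tmean_integrable: "integrable lborel tmean" and second_moment: "(\<integral>\<omega>. (X \<omega>)\<^sup>2 \<partial>M) = (\<integral>y. tmean y \<partial>lborel)"
proof -
  have id: "lipschitz_C1 (\<lambda>x. x) (\<lambda>_. 1)" by (auto simp: lipschitz_C1_def intro!: exI[of _ 1])
  show "integrable lborel tmean" by (rule expectation_lipschitz(1)[OF id])
  show "(\<integral>\<omega>. (X \<omega>)\<^sup>2 \<partial>M) = (\<integral>y. tmean y \<partial>lborel)"
    using expectation_lipschitz(2)[OF id] by (simp add: power2_eq_square)
qed

text \<open>Cosines are derivatives of admissible test functions, so the integration by parts
  identity reaches a class that determines measures. For zero frequency the antiderivative is
  linear.\<close>

lemma lipschitz_C1_cos: "\<exists>f. lipschitz_C1 f (\<lambda>x. cos (t * x + \<theta>))"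
proof (cases "t = 0")
  case True
  have "lipschitz_C1 (\<lambda>x. cos \<theta> * x) (\<lambda>x. cos \<theta>)"
    unfolding lipschitz_C1_def by (auto intro!: derivative_eq_intros exI[of _ 1])
  with True show ?thesis by auto
next
  case False
  have "lipschitz_C1 (\<lambda>x. sin (t * x + \<theta>) / t) (\<lambda>x. cos (t * x + \<theta>))"
    unfolding lipschitz_C1_def using False
    by (auto intro!: derivative_eq_intros continuous_intros exI[of _ 1])
  then show ?thesis by blast
qed

text \<open>Integration by parts, for \<open>G\<close> and for \<open>tmean\<close>, equates the
  cosine integrals of two possibly signed measures. Adding the law of \<open>X\<close> weighted by
  \<open>k\<close> to both makes them positive, and cosine uniqueness applies.\<close>

lemma tmean_eq_set:
  assumes G: "integrable M G"
    and ibp: "\<And>f f'. lipschitz_C1 f f' \<Longrightarrow> (\<integral>\<omega>. X \<omega> * f (X \<omega>) \<partial>M) = (\<integral>\<omega>. f' (X \<omega>) * G \<omega> \<partial>M)"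
    and k[measurable]: "k \<in> borel_measurable borel" and k0: "\<And>x. 0 \<le> k x" and kint: "integrable M (\<lambda>\<omega>. k (X \<omega>))"
    and lower: "AE \<omega> in M. - k (X \<omega>) \<le> G \<omega>" and B[measurable]: "B \<in> sets borel"
  shows "(\<integral>\<omega>. indicator B (X \<omega>) * G \<omega> \<partial>M) = (\<integral>y. indicator B y * tmean y \<partial>lborel)"
proof -
  have [measurable]: "G \<in> borel_measurable M" using G by simp
  \<comment> \<open>The maximum with zero changes nothing almost surely and makes the density
    nonnegative everywhere.\<close>
  define H where "H \<omega> = max 0 (G \<omega> + k (X \<omega>))" for \<omega>
  define h where "h x = tmean x + k x * r x" for x
  have [measurable]: "H \<in> borel_measurable M" "h \<in> borel_measurable borel" unfolding H_def h_def by measurable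
  have HG: "AE \<omega> in M. H \<omega> = G \<omega> + k (X \<omega>)" using lower by eventually_elim (auto simp: H_def)
  have H0: "0 \<le> H \<omega>" for \<omega> by (simp add: H_def)
  have h0: "0 \<le> h x" for x using tmean_nonneg[of x] k0[of x] r_nonneg[of x] by (simp add: h_def)
  have krint: "integrable lborel (\<lambda>x. k x * r x)" using kint integrable_law[OF k] by (simp add: mult.commute)
  have Hint: "integrable M H"
    using HG by (subst integrable_cong_AE[OF _ _ HG]) (use G kint in auto)
  have hint: "integrable lborel h" unfolding h_def using tmean_integrable krint by simp
  define \<mu> where "\<mu> = distr (density M (\<lambda>\<omega>. ennreal (H \<omega>))) borel X"
  define \<nu> where "\<nu> = density lborel (\<lambda>x. ennreal (h x))"
  have eqw: "(\<integral>\<omega>. H \<omega> * w (X \<omega>) \<partial>M) - (\<integral>x. h x * w x \<partial>lborel) = (\<integral>\<omega>. w (X \<omega>) * G \<omega> \<partial>M) - (\<integral>x. w x * tmean x \<partial>lborel)"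
    if [measurable]: "w \<in> borel_measurable borel" and w: "\<And>x. \<bar>w x\<bar> \<le> 1" for w
  proof -
    have bd': "integrable lborel (\<lambda>x. w x * F x)" if F: "integrable lborel F" for F
    proof (rule Bochner_Integration.integrable_bound[OF F])
      have [measurable]: "F \<in> borel_measurable borel" using F by simp
      show "(\<lambda>x. w x * F x) \<in> borel_measurable lborel" by measurable
      show "AE x in lborel. norm (w x * F x) \<le> norm (F x)"
        using mult_right_mono[OF w, of "\<bar>F _\<bar>"] by (intro AE_I2) (simp add: abs_mult)
    qed
    have bdM: "integrable M (\<lambda>x. w (X x) * F x)" if F: "integrable M F" for F
    proof (rule Bochner_Integration.integrable_bound[OF F])
      have [measurable]: "F \<in> borel_measurable M" using F by simp
      show "(\<lambda>x. w (X x) * F x) \<in> borel_measurable M" by measurable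
      show "AE x in M. norm (w (X x) * F x) \<le> norm (F x)"
        using mult_right_mono[OF w, of "\<bar>F _\<bar>"] by (intro AE_I2) (simp add: abs_mult)
    qed
    have "(\<integral>\<omega>. H \<omega> * w (X \<omega>) \<partial>M) = (\<integral>\<omega>. w (X \<omega>) * G \<omega> + w (X \<omega>) * k (X \<omega>) \<partial>M)"
      using HG by (intro integral_cong_AE) (auto simp: algebra_simps elim: eventually_mono)
    also have "\<dots> = (\<integral>\<omega>. w (X \<omega>) * G \<omega> \<partial>M) + (\<integral>\<omega>. w (X \<omega>) * k (X \<omega>) \<partial>M)"
      by (intro Bochner_Integration.integral_add bdM G kint)
    also have "(\<integral>\<omega>. w (X \<omega>) * k (X \<omega>) \<partial>M) = (\<integral>x. w x * (k x * r x) \<partial>lborel)"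
      using integral_law[of "\<lambda>x. w x * k x"] by (simp add: mult_ac)
    finally have 1: "(\<integral>\<omega>. H \<omega> * w (X \<omega>) \<partial>M) = (\<integral>\<omega>. w (X \<omega>) * G \<omega> \<partial>M) + (\<integral>x. w x * (k x * r x) \<partial>lborel)" .
    have "(\<integral>x. h x * w x \<partial>lborel) = (\<integral>x. w x * tmean x + w x * (k x * r x) \<partial>lborel)"
      by (rule Bochner_Integration.integral_cong) (auto simp: h_def algebra_simps)
    also have "\<dots> = (\<integral>x. w x * tmean x \<partial>lborel) + (\<integral>x. w x * (k x * r x) \<partial>lborel)"
      by (intro Bochner_Integration.integral_add bd' tmean_integrable krint)
    finally show ?thesis using 1 by simp
  qed
  have fin: "finite_measure \<mu>" "finite_measure \<nu>"
  proof -
    have "finite_measure (density M (\<lambda>\<omega>. ennreal (H \<omega>)))"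
      using Hint H0 by (intro finite_measureI) (simp add: emeasure_density nn_integral_eq_integral cong: nn_integral_cong)
    then show "finite_measure \<mu>" unfolding \<mu>_def by (rule finite_measure.finite_measure_distr) simp
    show "finite_measure \<nu>" unfolding \<nu>_def
      using hint h0 by (intro finite_measureI) (simp add: emeasure_density nn_integral_eq_integral cong: nn_integral_cong)
  qed
  have "\<mu> = \<nu>"
  proof (rule finite_measure_eqI_cos[OF fin])
    show "sets \<mu> = sets borel" "sets \<nu> = sets borel" by (simp_all add: \<mu>_def \<nu>_def)
    fix t \<theta>
    obtain f where f: "lipschitz_C1 f (\<lambda>x. cos (t * x + \<theta>))" using lipschitz_C1_cos by blast
    have "(\<integral>x. cos (t * x + \<theta>) \<partial>\<mu>) = (\<integral>\<omega>. H \<omega> * cos (t * X \<omega> + \<theta>) \<partial>M)"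
      unfolding \<mu>_def by (subst integral_distr, simp, simp, subst integral_density) (auto simp: H0)
    also have "\<dots> = (\<integral>x. h x * cos (t * x + \<theta>) \<partial>lborel)"
      using eqw[of "\<lambda>x. cos (t * x + \<theta>)"] ibp[OF f] expectation_lipschitz(2)[OF f] by simp
    also have "\<dots> = (\<integral>x. cos (t * x + \<theta>) \<partial>\<nu>)"
      unfolding \<nu>_def by (subst integral_density) (auto simp: h0)
    finally show "(\<integral>x. cos (t * x + \<theta>) \<partial>\<mu>) = (\<integral>x. cos (t * x + \<theta>) \<partial>\<nu>)" .
  qed
  have "(\<integral>\<omega>. H \<omega> * indicator B (X \<omega>) \<partial>M) = (\<integral>x. indicator B x \<partial>\<mu>)"
    unfolding \<mu>_def by (subst integral_distr, simp, simp, subst integral_density) (auto simp: H0)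
  also have "\<dots> = (\<integral>x. h x * indicator B x \<partial>lborel)"
    unfolding \<open>\<mu> = \<nu>\<close> \<nu>_def by (subst integral_density) (auto simp: h0)
  finally show ?thesis using eqw[of "indicator B"] by (simp add: indicator_def)
qed

end

lemma AE_le_of_set_integrals:
  fixes u v :: "real \<Rightarrow> real"
  assumes u: "integrable lborel u" and v: "integrable lborel v"
    and le: "\<And>B. B \<in> sets borel \<Longrightarrow> (\<integral>y. indicator B y * u y \<partial>lborel) \<le> (\<integral>y. indicator B y * v y \<partial>lborel)"
  shows "AE y in lborel. u y \<le> v y"
proof -
  have [measurable]: "u \<in> borel_measurable borel" "v \<in> borel_measurable borel" using u v by simp_all
  define B where "B = {y. v y < u y}"
  have B[measurable]: "B \<in> sets borel" unfolding B_def by measurable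
  have i: "integrable lborel (\<lambda>y. indicator B y * u y)" "integrable lborel (\<lambda>y. indicator B y * v y)"
    using integrable_mult_indicator[OF _ u, of B] integrable_mult_indicator[OF _ v, of B] B by simp_all
  have nn: "0 \<le> indicator B y * u y - indicator B y * v y" for y by (auto simp: B_def split: split_indicator)
  have "(\<integral>y. indicator B y * u y - indicator B y * v y \<partial>lborel) = 0"
    using le[OF B] i nn by (intro antisym integral_nonneg_AE) auto
  then have "AE y in lborel. indicator B y * u y - indicator B y * v y = 0"
    by (subst (asm) integral_nonneg_eq_0_iff_AE) (use nn i in auto)
  then show ?thesis by eventually_elim (auto simp: B_def split: split_indicator_asm)
qed

subsection \<open>Pearson laws\<close>

lemma has_derivative_of_integral_difference:
  fixes \<psi> k :: "real \<Rightarrow> real"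
  assumes eq: "\<And>x y. x \<le> y \<Longrightarrow> \<psi> x - \<psi> y = (\<integral>t. k t * indicator {x..y} t \<partial>lborel)" and k: "continuous_on UNIV k"
  shows "(\<psi> has_real_derivative - k x) (at x)"
proof -
  \<comment> \<open>The base point \<open>x - 1\<close> puts \<open>x\<close> in the interior of the
    interval, so that the derivative is two-sided.\<close>
  define K where "K t = integral {x - 1..t} k" for t
  have ck: "continuous_on A k" for A using k continuous_on_subset by blast
  have K: "\<psi> t = \<psi> (x - 1) - K t" if "x - 1 \<le> t" for t
  proof -
    have "set_integrable lborel {x - 1..t} k"
      by (rule borel_integrable_atLeastAtMost') (rule ck)
    then have "(LBINT u:{x - 1..t}. k u) = K t" unfolding K_def by (rule set_borel_integral_eq_integral)
    then show ?thesis using eq[OF that] by (simp add: set_lebesgue_integral_def mult.commute)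
  qed
  have "(K has_real_derivative k x) (at x within {x - 1..x + 1})"
    unfolding K_def by (rule integral_has_real_derivative) (auto intro: ck)
  then have "(K has_real_derivative k x) (at x)"
    by (subst (asm) at_within_interior) auto
  then have "((\<lambda>t. \<psi> (x - 1) - K t) has_real_derivative - k x) (at x)"
    by (auto intro!: derivative_eq_intros)
  then show ?thesis
  proof (rule has_field_derivative_transform_within[of _ _ _ _ 1])
    show "\<psi> (x - 1) - K t = \<psi> t" if "dist t x < 1" for t
      using that by (intro K[symmetric]) (auto simp: dist_real_def)
  qed auto
qed

context centered_rv
begin

lemma tail_integral_diff:
  assumes h[measurable]: "h \<in> borel_measurable borel" and int: "integrable M (\<lambda>\<omega>. h (X \<omega>))" and "x \<le> y"
  shows "tail_integral M (\<lambda>\<omega>. h (X \<omega>)) X x - tail_integral M (\<lambda>\<omega>. h (X \<omega>)) X y = (\<integral>t. (h t * r t) * indicator {x..y} t \<partial>lborel)"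
proof -
  have "tail_integral M (\<lambda>\<omega>. h (X \<omega>)) X x - tail_integral M (\<lambda>\<omega>. h (X \<omega>)) X y =
    (\<integral>\<omega>. (if x < X \<omega> then h (X \<omega>) else 0) - (if y < X \<omega> then h (X \<omega>) else 0) \<partial>M)"
    unfolding tail_integral_def using int by (intro Bochner_Integration.integral_diff[symmetric] integrable_if)
  also have "\<dots> = (\<integral>\<omega>. (\<lambda>t. h t * indicator {x<..y} t) (X \<omega>) \<partial>M)"
    using \<open>x \<le> y\<close> by (intro Bochner_Integration.integral_cong) (auto split: split_indicator)
  also have "\<dots> = (\<integral>t. r t * (h t * indicator {x<..y} t) \<partial>lborel)"
    by (rule integral_law) measurable
  also have "\<dots> = (\<integral>t. (h t * r t) * indicator {x..y} t \<partial>lborel)"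
  proof (rule integral_cong_AE)
    show "AE t in lborel. r t * (h t * indicator {x<..y} t) = (h t * r t) * indicator {x..y} t"
      using AE_lborel_singleton[of x] by eventually_elim (auto split: split_indicator)
  qed measurable
  finally show ?thesis .
qed

lemma tail_has_derivative:
  assumes "continuous_on UNIV r"
  shows "(tail has_real_derivative - r x) (at x)"
proof (rule has_derivative_of_integral_difference[OF _ assms])
  show "tail x - tail y = (\<integral>t. r t * indicator {x..y} t \<partial>lborel)" if "x \<le> y" for x y
    using tail_integral_diff[OF borel_measurable_const integrable_const that, of 1] by (simp only: mult_1_left)
qed

lemma tmean_has_derivative:
  assumes "continuous_on UNIV r"
  shows "(tmean has_real_derivative - (x * r x)) (at x)"
proof (rule has_derivative_of_integral_difference)
  show "tmean x - tmean y = (\<integral>t. (t * r t) * indicator {x..y} t \<partial>lborel)" if "x \<le> y" for x y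
    by (rule tail_integral_diff[OF measurable_ident_sets[OF refl] X_integrable that])
  show "continuous_on UNIV (\<lambda>t. t * r t)" by (intro continuous_intros assms)
qed

text \<open>The clamped function is constant on each outer piece. With \<open>Y = X\<close> these
  pieces turn into multiples of \<open>tmean\<close> at the endpoints, the boundary terms of an
  integration by parts.\<close>

lemma clamp_split:
  assumes "b \<le> v" and Y: "integrable M Y" and int: "integrable M (\<lambda>\<omega>. Y \<omega> * u (clamp_real b v (X \<omega>)))"
  shows "(\<integral>\<omega>. Y \<omega> * u (clamp_real b v (X \<omega>)) \<partial>M) =
      u b * (\<integral>\<omega>. (if X \<omega> \<le> b then Y \<omega> else 0) \<partial>M) + (\<integral>\<omega>. indicator {b<..v} (X \<omega>) * (Y \<omega> * u (X \<omega>)) \<partial>M) + u v * tail_integral M Y X v"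
    and "integrable M (\<lambda>\<omega>. indicator {b<..v} (X \<omega>) * (Y \<omega> * u (X \<omega>)))"
proof -
  have eq: "Y \<omega> * u (clamp_real b v (X \<omega>)) = u b * (if X \<omega> \<le> b then Y \<omega> else 0) + indicator {b<..v} (X \<omega>) * (Y \<omega> * u (X \<omega>)) + u v * (if v < X \<omega> then Y \<omega> else 0)" for \<omega>
    using assms(1) by (auto simp: clamp_real_def split: split_indicator)
  have i: "integrable M (\<lambda>\<omega>. u b * (if X \<omega> \<le> b then Y \<omega> else 0))" "integrable M (\<lambda>\<omega>. u v * (if v < X \<omega> then Y \<omega> else 0))"
    using Y by (intro integrable_mult_right integrable_if integrable_if_le; simp)+
  have "integrable M (\<lambda>\<omega>. Y \<omega> * u (clamp_real b v (X \<omega>)) - u b * (if X \<omega> \<le> b then Y \<omega> else 0) - u v * (if v < X \<omega> then Y \<omega> else 0))"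
    using int i by (intro Bochner_Integration.integrable_diff)
  then show i2: "integrable M (\<lambda>\<omega>. indicator {b<..v} (X \<omega>) * (Y \<omega> * u (X \<omega>)))"
    unfolding eq by simp
  show "(\<integral>\<omega>. Y \<omega> * u (clamp_real b v (X \<omega>)) \<partial>M) =
      u b * (\<integral>\<omega>. (if X \<omega> \<le> b then Y \<omega> else 0) \<partial>M) + (\<integral>\<omega>. indicator {b<..v} (X \<omega>) * (Y \<omega> * u (X \<omega>)) \<partial>M) + u v * tail_integral M Y X v"
    unfolding eq tail_integral_def integral_mult_right_zero[symmetric]
    using i i2 by (simp only: Bochner_Integration.integral_add Bochner_Integration.integrable_add)
qed

lemma expectation_interval: "b \<le> v \<Longrightarrow> (\<integral>\<omega>. indicator {b<..v} (X \<omega>) \<partial>M) = tail b - tail v"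
  unfolding tail_integral_def
  by (subst Bochner_Integration.integral_diff[symmetric])
    (auto intro!: integrable_if Bochner_Integration.integral_cong split: split_indicator)

end

text \<open>The defining relation of \<open>g_star\<close> appears multiplied out, because its
  numerator is the tail mean.\<close>

locale pearson_law = centered_rv N Z r for N :: "'v measure" and Z r +
  fixes a :: ereal and \<alpha> \<beta> \<gamma> :: real
  assumes a_less: "a < \<infinity>" and r_cont: "continuous_on UNIV r"
    and r_pos: "\<And>z. a < ereal z \<Longrightarrow> 0 < r z" and r_zero: "\<And>z. \<not> a < ereal z \<Longrightarrow> r z = 0"
    and pearson: "\<And>z. a < ereal z \<Longrightarrow> tmean z = (\<alpha> * z\<^sup>2 + \<beta> * z + \<gamma>) * r z"
begin

definition q :: "real \<Rightarrow> real" where "q z = \<alpha> * z\<^sup>2 + \<beta> * z + \<gamma>"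

abbreviation Q :: "real \<Rightarrow> real" where "Q \<equiv> pearson_Q \<alpha> \<gamma>"

lemma tmean_zero: "\<not> a < ereal y \<Longrightarrow> tmean y = 0"
proof -
  assume y: "\<not> a < ereal y"
  have "(\<integral>\<omega>. (\<lambda>t. if t \<le> y then t else 0) (Z \<omega>) \<partial>N) = (\<integral>t. r t * (if t \<le> y then t else 0) \<partial>lborel)"
    by (rule integral_law) measurable
  also have "\<dots> = (\<integral>t. 0 \<partial>(lborel :: real measure))"
  proof (rule Bochner_Integration.integral_cong[OF refl])
    fix t
    have "r t = 0" if "t \<le> y" using y that by (intro r_zero) (meson ereal_less_eq(3) less_le_trans)
    then show "r t * (if t \<le> y then t else 0) = 0" by simp
  qed
  finally show ?thesis by (simp add: tmean_alt)
qed

lemma tmean_cont: "continuous_on A tmean"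
  using tmean_has_derivative[OF r_cont] by (meson DERIV_isCont continuous_at_imp_continuous_on)

text \<open>Otherwise \<open>tmean\<close> starts from zero at \<open>a\<close> and strictly
  decreases just to the right of it, its derivative being \<open>- (x * r x)\<close>, against its
  nonnegativity.\<close>

lemma a_neg: "a < 0"
proof (rule ccontr)
  assume "\<not> a < 0"
  then obtain a' where a': "a = ereal a'" "a' \<ge> 0" using a_less by (cases a) auto
  have "tmean (a' + 1) < tmean a'"
  proof (rule DERIV_neg_imp_decreasing_open[OF _ _ tmean_cont])
    fix x assume "a' < x" "x < a' + 1"
    then have "0 < x * r x" using a' r_pos[of x] by (intro mult_pos_pos) auto
    then show "\<exists>y. (tmean has_real_derivative y) (at x) \<and> y < 0" using tmean_has_derivative[OF r_cont, of x] by force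
  qed simp
  moreover have "tmean a' = 0" by (rule tmean_zero) (simp add: a')
  ultimately show False using tmean_nonneg[of "a' + 1"] by simp
qed

text \<open>The derivative \<open>- (x * r x)\<close> makes \<open>tmean\<close> strictly increasing
  on the negative part of the support and strictly decreasing on the positive part, and it is
  nonnegative throughout.\<close>

lemma tmean_pos: assumes "a < ereal x" shows "0 < tmean x"
proof (cases "x \<ge> 0")
  case True
  have "tmean (x + 1) < tmean x"
  proof (rule DERIV_neg_imp_decreasing_open[OF _ _ tmean_cont])
    fix y assume "x < y" "y < x + 1"
    then have "0 < y * r y" using True assms r_pos[of y] less_trans[of a "ereal x" "ereal y"] by (intro mult_pos_pos) auto
    then show "\<exists>z. (tmean has_real_derivative z) (at y) \<and> z < 0" using tmean_has_derivative[OF r_cont, of y] by force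
  qed simp
  then show ?thesis using tmean_nonneg[of "x + 1"] by simp
next
  case False
  obtain x' where x': "a < ereal x'" "x' < x" using ereal_dense2[OF assms] by auto
  have "tmean x' < tmean x"
  proof (rule DERIV_pos_imp_increasing[OF x'(2)])
    fix y assume "x' \<le> y" "y \<le> x"
    then have "y * r y < 0" using False x' r_pos[of y] less_le_trans[of a "ereal x'" "ereal y"] by (intro mult_neg_pos) auto
    then show "\<exists>z. (tmean has_real_derivative z) (at y) \<and> 0 < z" using tmean_has_derivative[OF r_cont, of y] by force
  qed
  then show ?thesis using tmean_nonneg[of x'] by simp
qed

lemma tmean_q: "a < ereal z \<Longrightarrow> tmean z = q z * r z"
  using pearson by (simp add: q_def)

lemma q_pos: "a < ereal z \<Longrightarrow> 0 < q z"
  using tmean_pos[of z] r_pos[of z] tmean_q[of z] by (simp add: zero_less_mult_iff)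

lemma gamma_pos: "0 < \<gamma>"
  using q_pos[of 0] a_neg by (simp add: q_def zero_ereal_def)

text \<open>The second moment is the integral of \<open>tmean\<close>, hence the mean of
  \<open>q\<close> under the law; so \<open>1 - \<alpha>\<close> times the second moment equals
  \<open>\<gamma>\<close>, and \<open>\<gamma> = q 0\<close> is positive because 0 lies in the
  support. This is what makes \<open>Q\<close> positive.\<close>

lemma alpha_less_1: "\<alpha> < 1"
proof -
  have i2: "integrable N (\<lambda>\<omega>. (Z \<omega>)\<^sup>2)" by (rule X_sq_integrable)
  have "(\<integral>\<omega>. (Z \<omega>)\<^sup>2 \<partial>N) = (\<integral>y. tmean y \<partial>lborel)" by (rule second_moment)
  also have "\<dots> = (\<integral>y. r y * q y \<partial>lborel)"
    using tmean_q tmean_zero r_zero by (intro Bochner_Integration.integral_cong refl) (metis mult.commute mult_zero_left)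
  also have "\<dots> = (\<integral>\<omega>. q (Z \<omega>) \<partial>N)"
    by (rule integral_law[symmetric]) (simp add: q_def[abs_def])
  also have "\<dots> = \<alpha> * (\<integral>\<omega>. (Z \<omega>)\<^sup>2 \<partial>N) + \<gamma>"
    using i2 X_integrable mean by (simp add: q_def prob_space)
  finally have "(1 - \<alpha>) * (\<integral>\<omega>. (Z \<omega>)\<^sup>2 \<partial>N) = \<gamma>" by (simp add: algebra_simps)
  moreover have "0 \<le> (\<integral>\<omega>. (Z \<omega>)\<^sup>2 \<partial>N)" by simp
  ultimately show ?thesis using gamma_pos by (metis diff_gt_0_iff_gt not_less zero_less_mult_iff)
qed

lemma Q_pos: "0 < Q z"
  unfolding pearson_Q_def using alpha_less_1 gamma_pos by (simp add: add_nonneg_pos)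

lemma Q_mono: "0 \<le> z \<Longrightarrow> z \<le> x \<Longrightarrow> Q z \<le> Q x"
  unfolding pearson_Q_def using alpha_less_1 by (intro add_right_mono mult_left_mono power_mono) auto

lemma pos_imp_supp: "0 \<le> z \<Longrightarrow> a < ereal z"
  using a_neg by (metis ereal_less_eq(5) less_le_trans)

text \<open>The difference of the two sides is nonincreasing and tends to \<open>0\<close> at infinity.\<close>

lemma tail_lower:
  assumes x: "0 \<le> x"
  shows "((1 - 2 * \<alpha>) * x - \<beta>) / Q x * tmean x \<le> tail x"
proof -
  \<comment> \<open>The numerator is chosen so that \<open>x * R x = 1 - q x / Q x\<close>, which is
    the lower bound on \<open>x * p x\<close> that the estimate of \<open>p'\<close>
    requires.\<close>
  define R where "R x = ((1 - 2 * \<alpha>) * x - \<beta>) / Q x" for x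
  define D where "D x = tail x - R x * tmean x" for x
  have D': "(D has_real_derivative - (2 * (1 - \<alpha>) * r y * (q y)\<^sup>2 / (Q y)\<^sup>2)) (at y)" if y: "a < ereal y" for y
  proof -
    have Q0: "Q y \<noteq> 0" using Q_pos[of y] by simp
    define n where "n = (1 - 2 * \<alpha>) * Q y - ((1 - 2 * \<alpha>) * y - \<beta>) * (2 * (1 - \<alpha>) * y)"
    have dQ: "(Q has_real_derivative 2 * (1 - \<alpha>) * y) (at y)"
      unfolding pearson_Q_def[abs_def] by (auto intro!: derivative_eq_intros)
    have dR: "(R has_real_derivative n / (Q y)\<^sup>2) (at y)"
      unfolding R_def[abs_def] n_def using Q0
      by (auto intro!: derivative_eq_intros dQ simp: power2_eq_square)
    have "((\<lambda>x. R x * tmean x) has_real_derivative R y * - (y * r y) + n / (Q y)\<^sup>2 * tmean y) (at y)"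
      by (rule DERIV_mult'[OF dR tmean_has_derivative[OF r_cont]])
    from DERIV_diff[OF tail_has_derivative[OF r_cont] this]
    have "(D has_real_derivative - r y - (n / (Q y)\<^sup>2 * tmean y + R y * - (y * r y))) (at y)"
      unfolding D_def[abs_def] by (simp only: add.commute)
    moreover have "- r y - (n / (Q y)\<^sup>2 * tmean y + R y * - (y * r y)) = - (2 * (1 - \<alpha>) * r y * (q y)\<^sup>2 / (Q y)\<^sup>2)"
    proof -
      have e1: "((1 - 2 * \<alpha>) * y - \<beta>) * y = Q y - q y"
        by (simp add: pearson_Q_def q_def power2_eq_square algebra_simps)
      have "n = (1 - 2 * \<alpha>) * Q y - 2 * (1 - \<alpha>) * (((1 - 2 * \<alpha>) * y - \<beta>) * y)" by (simp add: n_def)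
      then have e2: "n = 2 * (1 - \<alpha>) * q y - Q y" unfolding e1 by (simp add: algebra_simps)
      have e3: "R y * y = 1 - q y / Q y"
      proof -
        have "R y * y = (((1 - 2 * \<alpha>) * y - \<beta>) * y) / Q y" by (simp only: R_def times_divide_eq_left)
        then show ?thesis unfolding e1 using Q0 by (simp only: diff_divide_distrib) simp
      qed
      have "- r y - (n / (Q y)\<^sup>2 * tmean y + R y * - (y * r y)) = r y * (R y * y - 1 - n * q y / (Q y)\<^sup>2)"
        by (simp add: tmean_q[OF y] algebra_simps)
      also have "\<dots> = - (2 * (1 - \<alpha>) * r y * (q y)\<^sup>2 / (Q y)\<^sup>2)"
        unfolding e2 e3 using Q0 by (simp add: field_simps power2_eq_square)
      finally show ?thesis .
    qed
    ultimately show ?thesis by simp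
  qed
  have mono: "D y \<le> D x" if "x \<le> y" for y
  proof (rule DERIV_nonpos_imp_nonincreasing[OF that])
    fix t assume "x \<le> t" "t \<le> y"
    then have t: "a < ereal t" using x by (intro pos_imp_supp) auto
    have "0 \<le> 2 * (1 - \<alpha>) * r t * (q t)\<^sup>2 / (Q t)\<^sup>2"
      using alpha_less_1 r_nonneg by (intro divide_nonneg_nonneg mult_nonneg_nonneg) auto
    then show "\<exists>z. (D has_real_derivative z) (at t) \<and> z \<le> 0" using D'[OF t] by force
  qed
  have "(D \<longlongrightarrow> 0) at_top"
  proof -
    \<comment> \<open>Beyond 1 the numerator of \<open>R\<close> grows at most linearly while
      \<open>Q y\<close> is at least \<open>(1 - \<alpha>) * y\<close>; \<open>C\<close> is the
      quotient of the two constants.\<close>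
    define C where "C = (\<bar>1 - 2 * \<alpha>\<bar> + \<bar>\<beta>\<bar>) / (1 - \<alpha>)"
    have R: "\<bar>R y\<bar> \<le> C" if y: "1 \<le> y" for y
    proof -
      have "\<bar>(1 - 2 * \<alpha>) * y - \<beta>\<bar> \<le> \<bar>1 - 2 * \<alpha>\<bar> * y + \<bar>\<beta>\<bar> * y"
      proof -
        have "\<bar>\<beta>\<bar> * 1 \<le> \<bar>\<beta>\<bar> * y" using y by (intro mult_left_mono) auto
        moreover have "\<bar>(1 - 2 * \<alpha>) * y\<bar> = \<bar>1 - 2 * \<alpha>\<bar> * y" using y by (simp add: abs_mult)
        ultimately show ?thesis by linarith
      qed
      moreover have "(1 - \<alpha>) * y \<le> Q y"
      proof -
        have "y \<le> y\<^sup>2" using y self_le_power[of y 2] by simp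
        then have "(1 - \<alpha>) * y \<le> (1 - \<alpha>) * y\<^sup>2" using alpha_less_1 by (intro mult_left_mono) auto
        then show ?thesis using gamma_pos by (simp add: pearson_Q_def)
      qed
      ultimately have "\<bar>(1 - 2 * \<alpha>) * y - \<beta>\<bar> / Q y \<le> (\<bar>1 - 2 * \<alpha>\<bar> * y + \<bar>\<beta>\<bar> * y) / ((1 - \<alpha>) * y)"
        using y alpha_less_1 by (intro frac_le) auto
      also have "\<dots> = C" using y alpha_less_1 by (simp add: C_def distrib_right[symmetric])
      finally show ?thesis using Q_pos[of y] by (simp add: R_def)
    qed
    have t0: "(tail \<longlongrightarrow> 0) at_top" "(tmean \<longlongrightarrow> 0) at_top"
      using X_integrable by (auto intro!: tail_integral_tendsto_0)
    have "((\<lambda>y. R y * tmean y) \<longlongrightarrow> 0) at_top"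
    proof (rule Lim_null_comparison)
      show "((\<lambda>y. C * tmean y) \<longlongrightarrow> 0) at_top" using tendsto_mult_left[OF t0(2), of C] by simp
      show "\<forall>\<^sub>F y in at_top. norm (R y * tmean y) \<le> C * tmean y"
        using eventually_ge_at_top[of 1]
      proof eventually_elim
        case (elim y)
        then show ?case using mult_right_mono[OF R[OF elim] tmean_nonneg[of y]] tmean_nonneg[of y] by (simp add: abs_mult)
      qed
    qed
    then show ?thesis unfolding D_def[abs_def] using tendsto_diff[OF t0(1)] by force
  qed
  then have "0 \<le> D x"
    by (rule tendsto_upperbound) (auto simp: eventually_at_top_linorder intro!: exI[of _ x] mono)
  then show ?thesis by (simp add: D_def R_def)
qed

text \<open>Up to constant factors, \<open>p\<close> and \<open>s\<close> are the right and left
  branches of the Stein solution for an indicator of a half-line. They solve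
  \<open>q p' = x p - 1\<close> and \<open>q s' = 1 + x s\<close>.\<close>

definition p :: "real \<Rightarrow> real" where "p x = tail x / tmean x"

definition s :: "real \<Rightarrow> real" where "s x = (1 - tail x) / tmean x"

lemma p_measurable[measurable]: "p \<in> borel_measurable borel"
  unfolding p_def by measurable

lemma s_measurable[measurable]: "s \<in> borel_measurable borel"
  unfolding s_def by measurable

lemma p_nonneg: "0 \<le> p x" and s_nonneg: "0 \<le> s x"
  using tail_nonneg[of x] tail_le_1[of x] tmean_nonneg[of x] by (simp_all add: p_def s_def)

lemma p_has_derivative: assumes x: "a < ereal x" shows "(p has_real_derivative (x * p x - 1) / q x) (at x)"
proof -
  have 0: "tmean x \<noteq> 0" "q x \<noteq> 0" "r x \<noteq> 0" using tmean_pos[OF x] q_pos[OF x] r_pos[OF x] by auto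
  have "(p has_real_derivative (- r x * tmean x - tail x * - (x * r x)) / (tmean x * tmean x)) (at x)"
    unfolding p_def[abs_def] by (intro DERIV_divide tail_has_derivative[OF r_cont] tmean_has_derivative[OF r_cont] 0)
  moreover have "(- r x * tmean x - tail x * - (x * r x)) / (tmean x * tmean x) = (x * p x - 1) / q x"
    unfolding p_def tmean_q[OF x] using 0 by (simp add: field_simps)
  ultimately show ?thesis by simp
qed

lemma s_has_derivative: assumes x: "a < ereal x" shows "(s has_real_derivative (1 + x * s x) / q x) (at x)"
proof -
  have 0: "tmean x \<noteq> 0" "q x \<noteq> 0" "r x \<noteq> 0" using tmean_pos[OF x] q_pos[OF x] r_pos[OF x] by auto
  have d: "((\<lambda>x. 1 - tail x) has_real_derivative r x) (at x)"
    using tail_has_derivative[OF r_cont, of x] by (auto intro!: derivative_eq_intros)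
  have "(s has_real_derivative (r x * tmean x - (1 - tail x) * - (x * r x)) / (tmean x * tmean x)) (at x)"
    unfolding s_def[abs_def] by (intro DERIV_divide d tmean_has_derivative[OF r_cont] 0)
  moreover have "(r x * tmean x - (1 - tail x) * - (x * r x)) / (tmean x * tmean x) = (1 + x * s x) / q x"
    unfolding s_def tmean_q[OF x] using 0 by (simp add: field_simps)
  ultimately show ?thesis by simp
qed

lemma isCont_q: "isCont q x"
  unfolding q_def[abs_def] by (intro continuous_intros)

lemma isCont_p': assumes x: "a < ereal x" shows "isCont (\<lambda>x. (x * p x - 1) / q x) x"
  using q_pos[OF x] by (intro continuous_intros isCont_q DERIV_isCont[OF p_has_derivative[OF x]]) auto

lemma isCont_s': assumes x: "a < ereal x" shows "isCont (\<lambda>x. (1 + x * s x) / q x) x"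
  using q_pos[OF x] by (intro continuous_intros isCont_q DERIV_isCont[OF s_has_derivative[OF x]]) auto

lemma x_p_le_1: "a < ereal x \<Longrightarrow> x * p x \<le> 1"
  using tmean_ge[of x] tmean_pos[of x] by (simp add: p_def)

lemma s_deriv_nonneg: "a < ereal x \<Longrightarrow> 0 \<le> 1 + x * s x"
  using tmean_ge_left[of x] tmean_pos[of x] by (simp add: s_def field_simps)

text \<open>The lower bound on the tail, divided by \<open>tmean\<close> and multiplied by
  \<open>x\<close>, reads \<open>x * p x \<ge> 1 - q x / Q x\<close>. Division by \<open>q\<close>
  then cancels \<open>q\<close> altogether.\<close>

lemma p_deriv_bound: assumes x: "0 \<le> x" shows "- (1 / Q x) \<le> (x * p x - 1) / q x"
proof -
  have ax: "a < ereal x" by (rule pos_imp_supp[OF x])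
  have "((1 - 2 * \<alpha>) * x - \<beta>) / Q x \<le> p x"
    using tail_lower[OF x] tmean_pos[OF ax] by (simp add: p_def pos_le_divide_eq)
  then have "x * (((1 - 2 * \<alpha>) * x - \<beta>) / Q x) \<le> x * p x" using x by (rule mult_left_mono)
  moreover have "x * (((1 - 2 * \<alpha>) * x - \<beta>) / Q x) = 1 - q x / Q x"
  proof -
    have "x * ((1 - 2 * \<alpha>) * x - \<beta>) = Q x - q x" by (simp add: pearson_Q_def q_def power2_eq_square algebra_simps)
    then have "x * (((1 - 2 * \<alpha>) * x - \<beta>) / Q x) = (Q x - q x) / Q x" by (simp only: times_divide_eq_right)
    then show ?thesis using Q_pos[of x] by (simp only: diff_divide_distrib) simp
  qed
  ultimately have "- (q x / Q x) \<le> x * p x - 1" by linarith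
  then have "- (q x / Q x) / q x \<le> (x * p x - 1) / q x" using q_pos[OF ax] by (intro divide_right_mono) auto
  then show ?thesis using q_pos[OF ax] by simp
qed

end

subsection \<open>Comparison of tails\<close>

text \<open>\<open>lower\<close> is the comparison of \<open>G\<close> with the Pearson quadratic in
  density form. \<open>supp\<close> makes the tail of \<open>X\<close> tend to 1 when the left
  endpoint descends to \<open>a\<close>.\<close>

locale pearson_comparison = P: pearson_law N Z \<rho>s a \<alpha> \<beta> \<gamma> + centered_rv M X r
  for N :: "'v measure" and Z \<rho>s a \<alpha> \<beta> \<gamma> and M :: "'w measure" and X r +
  assumes lower: "AE x in lborel. a < ereal x \<longrightarrow> P.q x * r x \<le> tmean x"
    and supp: "AE \<omega> in M. a < ereal (X \<omega>)"
begin

text \<open>Integrate the nonnegative product of \<open>s'\<close> and \<open>tmean - q r\<close>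
  over the interval. Since \<open>q s' = 1 + x s\<close>, the part with \<open>q r\<close> is the
  interval probability plus the mean of \<open>X s(X)\<close> there. The clamp identity produces the
  same mean from \<open>tmean\<close>, and the two cancel.\<close>

lemma left_interval_bound:
  assumes b: "a < ereal b" and "b \<le> z"
  shows "tail b - tail z \<le> P.s z * tmean z"
proof -
  have above: "a < ereal y" if "b \<le> y" for y using b that by (meson ereal_less_eq(3) less_le_trans)
  define s' where "s' x = (1 + x * P.s x) / P.q x" for x
  have [measurable]: "s' \<in> borel_measurable borel" unfolding s'_def P.q_def by measurable
  have cl: "(\<integral>\<omega>. X \<omega> * P.s (clamp_real b z (X \<omega>)) \<partial>M) = P.s b * (\<integral>\<omega>. X \<omega> \<partial>M) + (\<integral>y. indicator {b<..z} y * (s' y * tmean y) \<partial>lborel)"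
    "integrable lborel (\<lambda>y. indicator {b<..z} y * (s' y * tmean y))"
    "integrable M (\<lambda>\<omega>. X \<omega> * P.s (clamp_real b z (X \<omega>)))"
    using expectation_clamp[OF \<open>b \<le> z\<close>, of P.s s' X X] P.s_has_derivative P.isCont_s' above X_integrable
    unfolding s'_def by auto
  note sp = clamp_split[OF \<open>b \<le> z\<close> X_integrable cl(3)]
  have iI: "integrable M (\<lambda>\<omega>. indicator {b<..z} (X \<omega>) :: real)"
    by (rule integrable_const_bound[where B=1]) (auto split: split_indicator)
  \<comment> \<open>The factor \<open>q\<close> cancels the denominator of \<open>s'\<close>; what
    remains is an expectation under the law of \<open>X\<close>.\<close>
  have eqq: "indicator {b<..z} y * (s' y * (P.q y * r y)) = r y * (indicator {b<..z} y * (1 + y * P.s y))" for y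
    using P.q_pos[OF above, of y] by (auto simp: s'_def split: split_indicator)
  have iM: "integrable M (\<lambda>\<omega>. indicator {b<..z} (X \<omega>) * (1 + X \<omega> * P.s (X \<omega>)))"
    using iI sp(2) by (simp add: distrib_left)
  have il: "integrable lborel (\<lambda>y. indicator {b<..z} y * (s' y * (P.q y * r y)))"
    unfolding eqq using iM integrable_law[of "\<lambda>y. indicator {b<..z} y * (1 + y * P.s y)"] by simp
  have "(\<integral>y. indicator {b<..z} y * (s' y * (P.q y * r y)) \<partial>lborel) = (\<integral>\<omega>. indicator {b<..z} (X \<omega>) * (1 + X \<omega> * P.s (X \<omega>)) \<partial>M)"
    unfolding eqq using integral_law[of "\<lambda>y. indicator {b<..z} y * (1 + y * P.s y)"] by simp
  also have "\<dots> = (tail b - tail z) + (\<integral>\<omega>. indicator {b<..z} (X \<omega>) * (X \<omega> * P.s (X \<omega>)) \<partial>M)"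
    unfolding expectation_interval[OF \<open>b \<le> z\<close>, symmetric] distrib_left mult_1_right
    by (rule Bochner_Integration.integral_add[OF iI sp(2)])
  finally have 1: "(\<integral>y. indicator {b<..z} y * (s' y * (P.q y * r y)) \<partial>lborel) =
     (tail b - tail z) + (\<integral>\<omega>. indicator {b<..z} (X \<omega>) * (X \<omega> * P.s (X \<omega>)) \<partial>M)" .
  have "(\<integral>y. indicator {b<..z} y * (s' y * (P.q y * r y)) \<partial>lborel) \<le> (\<integral>y. indicator {b<..z} y * (s' y * tmean y) \<partial>lborel)"
  proof (rule integral_mono_AE[OF il cl(2)])
    show "AE y in lborel. indicator {b<..z} y * (s' y * (P.q y * r y)) \<le> indicator {b<..z} y * (s' y * tmean y)"
      using lower
    proof eventually_elim
      case (elim y)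
      show ?case
      proof (cases "y \<in> {b<..z}")
        case True
        then have y: "a < ereal y" by (intro above) auto
        have "0 \<le> s' y" using P.s_deriv_nonneg[OF y] P.q_pos[OF y] by (simp add: s'_def)
        then show ?thesis using True elim y by (simp add: mult_left_mono)
      qed simp
    qed
  qed
  also have "\<dots> = P.s b * - tmean b + (\<integral>\<omega>. indicator {b<..z} (X \<omega>) * (X \<omega> * P.s (X \<omega>)) \<partial>M) + P.s z * tmean z"
    using cl(1) sp(1) mean tmean_alt[of b] by simp
  finally have "tail b - tail z \<le> P.s z * tmean z - P.s b * tmean b" unfolding 1 by simp
  \<comment> \<open>The boundary term at \<open>b\<close> has a favourable sign and is dropped, so
    nothing has to be known about its limit as \<open>b\<close> tends to \<open>a\<close>.\<close>
  moreover have "0 \<le> P.s b * tmean b" by (intro mult_nonneg_nonneg P.s_nonneg tmean_nonneg)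
  ultimately show ?thesis by linarith
qed

text \<open>The right-hand side of the interval bound does not involve \<open>b\<close>, so
  \<open>b\<close> may descend to \<open>a\<close>.\<close>

lemma left_bound:
  assumes z: "a < ereal z"
  shows "1 - tail z \<le> P.s z * tmean z"
proof -
  obtain b where b: "\<And>n::nat. a < ereal (b n)" "\<And>n. ereal (b n) < ereal z" "(\<lambda>n. ereal (b n)) \<longlonglongrightarrow> a"
    using ereal_decseq_approx[OF z] by metis
  have "(\<lambda>n. \<integral>\<omega>. (if b n < X \<omega> then 1 else 0 :: real) \<partial>M) \<longlonglongrightarrow> (\<integral>\<omega>. 1 \<partial>M)"
  proof (rule integral_dominated_convergence)
    show "integrable M (\<lambda>_. 1 :: real)" by simp
    show "AE \<omega> in M. (\<lambda>n. if b n < X \<omega> then 1 else 0) \<longlonglongrightarrow> (1::real)"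
      using supp
    proof eventually_elim
      case (elim \<omega>)
      from order_tendstoD(2)[OF b(3) elim] have "\<forall>\<^sub>F n in sequentially. b n < X \<omega>" by simp
      then have "\<forall>\<^sub>F n in sequentially. (if b n < X \<omega> then 1 else 0) = (1::real)" by eventually_elim simp
      then show ?case by (rule tendsto_eventually)
    qed
  qed auto
  then have "(\<lambda>n. tail (b n)) \<longlonglongrightarrow> 1" by (simp add: tail_integral_def prob_space)
  then have "(\<lambda>n. tail (b n) - tail z) \<longlonglongrightarrow> 1 - tail z" by (intro tendsto_intros)
  then show ?thesis
  proof (rule tendsto_upperbound)
    have "tail (b n) - tail z \<le> P.s z * tmean z" for n
      using b(2)[of n] by (intro left_interval_bound b(1)) auto
    then show "\<forall>\<^sub>F n in sequentially. tail (b n) - tail z \<le> P.s z * tmean z" by simp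
  qed simp
qed

text \<open>The left-hand side is the integral of \<open>- p'\<close> times
  \<open>tmean - q r\<close>. As \<open>- p'\<close> lies between 0 and \<open>1 / Q z\<close> on
  the interval, dropping \<open>q r\<close> bounds it by the integral of \<open>tmean\<close> over
  \<open>Q z\<close>, and the clamp identity for the identity function evaluates that
  integral.\<close>

lemma right_bound:
  assumes z: "0 < z" "z \<le> v"
  shows "P.p z * tmean z - P.p v * tmean v - (tail z - tail v) \<le>
    1 / P.Q z * (v * tmean v - z * tmean z + (\<integral>\<omega>. indicator {z<..v} (X \<omega>) * (X \<omega> * X \<omega>) \<partial>M))"
proof -
  have above: "a < ereal y" if "z \<le> y" for y using z that by (intro P.pos_imp_supp) auto
  define p' where "p' x = (x * P.p x - 1) / P.q x" for x
  have [measurable]: "p' \<in> borel_measurable borel" unfolding p'_def P.q_def by measurable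
  have cl: "(\<integral>\<omega>. X \<omega> * P.p (clamp_real z v (X \<omega>)) \<partial>M) = P.p z * (\<integral>\<omega>. X \<omega> \<partial>M) + (\<integral>y. indicator {z<..v} y * (p' y * tmean y) \<partial>lborel)"
    "integrable lborel (\<lambda>y. indicator {z<..v} y * (p' y * tmean y))"
    "integrable M (\<lambda>\<omega>. X \<omega> * P.p (clamp_real z v (X \<omega>)))"
    using expectation_clamp[OF \<open>z \<le> v\<close>, of P.p p' X X] P.p_has_derivative P.isCont_p' above X_integrable
    unfolding p'_def by auto
  note sp = clamp_split[OF \<open>z \<le> v\<close> X_integrable cl(3)]
  have iI: "integrable M (\<lambda>\<omega>. indicator {z<..v} (X \<omega>) :: real)"
    by (rule integrable_const_bound[where B=1]) (auto split: split_indicator)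
  have eqq: "indicator {z<..v} y * (p' y * (P.q y * r y)) = r y * (indicator {z<..v} y * (y * P.p y - 1))" for y
    using P.q_pos[OF above, of y] by (auto simp: p'_def split: split_indicator)
  have iM: "integrable M (\<lambda>\<omega>. indicator {z<..v} (X \<omega>) * (X \<omega> * P.p (X \<omega>) - 1))"
    using iI sp(2) by (simp add: right_diff_distrib)
  have il: "integrable lborel (\<lambda>y. indicator {z<..v} y * (p' y * (P.q y * r y)))"
    unfolding eqq using iM integrable_law[of "\<lambda>y. indicator {z<..v} y * (y * P.p y - 1)"] by simp
  have "(\<integral>y. indicator {z<..v} y * (p' y * (P.q y * r y)) \<partial>lborel) = (\<integral>\<omega>. indicator {z<..v} (X \<omega>) * (X \<omega> * P.p (X \<omega>) - 1) \<partial>M)"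
    unfolding eqq using integral_law[of "\<lambda>y. indicator {z<..v} y * (y * P.p y - 1)"] by simp
  also have "\<dots> = (\<integral>\<omega>. indicator {z<..v} (X \<omega>) * (X \<omega> * P.p (X \<omega>)) \<partial>M) - (tail z - tail v)"
    unfolding expectation_interval[OF \<open>z \<le> v\<close>, symmetric] right_diff_distrib mult_1_right
    by (rule Bochner_Integration.integral_diff[OF sp(2) iI])
  finally have 1: "(\<integral>y. indicator {z<..v} y * (p' y * (P.q y * r y)) \<partial>lborel) =
     (\<integral>\<omega>. indicator {z<..v} (X \<omega>) * (X \<omega> * P.p (X \<omega>)) \<partial>M) - (tail z - tail v)" .
  have 2: "(\<integral>y. indicator {z<..v} y * (p' y * tmean y) \<partial>lborel) =
     - P.p z * tmean z + (\<integral>\<omega>. indicator {z<..v} (X \<omega>) * (X \<omega> * P.p (X \<omega>)) \<partial>M) + P.p v * tmean v"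
    using cl(1) sp(1) mean tmean_alt[of z] by simp
  have cl': "(\<integral>\<omega>. X \<omega> * clamp_real z v (X \<omega>) \<partial>M) = z * (\<integral>\<omega>. X \<omega> \<partial>M) + (\<integral>y. indicator {z<..v} y * (1 * tmean y) \<partial>lborel)"
    "integrable lborel (\<lambda>y. indicator {z<..v} y * (1 * tmean y))"
    "integrable M (\<lambda>\<omega>. X \<omega> * clamp_real z v (X \<omega>))"
    using expectation_clamp[OF \<open>z \<le> v\<close>, of "\<lambda>x. x" "\<lambda>_. 1" X X] X_integrable by auto
  have 3: "(\<integral>y. indicator {z<..v} y * tmean y \<partial>lborel) = v * tmean v - z * tmean z + (\<integral>\<omega>. indicator {z<..v} (X \<omega>) * (X \<omega> * X \<omega>) \<partial>M)"
    using cl'(1) clamp_split(1)[OF \<open>z \<le> v\<close> X_integrable cl'(3)] mean tmean_alt[of z] by simp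
  have "(\<integral>y. indicator {z<..v} y * (p' y * (P.q y * r y)) \<partial>lborel) - (\<integral>y. indicator {z<..v} y * (p' y * tmean y) \<partial>lborel) =
     (\<integral>y. indicator {z<..v} y * (p' y * (P.q y * r y)) - indicator {z<..v} y * (p' y * tmean y) \<partial>lborel)"
    by (rule Bochner_Integration.integral_diff[OF il cl(2), symmetric])
  also have "\<dots> \<le> (\<integral>y. 1 / P.Q z * (indicator {z<..v} y * (1 * tmean y)) \<partial>lborel)"
  proof (rule integral_mono_AE)
    show "integrable lborel (\<lambda>y. indicator {z<..v} y * (p' y * (P.q y * r y)) - indicator {z<..v} y * (p' y * tmean y))"
      by (rule Bochner_Integration.integrable_diff[OF il cl(2)])
    show "integrable lborel (\<lambda>y. 1 / P.Q z * (indicator {z<..v} y * (1 * tmean y)))"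
      by (rule integrable_mult_right[OF cl'(2)])
    show "AE y in lborel. indicator {z<..v} y * (p' y * (P.q y * r y)) - indicator {z<..v} y * (p' y * tmean y) \<le> 1 / P.Q z * (indicator {z<..v} y * (1 * tmean y))"
      using lower
    proof eventually_elim
      case (elim y)
      show ?case
      proof (cases "y \<in> {z<..v}")
        case True
        then have y: "a < ereal y" by (intro above) auto
        have d0: "0 \<le> - p' y" using P.x_p_le_1[OF y] P.q_pos[OF y] by (simp add: p'_def field_simps)
        have d1: "- p' y \<le> 1 / P.Q z"
        proof -
          have "- (1 / P.Q y) \<le> p' y" unfolding p'_def using True z by (intro P.p_deriv_bound) auto
          moreover have "1 / P.Q y \<le> 1 / P.Q z" using True z P.Q_pos[of z] by (intro divide_left_mono P.Q_mono mult_pos_pos P.Q_pos) auto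
          ultimately show ?thesis by linarith
        qed
        \<comment> \<open>The sign of \<open>- p'\<close> allows \<open>q r\<close> to be discarded;
          no upper bound on \<open>tmean\<close> relative to \<open>q r\<close> is
          available.\<close>
        have "p' y * (P.q y * r y) - p' y * tmean y = - p' y * (tmean y - P.q y * r y)" by (simp add: algebra_simps)
        also have "\<dots> \<le> - p' y * tmean y"
          using d0 P.q_pos[OF y] r_nonneg[of y] by (intro mult_left_mono) auto
        also have "\<dots> \<le> 1 / P.Q z * tmean y" by (intro mult_right_mono d1 tmean_nonneg)
        finally show ?thesis using True by simp
      qed simp
    qed
  qed
  also have "\<dots> = 1 / P.Q z * (\<integral>y. indicator {z<..v} y * tmean y \<partial>lborel)" by simp
  finally show ?thesis unfolding 1 2 3 by simp
qed

text \<open>The clamp identity for the square expresses the truncated second moment \<open>E\<close>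
  through the integral of \<open>2 * y * tail y\<close>. The tail hypothesis bounds this integral by
  \<open>2 / c * E\<close>, which can be absorbed into the left side because
  \<open>c > 2\<close>.\<close>

lemma second_moment_interval_bound:
  assumes c: "c > 2" and z: "0 < z" "z0 \<le> z" "z \<le> v"
    and bound: "AE x in lborel. z0 \<le> x \<longrightarrow> tail x \<le> x * r x / c"
  shows "(\<integral>\<omega>. indicator {z<..v} (X \<omega>) * (X \<omega> * X \<omega>) \<partial>M) \<le> c / (c - 2) * (z\<^sup>2 * tail z)"
proof -
  define E where "E = (\<integral>\<omega>. indicator {z<..v} (X \<omega>) * (X \<omega> * X \<omega>) \<partial>M)"
  have d: "((\<lambda>x. x\<^sup>2) has_real_derivative 2 * y) (at y)" and d': "isCont (\<lambda>y. 2 * y) y" for y :: real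
    by (auto intro!: derivative_eq_intros)
  have cl: "(\<integral>\<omega>. 1 * (clamp_real z v (X \<omega>))\<^sup>2 \<partial>M) = z\<^sup>2 * (\<integral>\<omega>. 1 \<partial>M) + (\<integral>y. indicator {z<..v} y * (2 * y * tail y) \<partial>lborel)"
    "integrable lborel (\<lambda>y. indicator {z<..v} y * (2 * y * tail y))"
    "integrable M (\<lambda>\<omega>. 1 * (clamp_real z v (X \<omega>))\<^sup>2)"
    by (rule expectation_clamp[OF \<open>z \<le> v\<close> d d' X_measurable]; simp)+
  note sp = clamp_split[OF \<open>z \<le> v\<close> _ cl(3)]
  have left: "(\<integral>\<omega>. (if X \<omega> \<le> z then 1 else 0) \<partial>M) = 1 - tail z"
  proof -
    have "(\<integral>\<omega>. (if X \<omega> \<le> z then 1 else 0) \<partial>M) = (\<integral>\<omega>. 1 - (if z < X \<omega> then 1 else 0) \<partial>M)"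
      by (rule Bochner_Integration.integral_cong) auto
    then show ?thesis unfolding tail_integral_def
      by (subst (asm) Bochner_Integration.integral_diff) (auto intro!: integrable_if simp: prob_space)
  qed
  have "(\<integral>y. indicator {z<..v} y * (2 * y * tail y) \<partial>lborel) = E + v\<^sup>2 * tail v - z\<^sup>2 * tail z"
    using cl(1) sp(1) left by (simp add: E_def prob_space power2_eq_square algebra_simps)
  moreover have "(\<integral>y. indicator {z<..v} y * (2 * y * tail y) \<partial>lborel) \<le> (\<integral>y. 2 / c * (r y * (indicator {z<..v} y * (y * y))) \<partial>lborel)"
  proof (rule integral_mono_AE[OF cl(2)])
    have "integrable M (\<lambda>\<omega>. indicator {z<..v} (X \<omega>) * (X \<omega> * X \<omega>))"
      using sp(2) by (simp add: power2_eq_square)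
    then have "integrable lborel (\<lambda>y. r y * (indicator {z<..v} y * (y * y)))"
      using integrable_law[of "\<lambda>y. indicator {z<..v} y * (y * y)"] by simp
    then show "integrable lborel (\<lambda>y. 2 / c * (r y * (indicator {z<..v} y * (y * y))))" by simp
    show "AE y in lborel. indicator {z<..v} y * (2 * y * tail y) \<le> 2 / c * (r y * (indicator {z<..v} y * (y * y)))"
      using bound
    proof eventually_elim
      case (elim y)
      show ?case
      proof (cases "y \<in> {z<..v}")
        case True
        then have "tail y \<le> y * r y / c" "0 \<le> 2 * y" using elim z by auto
        then have "2 * y * tail y \<le> 2 * y * (y * r y / c)" by (rule mult_left_mono)
        then show ?thesis using True by (simp add: mult_ac)
      qed simp
    qed
  qed
  moreover have "(\<integral>y. 2 / c * (r y * (indicator {z<..v} y * (y * y))) \<partial>lborel) = 2 / c * E"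
    unfolding E_def using integral_law[of "\<lambda>y. indicator {z<..v} y * (y * y)"] by simp
  moreover have "0 \<le> v\<^sup>2 * tail v" using tail_nonneg by simp
  ultimately have "E - z\<^sup>2 * tail z \<le> 2 / c * E" by linarith
  then have "c * E - c * (z\<^sup>2 * tail z) \<le> 2 * E" using c by (simp add: field_simps)
  then have "(c - 2) * E \<le> c * (z\<^sup>2 * tail z)" by (simp add: algebra_simps)
  then show ?thesis using c unfolding E_def[symmetric] by (simp add: field_simps)
qed

text \<open>The right and left bounds are weighted by \<open>1 - P.tail z\<close> and
  \<open>P.tail z\<close>, the constants of the two Stein branches, which cancels the boundary
  values at \<open>z\<close>. The result bounds \<open>P.tail z - tail z\<close> by a multiple of
  \<open>tail z\<close> and is solved for \<open>tail z\<close>.\<close>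

lemma tail_comparison:
  assumes c: "c > 2" and z: "0 < z" "z0 \<le> z"
    and bound: "AE x in lborel. z0 \<le> x \<longrightarrow> tail x \<le> x * r x / c"
  shows "(c - 2) * P.Q z / ((c - 2) * P.Q z + 2 * z\<^sup>2) * P.tail z \<le> tail z"
proof -
  have az: "a < ereal z" using z by (intro P.pos_imp_supp) simp
  have Pm: "0 < P.tmean z" by (rule P.tmean_pos[OF az])
  \<comment> \<open>The constant is \<open>2 / (c - 2) = c / (c - 2) - 1\<close>: the second moment
    bound minus the boundary term \<open>z * tmean z\<close>, which is at least
    \<open>z\<^sup>2 * tail z\<close>.\<close>
  define R where "R = 1 / P.Q z * (2 / (c - 2) * (z\<^sup>2 * tail z))"
  have R0: "0 \<le> R" unfolding R_def using c P.Q_pos[of z] tail_nonneg[of z] by simp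
  have 1: "P.p z * tmean z - tail z \<le> R"
  proof -
    have lim: "(tmean \<longlongrightarrow> 0) at_top" by (rule tail_integral_tendsto_0[OF X_integrable])
    \<comment> \<open>A Markov-type bound: above \<open>v\<close> the factor \<open>v\<close> is at
      most \<open>X\<close>, so the term lies below a tail of the second moment.\<close>
    have lim2: "((\<lambda>v. v * tmean v) \<longlongrightarrow> 0) at_top"
    proof (rule tendsto_sandwich)
      show "\<forall>\<^sub>F v in at_top. 0 \<le> v * tmean v"
        using eventually_ge_at_top[of 0] by eventually_elim (simp add: tmean_nonneg)
      show "\<forall>\<^sub>F v in at_top. v * tmean v \<le> tail_integral M (\<lambda>\<omega>. (X \<omega>)\<^sup>2) X v"
        using eventually_ge_at_top[of 0]
      proof eventually_elim
        case (elim v)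
        have "v * tmean v = (\<integral>\<omega>. v * (if v < X \<omega> then X \<omega> else 0) \<partial>M)" by (simp add: tail_integral_def)
        also have "\<dots> \<le> (\<integral>\<omega>. (if v < X \<omega> then (X \<omega>)\<^sup>2 else 0) \<partial>M)"
          using elim X_integrable X_sq_integrable
          by (intro integral_mono integrable_mult_right integrable_if) (auto simp: power2_eq_square intro!: mult_right_mono)
        finally show ?case by (simp add: tail_integral_def)
      qed
      show "(tail_integral M (\<lambda>\<omega>. (X \<omega>)\<^sup>2) X \<longlongrightarrow> 0) at_top" by (rule tail_integral_tendsto_0[OF X_sq_integrable])
    qed simp
    have ev: "\<forall>\<^sub>F v in at_top. P.p z * tmean z - tail z \<le> 1 / z * tmean v + 1 / P.Q z * (v * tmean v) + R"
      using eventually_ge_at_top[of z]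
    proof eventually_elim
      case (elim v)
      have v: "a < ereal v" using z elim by (intro P.pos_imp_supp) simp
      \<comment> \<open>This bounds \<open>p v\<close> uniformly in \<open>v \<ge> z\<close>, so
        that the boundary term \<open>p v * tmean v\<close> vanishes at infinity.\<close>
      have "v * P.p v \<le> 1" by (rule P.x_p_le_1[OF v])
      moreover have "z * P.p v \<le> v * P.p v" using elim P.p_nonneg by (intro mult_right_mono) auto
      ultimately have "P.p v \<le> 1 / z" using z by (simp add: field_simps)
      then have pv: "P.p v * tmean v \<le> 1 / z * tmean v" by (intro mult_right_mono tmean_nonneg)
      define E where "E = (\<integral>\<omega>. indicator {z<..v} (X \<omega>) * (X \<omega> * X \<omega>) \<partial>M)"
      have rb: "P.p z * tmean z - P.p v * tmean v - (tail z - tail v) \<le> 1 / P.Q z * (v * tmean v - z * tmean z + E)"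
        unfolding E_def by (rule right_bound[OF z(1) elim])
      have "E \<le> c / (c - 2) * (z\<^sup>2 * tail z)"
        unfolding E_def by (rule second_moment_interval_bound[OF c z elim bound])
      moreover have "z * (z * tail z) \<le> z * tmean z" using z tmean_ge by (intro mult_left_mono) auto
      moreover have "c / (c - 2) * (z\<^sup>2 * tail z) - z * (z * tail z) = 2 / (c - 2) * (z\<^sup>2 * tail z)"
        using c by (simp add: field_simps power2_eq_square)
      ultimately have "v * tmean v - z * tmean z + E \<le> v * tmean v + 2 / (c - 2) * (z\<^sup>2 * tail z)" by linarith
      then have "1 / P.Q z * (v * tmean v - z * tmean z + E) \<le> 1 / P.Q z * (v * tmean v + 2 / (c - 2) * (z\<^sup>2 * tail z))"
        using P.Q_pos[of z] by (intro mult_left_mono) auto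
      also have "\<dots> = 1 / P.Q z * (v * tmean v) + R" unfolding R_def by (rule distrib_left)
      finally show ?case using rb pv tail_nonneg[of v] by linarith
    qed
    have "((\<lambda>v. 1 / z * tmean v + 1 / P.Q z * (v * tmean v) + R) \<longlongrightarrow> 1 / z * 0 + 1 / P.Q z * 0 + R) at_top"
      by (intro tendsto_add tendsto_mult tendsto_const lim lim2)
    from tendsto_lowerbound[OF this ev] show ?thesis by simp
  qed
  have 2: "1 - tail z \<le> P.s z * tmean z" by (rule left_bound[OF az])
  define \<kappa> where "\<kappa> = tmean z / P.tmean z"
  have pz: "P.p z * tmean z = P.tail z * \<kappa>" "P.s z * tmean z = (1 - P.tail z) * \<kappa>"
    by (simp_all add: P.p_def P.s_def \<kappa>_def)
  have t: "0 \<le> P.tail z" "P.tail z \<le> 1" by (rule P.tail_nonneg, rule P.tail_le_1)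
  \<comment> \<open>The unknown ratio \<open>\<kappa>\<close> is eliminated by combining the bounds on the two sides of \<open>z\<close>.\<close>
  have "(1 - P.tail z) * (P.tail z * \<kappa> - tail z) \<le> (1 - P.tail z) * R"
    using 1 t by (intro mult_left_mono) (auto simp: pz)
  moreover have "P.tail z * (1 - tail z) \<le> P.tail z * ((1 - P.tail z) * \<kappa>)"
    using 2 t by (intro mult_left_mono) (auto simp: pz)
  moreover have "(1 - P.tail z) * R \<le> 1 * R" using t R0 by (intro mult_right_mono) auto
  ultimately have main: "P.tail z - tail z \<le> R" by (simp add: algebra_simps)
  define K where "K = (c - 2) * P.Q z"
  have K: "K > 0" using c P.Q_pos[of z] by (simp add: K_def)
  have "R * K = 2 * (z\<^sup>2 * tail z)"
    using c P.Q_pos[of z] by (simp add: R_def K_def)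
  moreover have "(P.tail z - tail z) * K \<le> R * K" using main K by (intro mult_right_mono) auto
  ultimately have "K * P.tail z \<le> (K + 2 * z\<^sup>2) * tail z" by (simp add: algebra_simps)
  moreover have "0 < K + 2 * z\<^sup>2" using K by (simp add: add_pos_nonneg)
  ultimately show ?thesis unfolding K_def[symmetric] by (simp add: pos_divide_le_eq mult.commute)
qed

end

text \<open>After cancelling \<open>z\<^sup>2\<close>, the coefficient depends on \<open>z\<close>
  only through \<open>\<gamma> / z\<^sup>2\<close>; the limiting denominator is positive because
  \<open>c > 2\<close> and \<open>\<alpha> < 1\<close>.\<close>

lemma coefficient_tendsto:
  assumes c: "c > 2" and \<alpha>: "\<alpha> < 1"
  shows "((\<lambda>z. (c - 2) * pearson_Q \<alpha> \<gamma> z / ((c - 2) * pearson_Q \<alpha> \<gamma> z + 2 * z\<^sup>2))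
     \<longlongrightarrow> ((c - 2) - \<alpha> * (c - 2)) / (c - \<alpha> * (c - 2))) at_top"
proof -
  have z2: "((\<lambda>z::real. \<gamma> / z\<^sup>2) \<longlongrightarrow> 0) at_top"
    by (intro tendsto_divide_0[OF tendsto_const] filterlim_at_top_imp_at_infinity filterlim_pow_at_top filterlim_ident) auto
  have pos: "0 < (c - 2) * (1 - \<alpha>)" using c \<alpha> by simp
  have "((\<lambda>z. (c - 2) * (1 - \<alpha> + \<gamma> / z\<^sup>2) / ((c - 2) * (1 - \<alpha> + \<gamma> / z\<^sup>2) + 2)) \<longlongrightarrow>
     (c - 2) * (1 - \<alpha> + 0) / ((c - 2) * (1 - \<alpha> + 0) + 2)) at_top"
    using pos by (intro tendsto_intros z2) auto
  also have "(c - 2) * (1 - \<alpha> + 0) / ((c - 2) * (1 - \<alpha> + 0) + 2) = ((c - 2) - \<alpha> * (c - 2)) / (c - \<alpha> * (c - 2))"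
    by (simp add: algebra_simps)
  finally show ?thesis
  proof (rule Lim_transform_eventually)
    show "\<forall>\<^sub>F z in at_top. (c - 2) * (1 - \<alpha> + \<gamma> / z\<^sup>2) / ((c - 2) * (1 - \<alpha> + \<gamma> / z\<^sup>2) + 2) =
      (c - 2) * pearson_Q \<alpha> \<gamma> z / ((c - 2) * pearson_Q \<alpha> \<gamma> z + 2 * z\<^sup>2)"
      using eventually_gt_at_top[of 0]
    proof eventually_elim
      case (elim z)
      define w where "w = 1 - \<alpha> + \<gamma> / z\<^sup>2"
      have "pearson_Q \<alpha> \<gamma> z = z\<^sup>2 * w" using elim by (simp add: w_def pearson_Q_def algebra_simps)
      then have "(c - 2) * pearson_Q \<alpha> \<gamma> z = z\<^sup>2 * ((c - 2) * w)"
        "(c - 2) * pearson_Q \<alpha> \<gamma> z + 2 * z\<^sup>2 = z\<^sup>2 * ((c - 2) * w + 2)"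
        by (simp_all add: algebra_simps)
      moreover have "z\<^sup>2 \<noteq> 0" using elim by simp
      ultimately show ?case unfolding w_def by (simp only: mult_divide_mult_cancel_left not_False_eq_True)
    qed
  qed
qed

subsection \<open>The tail bound\<close>

text \<open>By the Lindelof property the null balls, which cover the complement of the support,
  reduce to countably many.\<close>

lemma AE_law_support:
  assumes "prob_space M" and X[measurable]: "X \<in> borel_measurable M"
  shows "AE \<omega> in M. X \<omega> \<in> law_support M X"
proof -
  interpret prob_space M by fact
  define F where "F = {ball x e | x e. 0 < e \<and> \<P>(\<omega> in M. dist (X \<omega>) x < e) = 0}"
  have "\<And>S. S \<in> F \<Longrightarrow> open S" by (auto simp: F_def)
  then obtain F' where F': "F' \<subseteq> F" "countable F'" "\<Union>F' = \<Union>F" by (rule Lindelof)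
  have "AE \<omega> in M. X \<omega> \<notin> S" if "S \<in> F'" for S
  proof -
    have "S \<in> F" using F'(1) that by blast
    then obtain x e where S: "S = ball x e" "\<P>(\<omega> in M. dist (X \<omega>) x < e) = 0"
      unfolding F_def by blast
    have "AE \<omega> in M. \<not> dist (X \<omega>) x < e"
      using S(2) by (subst (asm) prob_eq_0) auto
    then show ?thesis by eventually_elim (auto simp: S dist_commute)
  qed
  then have "AE \<omega> in M. \<forall>S\<in>F'. X \<omega> \<notin> S" using F'(2) by (subst AE_ball_countable) auto
  then show ?thesis
  proof eventually_elim
    case (elim \<omega>)
    then have no: "X \<omega> \<notin> \<Union>F" using F'(3) by blast
    show ?case unfolding law_support_def
    proof (intro CollectI allI impI)
      fix e :: real assume e: "e > 0"
      show "0 < \<P>(\<omega>' in M. dist (X \<omega>') (X \<omega>) < e)"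
      proof (rule ccontr)
        assume "\<not> 0 < \<P>(\<omega>' in M. dist (X \<omega>') (X \<omega>) < e)"
        then have "\<P>(\<omega>' in M. dist (X \<omega>') (X \<omega>) < e) = 0" using measure_nonneg by (metis less_eq_real_def)
        then have "ball (X \<omega>) e \<in> F" using e unfolding F_def by blast
        then show False using no e by (metis UnionI centre_in_ball)
      qed
    qed
  qed
qed

lemma einterval_infinity: "einterval a \<infinity> = {x. a < ereal x}"
  by (auto simp: einterval_def)

text \<open>The topological support contains a finite endpoint \<open>a\<close>, but a law with a
  density does not charge a single point.\<close>

lemma AE_greater_of_law_support:
  assumes "prob_space M" and d: "distributed M lborel X f" and s: "law_support M X = closure (einterval a \<infinity>)"
  shows "AE \<omega> in M. a < ereal (X \<omega>)"
proof -
  interpret prob_space M by fact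
  have X[measurable]: "X \<in> borel_measurable M" using distributed_measurable[OF d] by simp
  have AE: "AE \<omega> in M. X \<omega> \<in> closure (einterval a \<infinity>)" using AE_law_support[OF assms(1) X] unfolding s .
  have single: "AE \<omega> in M. X \<omega> \<noteq> y" for y
  proof -
    have "AE x in distr M lborel X. x \<noteq> y"
      unfolding distributed_distr_eq_density[OF d] using AE_lborel_singleton[of y] distributed_borel_measurable[OF d]
      by (subst AE_density) auto
    then show ?thesis by (subst (asm) AE_distr_iff) auto
  qed
  show ?thesis
  proof (cases a)
    case (real a')
    then have "einterval a \<infinity> = {a'<..}" by (auto simp: einterval_infinity)
    with AE have "AE \<omega> in M. X \<omega> \<in> {a'..}" by simp
    then show ?thesis using single[of a'] by eventually_elim (auto simp: real)
  next
    case PInf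
    then have "einterval a \<infinity> = {}" by (auto simp: einterval_infinity)
    with AE have "AE \<omega> in M. False" by simp
    then show ?thesis by simp
  qed simp
qed

lemma tail_pos_of_law_support:
  assumes "prob_space M" and X[measurable]: "X \<in> borel_measurable M"
    and s: "law_support M X = closure (einterval a \<infinity>)" and a: "a < \<infinity>"
  shows "0 < \<P>(\<omega> in M. z < X \<omega>)"
proof -
  interpret prob_space M by fact
  obtain y0 where y0: "a < ereal y0" using ereal_dense2[OF a] by auto
  \<comment> \<open>The margin 2 keeps the unit ball around \<open>y\<close> to the right of
    \<open>z\<close>.\<close>
  define y where "y = max y0 (z + 2)"
  have "a < ereal y" using y0 by (rule less_le_trans) (simp add: y_def)
  then have "y \<in> law_support M X"
    unfolding s einterval_infinity by (intro subsetD[OF closure_subset]) simp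
  then have "\<forall>e>0. 0 < \<P>(\<omega> in M. dist (X \<omega>) y < e)" unfolding law_support_def by (rule CollectD)
  then have "0 < \<P>(\<omega> in M. dist (X \<omega>) y < 1)" using zero_less_one by blast
  also have "\<dots> \<le> \<P>(\<omega> in M. z < X \<omega>)"
    by (intro finite_measure_mono) (auto simp: y_def dist_real_def)
  finally show ?thesis .
qed

context centered_rv
begin

lemma integrable_indicator_law:
  fixes F :: "'w \<Rightarrow> real"
  assumes F: "integrable M F" and [measurable]: "B \<in> sets borel"
  shows "integrable M (\<lambda>\<omega>. indicator B (X \<omega>) * F \<omega>)"
proof (rule Bochner_Integration.integrable_bound[OF F])
  have [measurable]: "F \<in> borel_measurable M" using F by simp
  show "(\<lambda>\<omega>. indicator B (X \<omega>) * F \<omega>) \<in> borel_measurable M" by measurable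
qed (auto split: split_indicator)

lemma expectation_indicator_mono:
  fixes F H :: "'w \<Rightarrow> real"
  assumes F: "integrable M F" and H: "integrable M H" and B: "B \<in> sets borel" and le: "AE \<omega> in M. F \<omega> \<le> H \<omega>"
  shows "(\<integral>\<omega>. indicator B (X \<omega>) * F \<omega> \<partial>M) \<le> (\<integral>\<omega>. indicator B (X \<omega>) * H \<omega> \<partial>M)"
proof (rule integral_mono_AE[OF integrable_indicator_law[OF F B] integrable_indicator_law[OF H B]])
  show "AE \<omega> in M. indicator B (X \<omega>) * F \<omega> \<le> indicator B (X \<omega>) * H \<omega>"
    using le by eventually_elim (auto split: split_indicator)
qed

lemma expectation_indicator_law:
  assumes [measurable]: "h \<in> borel_measurable borel" "B \<in> sets borel"
  shows "(\<integral>\<omega>. indicator B (X \<omega>) * h (X \<omega>) \<partial>M) = (\<integral>y. indicator B y * (h y * r y) \<partial>lborel)"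
  using integral_law[of "\<lambda>y. indicator B y * h y"] by (simp add: mult_ac)

text \<open>\<open>G\<close> stands for any variable with these set integrals, so the comparison
  covers both the given variable and its conditional expectation given \<open>X\<close>.\<close>

lemma
  assumes G: "integrable M G" and set: "\<And>B. B \<in> sets borel \<Longrightarrow> (\<integral>\<omega>. indicator B (X \<omega>) * G \<omega> \<partial>M) = (\<integral>y. indicator B y * tmean y \<partial>lborel)"
    and h: "h \<in> borel_measurable borel" and hint: "integrable M (\<lambda>\<omega>. h (X \<omega>))"
  shows tmean_ge_AE: "AE \<omega> in M. h (X \<omega>) \<le> G \<omega> \<Longrightarrow> AE x in lborel. h x * r x \<le> tmean x"
    and tmean_le_AE: "AE \<omega> in M. G \<omega> \<le> h (X \<omega>) \<Longrightarrow> AE x in lborel. tmean x \<le> h x * r x"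
proof -
  have ih: "integrable lborel (\<lambda>x. h x * r x)" using hint integrable_law[OF h] by (simp add: mult.commute)
  show "AE x in lborel. h x * r x \<le> tmean x" if "AE \<omega> in M. h (X \<omega>) \<le> G \<omega>"
    using expectation_indicator_mono[OF hint G _ that]
    by (intro AE_le_of_set_integrals ih tmean_integrable) (simp add: expectation_indicator_law[OF h] set)
  show "AE x in lborel. tmean x \<le> h x * r x" if "AE \<omega> in M. G \<omega> \<le> h (X \<omega>)"
    using expectation_indicator_mono[OF G hint _ that]
    by (intro AE_le_of_set_integrals ih tmean_integrable) (simp add: expectation_indicator_law[OF h] set)
qed

text \<open>Chain \<open>z * tail z \<le> tmean z\<close> with the hypothesis and divide by
  \<open>z\<close>; taking \<open>max z0 1\<close> as threshold keeps this division
  legitimate.\<close>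

lemma tail_density_boundI:
  assumes r: "r = (\<lambda>x. max 0 (\<rho> x))" and pos: "\<And>z. 0 < tail z" and c: "0 < c"
    and le: "AE z in lborel. z0 \<le> z \<longrightarrow> tmean z \<le> z\<^sup>2 / c * r z"
  shows "tail_density_bound M X \<rho> c"
  unfolding tail_density_bound_def
proof (intro exI)
  show "AE z in lborel. max z0 1 \<le> z \<longrightarrow> \<P>(\<omega> in M. z < X \<omega>) \<le> z * \<rho> z / c"
    using le
  proof eventually_elim
    case (elim z)
    show ?case
    proof
      assume z: "max z0 1 \<le> z"
      then have "z * tail z \<le> z\<^sup>2 / c * r z" using elim tmean_ge[of z] by simp
      then have "z * tail z \<le> z * (z * r z / c)" by (simp add: power2_eq_square mult_ac)
      then have t: "tail z \<le> z * r z / c" using z by (subst (asm) mult_le_cancel_left_pos) auto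
      \<comment> \<open>A positive tail forces \<open>r z\<close> to be nonzero, and there the
        nonnegative version of the density coincides with \<open>\<rho>\<close>.\<close>
      have "r z \<noteq> 0" using t pos[of z] by auto
      then have "r z = \<rho> z" by (auto simp: r max_def split: if_splits)
      then show "\<P>(\<omega> in M. z < X \<omega>) \<le> z * \<rho> z / c" using t by (simp add: tail_eq)
    qed
  qed
qed

end

lemma pearson_law_of_centered_pearson:
  assumes P: "centered_pearson N Z \<rho>s a \<infinity> \<alpha> \<beta> \<gamma>" and Z2: "integrable N (\<lambda>\<omega>. (Z \<omega>)\<^sup>2)"
  shows "pearson_law N Z \<rho>s a \<alpha> \<beta> \<gamma>"
proof -
  note P' = P[unfolded centered_pearson_def einterval_infinity]
  interpret prob_space N using P' by blast
  have d: "distributed N lborel Z (\<lambda>z. ennreal (\<rho>s z))" using P' by blast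
  have pos: "0 < \<rho>s z" if "a < ereal z" for z using P' that by simp
  have zero: "\<rho>s z = 0" if "\<not> a < ereal z" for z using P' that by simp
  have nn: "0 \<le> \<rho>s z" for z using pos[of z] zero[of z] by (cases "a < ereal z") auto
  have [measurable]: "Z \<in> borel_measurable N" using distributed_measurable[OF d] by simp
  have "sq_integrable N Z" using Z2 by (simp add: sq_integrable_def)
  then interpret C: centered_rv N Z \<rho>s
    using P' nn by unfold_locales auto
  show ?thesis
  proof unfold_locales
    show "a < \<infinity>" "continuous_on UNIV \<rho>s" using P' by auto
    show "C.tmean z = (\<alpha> * z\<^sup>2 + \<beta> * z + \<gamma>) * \<rho>s z" if z: "a < ereal z" for z
    proof -
      have g: "g_star \<rho>s a \<infinity> z = \<alpha> * z\<^sup>2 + \<beta> * z + \<gamma>" using P' z by simp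
      have "C.tmean z = (\<integral>\<omega>. (\<lambda>t. if z < t then t else 0) (Z \<omega>) \<partial>N)" by (simp add: tail_integral_def)
      also have "\<dots> = (\<integral>t. \<rho>s t * (if z < t then t else 0) \<partial>lborel)" by (rule C.integral_law) measurable
      also have "\<dots> = (LBINT y:{z..}. y * \<rho>s y)"
        unfolding set_lebesgue_integral_def
      proof (rule integral_cong_AE)
        show "AE t in lborel. \<rho>s t * (if z < t then t else 0) = indicat_real {z..} t *\<^sub>R (t * \<rho>s t)"
          using AE_lborel_singleton[of z] by eventually_elim (auto split: split_indicator)
      qed measurable
      finally have "C.tmean z / \<rho>s z = \<alpha> * z\<^sup>2 + \<beta> * z + \<gamma>"
        using g z by (simp add: g_star_def einterval_infinity)
      then show ?thesis using pos[OF z] by (simp only: nonzero_divide_eq_eq[OF less_imp_neq[OF pos[OF z], symmetric]])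
    qed
  qed (use pos zero in auto)
qed

theorem corollary21:
  fixes N :: "'v measure" and Z :: "'v \<Rightarrow> real" and \<rho>s :: "real \<Rightarrow> real" and a :: ereal
    and \<alpha> \<beta> \<gamma> :: real
    and M :: "'w measure"
    and W :: "'h::{real_inner, complete_space, second_countable_topology} \<Rightarrow> 'w \<Rightarrow> real"
    and X Y G :: "'w \<Rightarrow> real" and DX DY :: "'w \<Rightarrow> 'h" and \<rho> :: "real \<Rightarrow> real"
  assumes pearson: "centered_pearson N Z \<rho>s a \<infinity> \<alpha> \<beta> \<gamma>"
    and Z_sq: "integrable N (\<lambda>\<omega>. (Z \<omega>)\<^sup>2)"
    and lim_a: "((\<lambda>x. real_of_ereal x ^ 3 * \<rho>s (real_of_ereal x)) \<longlongrightarrow> 0) (at_right a)"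
    and lim_top: "((\<lambda>z. z ^ 3 * \<rho>s z) \<longlongrightarrow> 0) at_top"
    and isonormal: "isonormal_gaussian M W"
    and X_D12: "X \<in> D12 M W"
    and X_centered: "(\<integral>\<omega>. X \<omega> \<partial>M) = 0"
    and X_density: "distributed M lborel X (\<lambda>x. ennreal (\<rho> x))"
    and X_support: "law_support M X = closure (einterval a \<infinity>)"
    and DX: "malliavin_derivative M W X DX"
    and Y: "neg_OU_inverse M W X Y"
    and DY: "malliavin_derivative M W Y DY"
    and G_measurable: "G \<in> borel_measurable M"
    and G: "AE \<omega> in M. G \<omega> = DX \<omega> \<bullet> DY \<omega>"
    and G_lower: "AE \<omega> in M. \<alpha> * (X \<omega>)\<^sup>2 + \<beta> * X \<omega> + \<gamma> \<le> G \<omega>"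
  shows "(\<forall>c>2. tail_density_bound M X \<rho> c \<longrightarrow>
      (\<forall>\<^sub>F z in at_top.
         \<P>(\<omega> in M. z < X \<omega>) \<ge>
           (c - 2) * pearson_Q \<alpha> \<gamma> z / ((c - 2) * pearson_Q \<alpha> \<gamma> z + 2 * z\<^sup>2) *
           \<P>(\<omega> in N. z < Z \<omega>)) \<and>
      ((\<lambda>z. (c - 2) * pearson_Q \<alpha> \<gamma> z / ((c - 2) * pearson_Q \<alpha> \<gamma> z + 2 * z\<^sup>2))
         \<longlongrightarrow> ((c - 2) - \<alpha> * (c - 2)) / (c - \<alpha> * (c - 2))) at_top)
    \<and> (\<forall>g c. cond_exp_given M G X g \<longrightarrow> c > 2 \<longrightarrow>
         (\<exists>z0. AE z in distr M borel X. z0 \<le> z \<longrightarrow> g z \<le> z\<^sup>2 / c) \<longrightarrow>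
         (\<exists>c'>2. tail_density_bound M X \<rho> c'))
    \<and> (\<forall>\<alpha>' \<beta>' \<gamma>' :: real. \<alpha>' < 1/2 \<longrightarrow>
         (AE \<omega> in M. G \<omega> \<le> \<alpha>' * (X \<omega>)\<^sup>2 + \<beta>' * X \<omega> + \<gamma>') \<longrightarrow>
         (\<exists>c'>2. tail_density_bound M X \<rho> c'))"
proof -
  interpret I: isonormal_process M W
  proof (rule isonormal_process.intro)
    show "prob_space M" using isonormal by (simp add: isonormal_gaussian_def)
    show "isonormal_process_axioms M W" by unfold_locales (rule isonormal)
  qed
  interpret P: pearson_law N Z \<rho>s a \<alpha> \<beta> \<gamma>
    by (rule pearson_law_of_centered_pearson[OF pearson Z_sq])
  \<comment> \<open>The given version of the density may take negative values, which
    \<open>ennreal\<close> sends to zero; \<open>r\<close> is a nonnegative version of the same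
    density.\<close>
  define r where "r = (\<lambda>x. max 0 (\<rho> x))"
  have sqX: "sq_integrable M X" and sqDX: "sq_integrable M DX" and sqDY: "sq_integrable M DY"
    using I.malliavin_derivative_ibp_simple[OF DX] I.malliavin_derivative_ibp_simple[OF DY] by auto
  have "(\<lambda>x. ennreal (\<rho> x)) = (\<lambda>x. ennreal (r x))"
    by (auto simp: r_def max_def ennreal_neg)
  then have dens: "distributed M lborel X (\<lambda>x. ennreal (r x))" using X_density by simp
  interpret X: centered_rv M X r
    by unfold_locales (use sqX X_centered dens in \<open>auto simp: r_def\<close>)
  note [measurable] = X.X_measurable G_measurable
  have tail_pos: "0 < X.tail z" for z
    unfolding X.tail_eq by (rule tail_pos_of_law_support[OF I.prob_space_axioms X.X_measurable X_support P.a_less])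
  have Gint: "integrable M G"
    using sq_integrable_inner_integrable[OF sqDX sqDY] integrable_cong_AE[OF _ _ G]
      borel_measurable_integrable G_measurable by blast
  have ibp: "(\<integral>\<omega>. X \<omega> * f (X \<omega>) \<partial>M) = (\<integral>\<omega>. f' (X \<omega>) * G \<omega> \<partial>M)" if f: "lipschitz_C1 f f'" for f f'
  proof -
    obtain [measurable]: "f' \<in> borel_measurable borel" by (rule lipschitz_C1E[OF f]) blast
    note [measurable] = sq_integrable_measurable[OF sqDX] sq_integrable_measurable[OF sqDY]
    have "(\<integral>\<omega>. f' (X \<omega>) * (DX \<omega> \<bullet> DY \<omega>) \<partial>M) = (\<integral>\<omega>. f' (X \<omega>) * G \<omega> \<partial>M)"
      by (rule integral_cong_AE) (use G in \<open>auto elim: eventually_mono\<close>)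
    then show ?thesis using I.malliavin_integration_by_parts[OF DX Y DY X_centered f] by simp
  qed
  have qint: "integrable M (\<lambda>\<omega>. \<alpha>' * (X \<omega>)\<^sup>2 + \<beta>' * X \<omega> + \<gamma>')" for \<alpha>' \<beta>' \<gamma>'
    using X.X_sq_integrable X.X_integrable by simp
  have set: "(\<integral>\<omega>. indicator B (X \<omega>) * G \<omega> \<partial>M) = (\<integral>y. indicator B y * X.tmean y \<partial>lborel)"
    if "B \<in> sets borel" for B
  proof (rule X.tmean_eq_set[OF Gint ibp])
    show "(\<lambda>x. \<bar>\<alpha>\<bar> * x\<^sup>2 + \<bar>\<beta>\<bar> * \<bar>x\<bar> + \<bar>\<gamma>\<bar>) \<in> borel_measurable borel" by measurable
    show "integrable M (\<lambda>\<omega>. \<bar>\<alpha>\<bar> * (X \<omega>)\<^sup>2 + \<bar>\<beta>\<bar> * \<bar>X \<omega>\<bar> + \<bar>\<gamma>\<bar>)"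
      using X.X_sq_integrable X.X_integrable by simp
    show "AE \<omega> in M. - (\<bar>\<alpha>\<bar> * (X \<omega>)\<^sup>2 + \<bar>\<beta>\<bar> * \<bar>X \<omega>\<bar> + \<bar>\<gamma>\<bar>) \<le> G \<omega>"
      using G_lower
    proof eventually_elim
      case (elim \<omega>)
      have "- (\<bar>\<alpha>\<bar> * (X \<omega>)\<^sup>2) \<le> \<alpha> * (X \<omega>)\<^sup>2" using mult_right_mono[of "- \<bar>\<alpha>\<bar>" \<alpha> "(X \<omega>)\<^sup>2"] by simp
      moreover have "- (\<bar>\<beta>\<bar> * \<bar>X \<omega>\<bar>) \<le> \<beta> * X \<omega>" using abs_ge_minus_self[of "\<beta> * X \<omega>"] by (simp add: abs_mult)
      ultimately show ?case using elim abs_ge_minus_self[of \<gamma>] by linarith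
    qed
  qed (use that in auto)
  interpret K: pearson_comparison N Z \<rho>s a \<alpha> \<beta> \<gamma> M X r
  proof unfold_locales
    have "AE x in lborel. (\<alpha> * x\<^sup>2 + \<beta> * x + \<gamma>) * r x \<le> X.tmean x"
      by (rule X.tmean_ge_AE[OF Gint set _ qint G_lower]) auto
    then show "AE x in lborel. a < ereal x \<longrightarrow> P.q x * r x \<le> X.tmean x"
      by eventually_elim (simp add: P.q_def)
    show "AE \<omega> in M. a < ereal (X \<omega>)"
      by (rule AE_greater_of_law_support[OF I.prob_space_axioms X_density X_support])
  qed
  have part1: "\<forall>\<^sub>F z in at_top. \<P>(\<omega> in M. z < X \<omega>) \<ge>
      (c - 2) * pearson_Q \<alpha> \<gamma> z / ((c - 2) * pearson_Q \<alpha> \<gamma> z + 2 * z\<^sup>2) * \<P>(\<omega> in N. z < Z \<omega>)"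
    if c: "c > 2" and bound: "tail_density_bound M X \<rho> c" for c
  proof -
    obtain z0 where z0: "AE z in lborel. z0 \<le> z \<longrightarrow> \<P>(\<omega> in M. z < X \<omega>) \<le> z * \<rho> z / c"
      using bound by (auto simp: tail_density_bound_def)
    have "AE x in lborel. max z0 0 \<le> x \<longrightarrow> X.tail x \<le> x * r x / c"
      using z0
    proof eventually_elim
      case (elim x)
      show ?case
      proof
        assume x: "max z0 0 \<le> x"
        then have "X.tail x \<le> x * \<rho> x / c" using elim by (simp add: X.tail_eq)
        \<comment> \<open>The threshold was raised to a nonnegative number so that replacing
          \<open>\<rho>\<close> by the larger \<open>r\<close> preserves the bound.\<close>
        also have "\<dots> \<le> x * r x / c" using x c by (intro divide_right_mono mult_left_mono) (auto simp: r_def)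
        finally show "X.tail x \<le> x * r x / c" .
      qed
    qed
    then have "(c - 2) * pearson_Q \<alpha> \<gamma> z / ((c - 2) * pearson_Q \<alpha> \<gamma> z + 2 * z\<^sup>2) * P.tail z \<le> X.tail z"
      if "0 < z" "max z0 0 \<le> z" for z
      by (rule K.tail_comparison[OF c that])
    then show ?thesis
      unfolding X.tail_eq P.tail_eq eventually_at_top_linorder
      by (intro exI[of _ "max z0 0 + 1"]) auto
  qed
  have part2: "\<exists>c'>2. tail_density_bound M X \<rho> c'"
    if g: "cond_exp_given M G X g" and c: "c > 2"
      and bound: "\<exists>z0. AE z in distr M borel X. z0 \<le> z \<longrightarrow> g z \<le> z\<^sup>2 / c" for g c
  proof -
    obtain z0 where z0: "AE z in distr M borel X. z0 \<le> z \<longrightarrow> g z \<le> z\<^sup>2 / c" using bound by blast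
    have gm[measurable]: "g \<in> borel_measurable borel" and ce: "AE \<omega> in M. real_cond_exp M (vimage_algebra (space M) X borel) G \<omega> = g (X \<omega>)"
      using g by (auto simp: cond_exp_given_def)
    define F where "F = vimage_algebra (space M) X borel"
    have "subalgebra M F" unfolding subalgebra_def F_def
      by (auto simp: sets_vimage_algebra2)
    then interpret S: finite_measure_subalgebra M F by unfold_locales
    have gX: "integrable M (\<lambda>\<omega>. g (X \<omega>))"
      using S.real_cond_exp_int(1)[OF Gint] ce
      by (subst integrable_cong_AE[of _ _ "real_cond_exp M F G"]) (auto simp: F_def elim: eventually_mono)
    \<comment> \<open>Preimages of Borel sets under \<open>X\<close> belong to the conditioning
      sigma-algebra, so \<open>g(X)\<close> has the same set integrals as \<open>G\<close>.\<close>
    have gset: "(\<integral>\<omega>. indicator B (X \<omega>) * g (X \<omega>) \<partial>M) = (\<integral>y. indicator B y * X.tmean y \<partial>lborel)"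
      if B[measurable]: "B \<in> sets borel" for B
    proof -
      define A where "A = X -` B \<inter> space M"
      have A: "A \<in> sets F" unfolding A_def F_def using B by (rule in_vimage_algebra)
      have ind: "indicator A \<omega> = (indicator B (X \<omega>) :: real)" if "\<omega> \<in> space M" for \<omega>
        using that by (auto simp: A_def split: split_indicator)
      have "(\<integral>\<omega>. indicator B (X \<omega>) * G \<omega> \<partial>M) = (\<integral>\<omega>\<in>A. G \<omega> \<partial>M)"
        unfolding set_lebesgue_integral_def by (rule Bochner_Integration.integral_cong) (auto simp: ind)
      also have "\<dots> = (\<integral>\<omega>\<in>A. real_cond_exp M F G \<omega> \<partial>M)" by (rule S.real_cond_exp_intA[OF Gint A])
      also have "\<dots> = (\<integral>\<omega>. indicator B (X \<omega>) * real_cond_exp M F G \<omega> \<partial>M)"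
        unfolding set_lebesgue_integral_def by (rule Bochner_Integration.integral_cong) (auto simp: ind)
      also have "\<dots> = (\<integral>\<omega>. indicator B (X \<omega>) * g (X \<omega>) \<partial>M)"
        by (rule integral_cong_AE) (use ce in \<open>auto simp: F_def elim: eventually_mono\<close>)
      finally show ?thesis using set[OF B] by simp
    qed
    have le: "AE \<omega> in M. z0 \<le> X \<omega> \<longrightarrow> g (X \<omega>) \<le> (X \<omega>)\<^sup>2 / c"
      using z0 by (subst (asm) AE_distr_iff) auto
    \<comment> \<open>The quadratic bound is known only from \<open>z0\<close> on; below that, the
      comparison function is \<open>g\<close> itself, so that it dominates \<open>g\<close>
      everywhere.\<close>
    have hint: "integrable M (\<lambda>\<omega>. if z0 \<le> X \<omega> then (X \<omega>)\<^sup>2 / c else g (X \<omega>))"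
    proof (rule Bochner_Integration.integrable_bound)
      show "integrable M (\<lambda>\<omega>. (X \<omega>)\<^sup>2 / c + \<bar>g (X \<omega>)\<bar>)" using X.X_sq_integrable gX by simp
    qed (use c in auto)
    have "AE x in lborel. X.tmean x \<le> (if z0 \<le> x then x\<^sup>2 / c else g x) * r x"
      by (rule X.tmean_le_AE[OF gX gset _ hint]) (use le in \<open>auto elim: eventually_mono\<close>)
    then have "AE x in lborel. z0 \<le> x \<longrightarrow> X.tmean x \<le> x\<^sup>2 / c * r x" by eventually_elim auto
    then have "tail_density_bound M X \<rho> c"
      using c by (intro X.tail_density_boundI[OF r_def tail_pos]) auto
    then show ?thesis using c by blast
  qed
  have part3: "\<exists>c'>2. tail_density_bound M X \<rho> c'"
    if \<alpha>': "\<alpha>' < 1/2" and upper: "AE \<omega> in M. G \<omega> \<le> \<alpha>' * (X \<omega>)\<^sup>2 + \<beta>' * X \<omega> + \<gamma>'" for \<alpha>' \<beta>' \<gamma>' :: real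
  proof -
    \<comment> \<open>The midpoint between \<open>max \<alpha>' 0\<close> and \<open>1/2\<close>. It
      exceeds \<open>\<alpha>'\<close>, which absorbs the lower-order terms for large
      \<open>z\<close>, and it lies strictly between 0 and \<open>1/2\<close>, so
      \<open>1 / m\<close> is an admissible constant above 2.\<close>
    define m where "m = (max \<alpha>' 0 + 1/2) / 2"
    have m: "0 < m" "m < 1/2" "\<alpha>' < m" using \<alpha>' by (auto simp: m_def max_def)
    have "((\<lambda>z. \<alpha>' + \<beta>' / z + \<gamma>' / z\<^sup>2) \<longlongrightarrow> \<alpha>' + 0 + 0) at_top"
      by (intro tendsto_intros tendsto_divide_0[OF tendsto_const] filterlim_at_top_imp_at_infinity filterlim_pow_at_top filterlim_ident) auto
    then have "\<forall>\<^sub>F z in at_top. \<alpha>' + \<beta>' / z + \<gamma>' / z\<^sup>2 < m" using m(3) by (auto dest: order_tendstoD(2))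
    then have "\<forall>\<^sub>F z in at_top. \<alpha>' * z\<^sup>2 + \<beta>' * z + \<gamma>' \<le> z\<^sup>2 * m"
      using eventually_gt_at_top[of 0]
    proof eventually_elim
      case (elim z)
      have "\<alpha>' * z\<^sup>2 + \<beta>' * z + \<gamma>' = z\<^sup>2 * (\<alpha>' + \<beta>' / z + \<gamma>' / z\<^sup>2)"
        using elim(2) by (simp add: field_simps power2_eq_square)
      also have "\<dots> \<le> z\<^sup>2 * m" using elim(1) by (intro mult_left_mono) auto
      finally show ?case .
    qed
    then obtain z0 where z0: "\<And>z. z0 \<le> z \<Longrightarrow> \<alpha>' * z\<^sup>2 + \<beta>' * z + \<gamma>' \<le> z\<^sup>2 * m"
      by (auto simp: eventually_at_top_linorder)
    have "AE x in lborel. X.tmean x \<le> (\<alpha>' * x\<^sup>2 + \<beta>' * x + \<gamma>') * r x"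
      by (rule X.tmean_le_AE[OF Gint set _ qint upper]) auto
    then have "AE x in lborel. z0 \<le> x \<longrightarrow> X.tmean x \<le> x\<^sup>2 / (1 / m) * r x"
    proof eventually_elim
      case (elim x)
      show ?case
      proof
        assume "z0 \<le> x"
        have "(\<alpha>' * x\<^sup>2 + \<beta>' * x + \<gamma>') * r x \<le> (x\<^sup>2 * m) * r x"
          by (intro mult_right_mono z0 \<open>z0 \<le> x\<close> X.r_nonneg)
        then show "X.tmean x \<le> x\<^sup>2 / (1 / m) * r x" using elim by simp
      qed
    qed
    then have "tail_density_bound M X \<rho> (1 / m)"
      using m by (intro X.tail_density_boundI[OF r_def tail_pos]) auto
    moreover have "2 < 1 / m" using m by (simp add: field_simps)
    ultimately show ?thesis by blast
  qed
  show ?thesis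
    using part1 part2 part3 coefficient_tendsto[OF _ P.alpha_less_1] by blast
qed

end
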